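(* Let $w(v,I)=(1+|v|+\sqrt I)^{\beta}$ with $\beta>5$. Assume $F_0(x,v,I)=M(v,I)+\sqrt{M(v,I)}\,f_0(x,v,I)\ge 0$ with $\|wf_0\|_\infty<\infty$. Then there is a positive constant $C_1>0$, depending only on $\beta,\alpha,\delta$, and a positive time $$T_1=\frac{1}{8C_1(1+\|wf_0\|_\infty)}>0,$$ such that the Cauchy problem $$\partial_tF+v\cdot\nabla_xF=Q(F,F),\qquad F(0,x,v,I)=F_0(x,v,I)$$ has a unique mild solution $F(t,x,v,I)=M(v,I)+\sqrt{M(v,I)}\,f(t,x,v,I)\ge 0$ for $(t,x,v,I)\in[0,T_1]\times\mathbb T^3\times\mathbb R^3\times\mathbb R_+$ satisfying $$\sup_{0\le t\le T_1}\|wf(t)\|_\infty\le 2\|wf_0\|_\infty .$$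
   Context: $\mathbb T^3=(\mathbb R/2\pi\mathbb Z)^3$ and $\mathbb R_+=(0,\infty)$. Fix $\delta\in[2,\infty)$, $\alpha\in[0,2]$ and a constant $C_\sigma>0$ (constants may depend on the fixed number $C_\sigma$). For $v,v_*,v',v'_*\in\mathbb R^3$ and $I,I_*,I',I'_*\in\mathbb R_+$ put $u=v-v_*$, $u'=v'-v'_*$, $\Phi=\frac{|u|^2}{4}+I+I_*$. Let $$W=W(v,v_*,I,I_*|v',v'_*,I',I'_* )=4(II_* )^{\delta/2-1}\,\sigma\,\frac{|u|}{|u'|}\,\delta_3(v+v_*-v'-v'_* )\,\delta_1\Big(\tfrac{|v|^2}{2}+\tfrac{|v_*|^2}{2}+I+I_*-\tfrac{|v'|^2}{2}-\tfrac{|v'_*|^2}{2}-I'-I'_*\Big),$$ $$\sigma=C_\sigma\frac{\sqrt{|u|^2+4I+4I_*-4I'-4I'_*}}{|u|\,\Phi^{\delta+(\alpha-1)/2}}(I'I'_* )^{\delta/2-1},$$ where $\delta_3,\delta_1$ are Dirac delta functions on $\mathbb R^3$ and $\mathbb R$. In the usual sense this means that for a function $G$, $\int W\,G\,dv'dv'_*=2C_\sigma\frac{(II_*I'I'_* )^{\delta/2-1}}{\Phi^{\delta+(\alpha-1)/2}}\sqrt{\Phi-I'-I'_*}\int_{\mathbb S^2}G\,d\omega$ if $I'+I'_*<\Phi$, with $G$ evaluated at $v'=\frac{v+v_*}2+\sqrt{\Phi-I'-I'_*}\,\omega$, $v'_*=\frac{v+v_*}2-\sqrt{\Phi-I'-I'_*}\,\omega$,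 and $0$ otherwise. For a function $g$ of $(v,I)$ (possibly also of $(t,x)$), $g_*,g',g'_*$ denote its values at $(v_*,I_* ),(v',I'),(v'_*,I'_* )$. Write $d\mu=dv_*dv'dv'_*dI_*dI'dI'_*$ on $(\mathbb R^3)^3\times(\mathbb R_+)^3$. The collision operator is $$Q(F,G)=\int W\Big(\frac{F'G'_*}{(I'I'_* )^{\delta/2-1}}-\frac{FG_*}{(II_* )^{\delta/2-1}}\Big)d\mu .$$ The equilibrium is $M(v,I)=\frac{I^{\delta/2-1}}{(2\pi)^{3/2}\Gamma(\delta/2)}e^{-|v|^2/2-I}$ ($\Gamma(\delta/2)$ the Gamma function). Define $$\nu(v,I)=\int W\frac{M_*}{(II_* )^{\delta/2-1}}d\mu,\qquad K=K_2-K_1,\qquad K_1f=\int W\frac{\sqrt{MM_*}}{(II_* )^{\delta/2-1}}f_*\,d\mu,$$ $$K_2f=\frac1{\sqrt M}\int W\Big(\frac{M'\sqrt{M'_*}}{(I'I'_* )^{\delta/2-1}}f'_*+\frac{M'_*\sqrt{M'}}{(I'I'_* )^{\delta/2-1}}f'\Big)d\mu,\qquad \Gamma(f,g)=\frac1{\sqrt M}Q(\sqrt Mf,\sqrt Mg).$$ A mild solution is $F=M+\sqrt Mf$ with $f$ satisfying $$f(t,x,v,I)=e^{-\nu(v,I)t}f_0(x-vt,v,I)+\int_0^te^{-\nu(v,I)(t-s)}(Kf)(s,x-v(t-s),v,I)\,ds+\int_0^te^{-\nu(v,I)(t-s)}\Gamma(f,f)(s,x-v(t-s),v,I)\,ds.$$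 For $g=g(t,x,v,I)$, $\|g(t)\|_\infty=\sup_{x\in\mathbb T^3,v\in\mathbb R^3,I\in\mathbb R_+}|g(t,x,v,I)|$, and similarly for functions of $(x,v,I)$. *)

theory Defs
  imports "HOL-Analysis.Analysis"
begin

section \<open>The collision kernel\<close>

text \<open>Surface measure of the unit sphere of \<open>\<real>\<^sup>3\<close>, carried by the Borel sets of \<open>\<real>\<^sup>3\<close>: the measure of
  \<open>A\<close> is \<open>3\<close> times the volume of the cone \<open>{r\<omega> | 0 < r < 1, \<omega> \<in> A, |\<omega>| = 1}\<close>, so the total mass is
  \<open>4\<pi>\<close>.\<close>

definition sphere_measure :: "(real^3) measure" where
  "sphere_measure =
     distr (density lborel (\<lambda>x. 3 * indicator (ball 0 1) x)) borel (\<lambda>x. x /\<^sub>R norm x)"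

text \<open>Subscript stars are rendered by a final \<open>s\<close>, so \<open>vs, Is, vs', Is'\<close> stand for
  \<open>v\<^sub>*, I\<^sub>*, v'\<^sub>*, I'\<^sub>*\<close>.\<close>

definition coll_energy :: "real^3 \<Rightarrow> real^3 \<Rightarrow> real \<Rightarrow> real \<Rightarrow> real" where
  "coll_energy v vs I Is = (norm (v - vs))\<^sup>2 / 4 + I + Is"

text \<open>What remains of \<open>W\<close> as a density in \<open>(v\<^sub>*, I\<^sub>*, I', I'\<^sub>*, \<omega>)\<close> once the two Dirac deltas are
  integrated out over \<open>(v', v'\<^sub>*)\<close>. Put \<open>s = sqrt (\<Phi> - I' - I'\<^sub>*)\<close>, so \<open>|u'| = 2s\<close> on the support;
  in the variables centre of mass and \<open>u' = r\<omega>\<close> the momentum delta contributes \<open>1/8\<close> and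
  the energy delta \<open>r\<^sup>2 \<cdot> 2/r\<close> at \<open>r = 2s\<close>, hence \<open>s/2\<close> altogether, and
  \<open>4 (I I\<^sub>*)\<^bsup>\<delta>/2-1\<^esup> \<cdot> \<sigma> \<cdot> |u|/|u'| \<cdot> s/2\<close> is the value below.\<close>

definition W_density ::
  "real \<Rightarrow> real \<Rightarrow> real \<Rightarrow> real^3 \<Rightarrow> real \<Rightarrow> real^3 \<Rightarrow> real \<Rightarrow> real \<Rightarrow> real \<Rightarrow> real" where
  "W_density \<delta> \<alpha> C v I vs Is I' Is' =
     (let \<Phi> = coll_energy v vs I Is in
      if I' + Is' < \<Phi>
      then 2 * C * (I * Is * I' * Is') powr (\<delta> / 2 - 1) / \<Phi> powr (\<delta> + (\<alpha> - 1) / 2)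
             * sqrt (\<Phi> - I' - Is')
      else 0)"

text \<open>For fixed \<open>(v, I)\<close>, the measure \<open>W d\<mu>\<close> on \<open>(\<real>\<^sup>3)\<^sup>3 \<times> (0,\<infinity>)\<^sup>3\<close>, in the variables
  \<open>(v\<^sub>*, v', v'\<^sub>*, I\<^sub>*, I', I'\<^sub>*)\<close>: \<open>W\<close> is a distribution supported on the set of collisions, so it
  is rendered as the image of \<open>W_density dv\<^sub>* dI\<^sub>* dI' dI'\<^sub>* d\<omega>\<close> under the parametrisation of the
  post-collisional velocities.
  An integral \<open>\<integral> W G d\<mu>\<close> is the Bochner integral of \<open>G\<close> for this measure.\<close>

definition W_measure ::
  "real \<Rightarrow> real \<Rightarrow> real \<Rightarrow> real^3 \<Rightarrow> real \<Rightarrow>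
     ((real^3) \<times> (real^3) \<times> (real^3) \<times> real \<times> real \<times> real) measure" where
  "W_measure \<delta> \<alpha> C v I =
     restrict_space
       (distr
          (density ((lborel :: ((real^3) \<times> real \<times> real \<times> real) measure) \<Otimes>\<^sub>M sphere_measure)
             (\<lambda>((vs, Is, I', Is'), \<omega>). ennreal (W_density \<delta> \<alpha> C v I vs Is I' Is')))
          borel
          (\<lambda>((vs, Is, I', Is'), \<omega>).
             let c = (v + vs) /\<^sub>R 2;
                 s = sqrt (coll_energy v vs I Is - I' - Is')
             in (vs, c + s *\<^sub>R \<omega>, c - s *\<^sub>R \<omega>, Is, I', Is')))
       (UNIV \<times> UNIV \<times> UNIV \<times> {0<..} \<times> {0<..} \<times> {0<..})"


section \<open>Equilibrium and collision operators\<close>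

definition maxwellian :: "real \<Rightarrow> real^3 \<Rightarrow> real \<Rightarrow> real" where
  "maxwellian \<delta> v I =
     I powr (\<delta> / 2 - 1) / ((2 * pi) powr (3 / 2) * Gamma (\<delta> / 2)) * exp (- (norm v)\<^sup>2 / 2 - I)"

text \<open>The integrands are named separately from the operators because a Bochner integral of a
  non-integrable function is \<open>0\<close>; their integrability is part of the notion of mild solution.\<close>

definition Q_integrand ::
  "real \<Rightarrow> (real^3 \<Rightarrow> real \<Rightarrow> real) \<Rightarrow> (real^3 \<Rightarrow> real \<Rightarrow> real) \<Rightarrow> real^3 \<Rightarrow> real \<Rightarrow>
     (real^3) \<times> (real^3) \<times> (real^3) \<times> real \<times> real \<times> real \<Rightarrow> real" where
  "Q_integrand \<delta> F G v I = (\<lambda>(vs, v', vs', Is, I', Is').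
     F v' I' * G vs' Is' / (I' * Is') powr (\<delta> / 2 - 1)
     - F v I * G vs Is / (I * Is) powr (\<delta> / 2 - 1))"

definition coll_Q ::
  "real \<Rightarrow> real \<Rightarrow> real \<Rightarrow> (real^3 \<Rightarrow> real \<Rightarrow> real) \<Rightarrow> (real^3 \<Rightarrow> real \<Rightarrow> real) \<Rightarrow> real^3 \<Rightarrow> real \<Rightarrow> real" where
  "coll_Q \<delta> \<alpha> C F G v I = (\<integral>z. Q_integrand \<delta> F G v I z \<partial>W_measure \<delta> \<alpha> C v I)"

definition nu_integrand ::
  "real \<Rightarrow> real^3 \<Rightarrow> real \<Rightarrow> (real^3) \<times> (real^3) \<times> (real^3) \<times> real \<times> real \<times> real \<Rightarrow> real" where
  "nu_integrand \<delta> v I = (\<lambda>(vs, v', vs', Is, I', Is').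
     maxwellian \<delta> vs Is / (I * Is) powr (\<delta> / 2 - 1))"

definition coll_nu :: "real \<Rightarrow> real \<Rightarrow> real \<Rightarrow> real^3 \<Rightarrow> real \<Rightarrow> real" where
  "coll_nu \<delta> \<alpha> C v I = (\<integral>z. nu_integrand \<delta> v I z \<partial>W_measure \<delta> \<alpha> C v I)"

definition K1_integrand ::
  "real \<Rightarrow> (real^3 \<Rightarrow> real \<Rightarrow> real) \<Rightarrow> real^3 \<Rightarrow> real \<Rightarrow>
     (real^3) \<times> (real^3) \<times> (real^3) \<times> real \<times> real \<times> real \<Rightarrow> real" where
  "K1_integrand \<delta> f v I = (\<lambda>(vs, v', vs', Is, I', Is').
     sqrt (maxwellian \<delta> v I * maxwellian \<delta> vs Is) / (I * Is) powr (\<delta> / 2 - 1) * f vs Is)"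

definition coll_K1 ::
  "real \<Rightarrow> real \<Rightarrow> real \<Rightarrow> (real^3 \<Rightarrow> real \<Rightarrow> real) \<Rightarrow> real^3 \<Rightarrow> real \<Rightarrow> real" where
  "coll_K1 \<delta> \<alpha> C f v I = (\<integral>z. K1_integrand \<delta> f v I z \<partial>W_measure \<delta> \<alpha> C v I)"

definition K2_integrand ::
  "real \<Rightarrow> (real^3 \<Rightarrow> real \<Rightarrow> real) \<Rightarrow>
     (real^3) \<times> (real^3) \<times> (real^3) \<times> real \<times> real \<times> real \<Rightarrow> real" where
  "K2_integrand \<delta> f = (\<lambda>(vs, v', vs', Is, I', Is').
     maxwellian \<delta> v' I' * sqrt (maxwellian \<delta> vs' Is') / (I' * Is') powr (\<delta> / 2 - 1) * f vs' Is'
     + maxwellian \<delta> vs' Is' * sqrt (maxwellian \<delta> v' I') / (I' * Is') powr (\<delta> / 2 - 1) * f v' I')"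

definition coll_K2 ::
  "real \<Rightarrow> real \<Rightarrow> real \<Rightarrow> (real^3 \<Rightarrow> real \<Rightarrow> real) \<Rightarrow> real^3 \<Rightarrow> real \<Rightarrow> real" where
  "coll_K2 \<delta> \<alpha> C f v I =
     1 / sqrt (maxwellian \<delta> v I) * (\<integral>z. K2_integrand \<delta> f z \<partial>W_measure \<delta> \<alpha> C v I)"

definition coll_K ::
  "real \<Rightarrow> real \<Rightarrow> real \<Rightarrow> (real^3 \<Rightarrow> real \<Rightarrow> real) \<Rightarrow> real^3 \<Rightarrow> real \<Rightarrow> real" where
  "coll_K \<delta> \<alpha> C f v I = coll_K2 \<delta> \<alpha> C f v I - coll_K1 \<delta> \<alpha> C f v I"

definition sqrt_maxw_mult :: "real \<Rightarrow> (real^3 \<Rightarrow> real \<Rightarrow> real) \<Rightarrow> real^3 \<Rightarrow> real \<Rightarrow> real" where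
  "sqrt_maxw_mult \<delta> f v I = sqrt (maxwellian \<delta> v I) * f v I"

definition coll_Gamma ::
  "real \<Rightarrow> real \<Rightarrow> real \<Rightarrow> (real^3 \<Rightarrow> real \<Rightarrow> real) \<Rightarrow> (real^3 \<Rightarrow> real \<Rightarrow> real) \<Rightarrow> real^3 \<Rightarrow> real \<Rightarrow> real" where
  "coll_Gamma \<delta> \<alpha> C f g v I =
     1 / sqrt (maxwellian \<delta> v I)
       * coll_Q \<delta> \<alpha> C (sqrt_maxw_mult \<delta> f) (sqrt_maxw_mult \<delta> g) v I"


section \<open>Weighted norms, the torus, mild solutions\<close>

definition weight :: "real \<Rightarrow> real^3 \<Rightarrow> real \<Rightarrow> real" where
  "weight \<beta> v I = (1 + norm v + sqrt I) powr \<beta>"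

text \<open>All functions of \<open>(x, v, I)\<close> are total in \<open>I\<close>, but only their values at \<open>I > 0\<close> matter. The
  supremum is over all points and may be \<open>\<infinity>\<close>.\<close>

definition sup_norm :: "(real^3 \<Rightarrow> real^3 \<Rightarrow> real \<Rightarrow> real) \<Rightarrow> ennreal" where
  "sup_norm g = (SUP x. SUP v. SUP I\<in>{0<..}. ennreal \<bar>g x v I\<bar>)"

text \<open>Functions on \<open>(\<real>/2\<pi>\<int>)\<^sup>3\<close> are functions on \<open>\<real>\<^sup>3\<close> that are \<open>2\<pi>\<close>-periodic in each coordinate.\<close>

definition torus_fun :: "(real^3 \<Rightarrow> real^3 \<Rightarrow> real \<Rightarrow> real) \<Rightarrow> bool" where
  "torus_fun g \<longleftrightarrow> (\<forall>x v I k. 0 < I \<longrightarrow> g (x + axis k (2 * pi)) v I = g x v I)"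

definition admissible_data :: "(real^3 \<Rightarrow> real^3 \<Rightarrow> real \<Rightarrow> real) \<Rightarrow> bool" where
  "admissible_data g \<longleftrightarrow>
     torus_fun g \<and>
     (\<lambda>(x, v, I). g x v I) \<in> borel_measurable (restrict_space borel (UNIV \<times> UNIV \<times> {0<..}))"

definition mild_perturbation ::
  "real \<Rightarrow> real \<Rightarrow> real \<Rightarrow> real \<Rightarrow> (real^3 \<Rightarrow> real^3 \<Rightarrow> real \<Rightarrow> real) \<Rightarrow>
     (real \<Rightarrow> real^3 \<Rightarrow> real^3 \<Rightarrow> real \<Rightarrow> real) \<Rightarrow> bool" where
  "mild_perturbation \<delta> \<alpha> C T f0 f \<longleftrightarrow>
     (\<forall>t\<in>{0..T}. torus_fun (f t)) \<and>
     (\<lambda>(t, x, v, I). f t x v I)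
       \<in> borel_measurable (restrict_space borel ({0..T} \<times> UNIV \<times> UNIV \<times> {0<..})) \<and>
     (\<forall>t\<in>{0..T}. \<forall>x v. \<forall>I>0.
        integrable (W_measure \<delta> \<alpha> C v I) (nu_integrand \<delta> v I) \<and>
        integrable (W_measure \<delta> \<alpha> C v I) (K1_integrand \<delta> (f t x) v I) \<and>
        integrable (W_measure \<delta> \<alpha> C v I) (K2_integrand \<delta> (f t x)) \<and>
        integrable (W_measure \<delta> \<alpha> C v I)
          (Q_integrand \<delta> (sqrt_maxw_mult \<delta> (f t x)) (sqrt_maxw_mult \<delta> (f t x)) v I)) \<and>
     (\<forall>t\<in>{0..T}. \<forall>x v. \<forall>I>0.
        set_integrable lborel {0..t}
          (\<lambda>s. exp (- coll_nu \<delta> \<alpha> C v I * (t - s))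
                 * coll_K \<delta> \<alpha> C (f s (x - (t - s) *\<^sub>R v)) v I) \<and>
        set_integrable lborel {0..t}
          (\<lambda>s. exp (- coll_nu \<delta> \<alpha> C v I * (t - s))
                 * coll_Gamma \<delta> \<alpha> C (f s (x - (t - s) *\<^sub>R v)) (f s (x - (t - s) *\<^sub>R v)) v I) \<and>
        f t x v I =
          exp (- coll_nu \<delta> \<alpha> C v I * t) * f0 (x - t *\<^sub>R v) v I
          + (LBINT s:{0..t}. exp (- coll_nu \<delta> \<alpha> C v I * (t - s))
               * coll_K \<delta> \<alpha> C (f s (x - (t - s) *\<^sub>R v)) v I)
          + (LBINT s:{0..t}. exp (- coll_nu \<delta> \<alpha> C v I * (t - s))
               * coll_Gamma \<delta> \<alpha> C (f s (x - (t - s) *\<^sub>R v)) (f s (x - (t - s) *\<^sub>R v)) v I))"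

text \<open>\<open>F = M + \<surd>M f\<close> is a mild solution on \<open>[0, T]\<close> of the Cauchy problem with datum
  \<open>F\<^sub>0 = M + \<surd>M f\<^sub>0\<close>. Since \<open>M > 0\<close> for \<open>I > 0\<close>, \<open>F\<close> and \<open>f\<close> determine each other.\<close>

definition mild_solution ::
  "real \<Rightarrow> real \<Rightarrow> real \<Rightarrow> real \<Rightarrow> (real^3 \<Rightarrow> real^3 \<Rightarrow> real \<Rightarrow> real) \<Rightarrow>
     (real \<Rightarrow> real^3 \<Rightarrow> real^3 \<Rightarrow> real \<Rightarrow> real) \<Rightarrow> (real \<Rightarrow> real^3 \<Rightarrow> real^3 \<Rightarrow> real \<Rightarrow> real) \<Rightarrow> bool" where
  "mild_solution \<delta> \<alpha> C T f0 F f \<longleftrightarrow>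
     (\<forall>t\<in>{0..T}. \<forall>x v. \<forall>I>0.
        F t x v I = maxwellian \<delta> v I + sqrt (maxwellian \<delta> v I) * f t x v I) \<and>
     mild_perturbation \<delta> \<alpha> C T f0 f"

end

theory Submission
  imports Defs
begin

text \<open>The obstacle is the loss term. It multiplies \<open>F\<close> by a collision frequency that grows like
  \<open>(1 + |v| + \<surd>I)\<^bsup>2-\<alpha>\<^esup>\<close>, so for \<open>\<alpha> < 2\<close> it is unbounded in every weighted supremum norm and does not become
  small for short times. It has a sign, however: the frequency is nonnegative as long as \<open>F \<ge> 0\<close>. The equation is
  therefore solved along the characteristics \<open>x + t v\<close>, where for fixed \<open>(v, I)\<close> it is a scalar equation
  \<open>f' = source - damp \<cdot> f\<close> with the whole frequency \<open>damp\<close> on the left. A comparison argument gives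
  \<open>|f(t)| \<le> |f(0)| + t sup |source|\<close> whatever the size of \<open>damp\<close> (\<open>damped_bound\<close>). The same argument for \<open>\<surd>M + f\<close>
  gives \<open>F \<ge> 0\<close>, because \<open>source + \<surd>M damp\<close> is the gain part of \<open>Q(F, F) / \<surd>M\<close>
  (\<open>source_damp_nonneg\<close>).

  It remains to estimate the source, that is, \<open>K\<close> and the gain part of \<open>\<Gamma>\<close>. On the collision set conservation
  of energy trades \<open>\<surd>M'\<surd>M'\<^sub>*\<close> for \<open>\<surd>M\<surd>M\<^sub>*\<close>, after which gain and loss have the common majorant
  \<open>\<Phi>\<^bsup>-1-\<alpha>/2\<^esup> exp (- (|v\<^sub>*|\<^sup>2 + I\<^sub>*) / 4)\<close> on \<open>I' + I'\<^sub>* < \<Phi>\<close> (\<open>kernels_dominated\<close>). A weighted function decays at least like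
  \<open>(1 + I')\<^bsup>-2\<^esup>\<close>, and with this decay in one outgoing energy the majorant is integrable, uniformly in
  \<open>(v, I)\<close> (\<open>energy_powr_gain_le\<close>). A weighted bound for the gain follows because one outgoing particle
  carries half of the energy of \<open>(v, I)\<close> (\<open>inverse_weights_le\<close>).

  The solution is the limit of the iteration that solves the linear problem with coefficients frozen at the
  previous iterate. Contraction holds in the supremum norm without weight (\<open>char_solution_diff\<close>):
  the difference of two frequencies grows at most like \<open>(1 + |v| + \<surd>I)\<^sup>2\<close>, and it multiplies a function that is
  \<open>O(1 / w)\<close>. The time \<open>T\<^sub>1\<close> is chosen so that the ball of radius \<open>2 \<parallel>w f\<^sub>0\<parallel>\<close> is invariant and the
  contraction factor is at most \<open>1 / 2\<close>. Uniqueness is the same contraction, since every nonnegative mild solution in the ball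
  solves the equation along characteristics. That equivalence is a product rule for absolutely continuous
  functions, applied to \<open>exp (\<nu> t) f\<close> (\<open>char_solution_imp_mild\<close>, \<open>mild_imp_char_solution\<close>).\<close>

section \<open>Absolutely continuous functions and damped linear equations\<close>

text \<open>\<open>u\<close> is Lipschitz on \<open>[0, T]\<close> with almost everywhere derivative \<open>U\<close>. The collision terms are
  only measurable in time, so the equation along a characteristic holds in this integrated sense.
  Both functions are Borel on the whole line so that products of them are again integrands.\<close>

definition abs_prim_on :: "real \<Rightarrow> (real \<Rightarrow> real) \<Rightarrow> (real \<Rightarrow> real) \<Rightarrow> bool" where
  "abs_prim_on T u U \<longleftrightarrow>
     u \<in> borel_measurable borel \<and> U \<in> borel_measurable borel \<and>
     (\<exists>B. \<forall>s\<in>{0..T}. \<bar>U s\<bar> \<le> B) \<and>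
     (\<forall>t\<in>{0..T}. u t = u 0 + (LBINT s:{0..t}. U s))"

lemma set_integrable_bounded_interval:
  fixes U :: "real \<Rightarrow> real"
  assumes "U \<in> borel_measurable borel" and "\<And>s. s \<in> {a..b} \<Longrightarrow> \<bar>U s\<bar> \<le> B"
  shows "set_integrable lborel {a..b} U"
  unfolding set_integrable_def
proof (rule integrableI_bounded_set_indicator[where B=B])
  show "AE x in lborel. x \<in> {a..b} \<longrightarrow> norm (U x) \<le> B" using assms(2) by auto
  show "emeasure lborel {a..b} < \<infinity>" by (cases "a \<le> b") auto
qed (use assms(1) in auto)

lemma LBINT_interval_combine:
  fixes U :: "real \<Rightarrow> real"
  assumes "set_integrable lborel {a..c} U" "a \<le> b" "b \<le> c"
  shows "(LBINT s:{a..c}. U s) = (LBINT s:{a..b}. U s) + (LBINT s:{b..c}. U s)"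
proof -
  have 1: "set_integrable lborel {a..b} U" "set_integrable lborel {b..c} U"
    using assms by (auto intro: set_integrable_subset)
  show ?thesis
    using assms 1 Henstock_Kurzweil_Integration.integral_combine[OF assms(2,3), of U] set_borel_integral_eq_integral[OF assms(1)]
    by (simp add: set_borel_integral_eq_integral)
qed

lemma LBINT_interval_bound:
  fixes U :: "real \<Rightarrow> real"
  assumes "U \<in> borel_measurable borel" and "\<And>s. s \<in> {a..b} \<Longrightarrow> \<bar>U s\<bar> \<le> B" and "a \<le> b"
  shows "\<bar>LBINT s:{a..b}. U s\<bar> \<le> B * (b - a)"
proof -
  have i: "set_integrable lborel {a..b} U"
    by (rule set_integrable_bounded_interval[OF assms(1,2)])
  have "norm (integral {a..b} U) \<le> integral {a..b} (\<lambda>_. B)"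
    by (rule integral_norm_bound_integral)
       (use set_borel_integral_eq_integral(1)[OF i] assms(2) in auto)
  then show ?thesis
    using i assms(3) by (simp add: set_borel_integral_eq_integral mult.commute)
qed

text \<open>Quadratic increments force a zero derivative. Product and chain rule for merely measurable derivatives
  therefore follow from increments computed up to an error of second order in the length of the
  interval.\<close>

lemma constant_on_if_quadratic_increments:
  fixes p :: "real \<Rightarrow> real"
  assumes "\<And>s t. 0 \<le> s \<Longrightarrow> s \<le> t \<Longrightarrow> t \<le> T \<Longrightarrow> \<bar>p t - p s\<bar> \<le> B * (t - s)\<^sup>2"
    and "t \<in> {0..T}"
  shows "p t = p 0"
proof -
  have B: "\<bar>p y - p x\<bar> \<le> \<bar>B\<bar> * (y - x)\<^sup>2" if "x \<in> {0..T}" "y \<in> {0..T}" for x y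
  proof (cases "x \<le> y")
    case True
    have "B * (y - x)\<^sup>2 \<le> \<bar>B\<bar> * (y - x)\<^sup>2" by (intro mult_right_mono) auto
    with assms(1)[of x y] that True show ?thesis by simp
  next
    case False
    have "B * (x - y)\<^sup>2 \<le> \<bar>B\<bar> * (x - y)\<^sup>2" by (intro mult_right_mono) auto
    moreover have "\<bar>p x - p y\<bar> \<le> B * (x - y)\<^sup>2" using assms(1)[of y x] that False by simp
    ultimately show ?thesis by (simp add: power2_commute[of y x] abs_minus_commute[of "p y"])
  qed
  have "(p has_field_derivative 0) (at x within {0..T})" if x: "x \<in> {0..T}" for x
  proof -
    have lim0: "((\<lambda>y. \<bar>B\<bar> * \<bar>y - x\<bar>) \<longlongrightarrow> 0) (at x within {0..T})"
      by (auto intro!: tendsto_eq_intros)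
    have ev: "\<forall>\<^sub>F y in at x within {0..T}. norm ((p y - p x) / (y - x)) \<le> \<bar>B\<bar> * \<bar>y - x\<bar>"
      unfolding eventually_at_filter
    proof (intro always_eventually allI impI)
      fix y assume y: "y \<noteq> x" "y \<in> {0..T}"
      have "\<bar>p y - p x\<bar> \<le> (\<bar>B\<bar> * \<bar>y - x\<bar>) * \<bar>y - x\<bar>"
        using B[OF x y(2)] by (simp add: power2_eq_square mult.assoc abs_mult_self_eq)
      then show "norm ((p y - p x) / (y - x)) \<le> \<bar>B\<bar> * \<bar>y - x\<bar>"
        using y(1) by (simp add: abs_divide pos_divide_le_eq)
    qed
    show ?thesis
      unfolding has_field_derivative_iff by (rule Lim_null_comparison[OF ev lim0])
  qed
  then obtain c where "\<forall>x\<in>{0..T}. p x = c"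
    using has_field_derivative_zero_constant[of "{0..T}" p] by auto
  with assms(2) show ?thesis by auto
qed

lemma abs_prim_onI_quadratic:
  assumes u: "u \<in> borel_measurable borel" and U: "U \<in> borel_measurable borel"
    and B: "\<And>s. s \<in> {0..T} \<Longrightarrow> \<bar>U s\<bar> \<le> B"
    and q: "\<And>s t. 0 \<le> s \<Longrightarrow> s \<le> t \<Longrightarrow> t \<le> T \<Longrightarrow>
              \<bar>u t - u s - (LBINT r:{s..t}. U r)\<bar> \<le> D * (t - s)\<^sup>2"
  shows "abs_prim_on T u U"
  unfolding abs_prim_on_def
proof (intro conjI ballI)
  show "\<exists>B. \<forall>s\<in>{0..T}. \<bar>U s\<bar> \<le> B" using B by blast
  fix t assume t: "t \<in> {0..T}"
  let ?p = "\<lambda>t. u t - (LBINT r:{0..t}. U r)"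
  have "\<bar>?p t - ?p s\<bar> \<le> D * (t - s)\<^sup>2" if "0 \<le> s" "s \<le> t" "t \<le> T" for s t
  proof -
    have "set_integrable lborel {0..t} U"
      by (rule set_integrable_bounded_interval[OF U, of _ _ B]) (use B that in auto)
    from LBINT_interval_combine[OF this that(1,2)] q[OF that]
    show ?thesis by simp
  qed
  from constant_on_if_quadratic_increments[of T ?p D, OF this t]
  have "?p t = ?p 0" by simp
  moreover have "(LBINT r:{0..0}. U r) = 0"
    using LBINT_interval_bound[of U 0 0 "\<bar>U 0\<bar>"] U by simp
  ultimately show "u t = u 0 + (LBINT r:{0..t}. U r)" by simp
qed (use u U in auto)

context
  fixes T :: real and u U :: "real \<Rightarrow> real"
  assumes ac: "abs_prim_on T u U"
begin

lemma abs_prim_on_measurable: "u \<in> borel_measurable borel" "U \<in> borel_measurable borel"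
  using ac unfolding abs_prim_on_def by blast+

lemma abs_prim_on_integrable: "0 \<le> s \<Longrightarrow> t \<le> T \<Longrightarrow> set_integrable lborel {s..t} U"
proof -
  assume "0 \<le> s" "t \<le> T"
  obtain B where "\<forall>s\<in>{0..T}. \<bar>U s\<bar> \<le> B" using ac unfolding abs_prim_on_def by blast
  then show ?thesis
    using \<open>0 \<le> s\<close> \<open>t \<le> T\<close>
    by (intro set_integrable_bounded_interval[OF abs_prim_on_measurable(2), of _ _ B]) auto
qed

lemma abs_prim_on_diff:
  assumes "0 \<le> s" "s \<le> t" "t \<le> T"
  shows "u t - u s = (LBINT r:{s..t}. U r)"
proof -
  have *: "u r = u 0 + (LBINT s:{0..r}. U s)" if "r \<in> {0..T}" for r
    using ac that unfolding abs_prim_on_def by blast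
  have "(LBINT r:{0..t}. U r) = (LBINT r:{0..s}. U r) + (LBINT r:{s..t}. U r)"
    by (rule LBINT_interval_combine[OF abs_prim_on_integrable assms(1,2)]) (use assms in auto)
  then show ?thesis using *[of s] *[of t] assms by simp
qed

lemma abs_prim_on_lipschitz:
  obtains B where "0 \<le> B" "\<And>s. s \<in> {0..T} \<Longrightarrow> \<bar>U s\<bar> \<le> B" "\<And>s. s \<in> {0..T} \<Longrightarrow> \<bar>u s\<bar> \<le> B"
    "\<And>s t. 0 \<le> s \<Longrightarrow> s \<le> t \<Longrightarrow> t \<le> T \<Longrightarrow> \<bar>u t - u s\<bar> \<le> B * (t - s)"
proof -
  obtain B where B: "\<forall>s\<in>{0..T}. \<bar>U s\<bar> \<le> B" using ac unfolding abs_prim_on_def by blast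
  define B' where "B' = \<bar>B\<bar> + \<bar>u 0\<bar> + \<bar>B\<bar> * \<bar>T\<bar>"
  have B': "\<bar>B\<bar> \<le> B'" "0 \<le> B'" by (auto simp: B'_def)
  have L: "\<bar>u t - u s\<bar> \<le> \<bar>B\<bar> * (t - s)" if "0 \<le> s" "s \<le> t" "t \<le> T" for s t
    unfolding abs_prim_on_diff[OF that]
    by (rule LBINT_interval_bound[OF abs_prim_on_measurable(2)]) (use B that in \<open>auto intro: order_trans[OF _ abs_ge_self]\<close>)
  have 1: "\<bar>U s\<bar> \<le> B'" if "s \<in> {0..T}" for s using B that B' by force
  have 2: "\<bar>u t - u s\<bar> \<le> B' * (t - s)" if "0 \<le> s" "s \<le> t" "t \<le> T" for s t
    using L[OF that] mult_right_mono[OF B'(1), of "t - s"] that by linarith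
  have 3: "\<bar>u s\<bar> \<le> B'" if "s \<in> {0..T}" for s
  proof -
    have "\<bar>u s\<bar> \<le> \<bar>u 0\<bar> + \<bar>u s - u 0\<bar>" by arith
    also have "\<bar>u s - u 0\<bar> \<le> \<bar>B\<bar> * (s - 0)" by (rule L) (use that in auto)
    also have "\<dots> \<le> \<bar>B\<bar> * \<bar>T\<bar>" using that by (intro mult_left_mono) auto
    finally show ?thesis unfolding B'_def using abs_ge_zero[of B] by linarith
  qed
  show ?thesis by (rule that[OF B'(2) 1 3 2])
qed

lemma abs_prim_on_continuous: "continuous_on {0..T} u"
proof -
  obtain B where B: "0 \<le> B" "\<And>s. s \<in> {0..T} \<Longrightarrow> \<bar>U s\<bar> \<le> B" "\<And>s. s \<in> {0..T} \<Longrightarrow> \<bar>u s\<bar> \<le> B"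
    "\<And>s t. 0 \<le> s \<Longrightarrow> s \<le> t \<Longrightarrow> t \<le> T \<Longrightarrow> \<bar>u t - u s\<bar> \<le> B * (t - s)"
    using abs_prim_on_lipschitz by metis
  have "B-lipschitz_on {0..T} u"
  proof (rule lipschitz_on_leI)
    fix x y assume "x \<in> {0..T}" "y \<in> {0..T}" "x \<le> y"
    then have "\<bar>u y - u x\<bar> \<le> B * (y - x)" by (intro B(4)) auto
    with \<open>x \<le> y\<close> show "dist (u x) (u y) \<le> B * dist x y"
      by (simp add: dist_real_def abs_minus_commute)
  qed (rule B(1))
  then show ?thesis by (rule lipschitz_on_continuous_on)
qed

text \<open>Freezing \<open>exp (u r)\<close> at \<open>r = s\<close> changes the integral over \<open>{s..t}\<close> by \<open>O((t - s)\<^sup>2)\<close>, because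
  \<open>u\<close> is Lipschitz, and convexity of the exponential controls the linearisation error of the increment
  by the same order.\<close>

lemma abs_prim_on_exp: "abs_prim_on T (\<lambda>t. exp (u t)) (\<lambda>t. exp (u t) * U t)"
proof -
  note [measurable] = abs_prim_on_measurable
  obtain B where B: "0 \<le> B" "\<And>s. s \<in> {0..T} \<Longrightarrow> \<bar>U s\<bar> \<le> B" "\<And>s. s \<in> {0..T} \<Longrightarrow> \<bar>u s\<bar> \<le> B"
    "\<And>s t. 0 \<le> s \<Longrightarrow> s \<le> t \<Longrightarrow> t \<le> T \<Longrightarrow> \<bar>u t - u s\<bar> \<le> B * (t - s)"
    using abs_prim_on_lipschitz by metis
  \<comment> \<open>convexity of the exponential; with \<open>a\<close> and \<open>b\<close> exchanged it bounds the remainder from above\<close>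
  have conv: "exp a * (b - a) \<le> exp b - exp a" for a b :: real
  proof -
    have "exp a * (1 + (b - a)) \<le> exp a * exp (b - a)" by (intro mult_left_mono) auto
    also have "\<dots> = exp b" by (simp add: exp_diff)
    finally show ?thesis by (simp add: algebra_simps)
  qed
  have eL: "\<bar>exp b - exp a\<bar> \<le> exp B * \<bar>b - a\<bar>" if "\<bar>a\<bar> \<le> B" "\<bar>b\<bar> \<le> B" for a b
  proof -
    have *: "exp b - exp a \<le> exp B * (b - a)" if "a \<le> b" "b \<le> B" for a b :: real
    proof -
      have "exp b * (b - a) \<le> exp B * (b - a)" using that by (intro mult_right_mono) auto
      with conv[of b a] show ?thesis by (simp add: algebra_simps)
    qed
    show ?thesis using *[of a b] *[of b a] that by (cases "a \<le> b") auto
  qed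
  show ?thesis
  proof (rule abs_prim_onI_quadratic[where B="exp B * B" and D="2 * exp B * B\<^sup>2"])
    show "\<bar>exp (u s) * U s\<bar> \<le> exp B * B" if "s \<in> {0..T}" for s
      unfolding abs_mult using B(2,3)[OF that] by (intro mult_mono) auto
    fix s t assume st: "0 \<le> s" "s \<le> t" "t \<le> T"
    have dexp: "\<bar>exp (u r) - exp (u s)\<bar> \<le> exp B * (B * (t - s))" if r: "r \<in> {s..t}" for r
    proof -
      have "\<bar>exp (u r) - exp (u s)\<bar> \<le> exp B * \<bar>u r - u s\<bar>" using eL B(3) r st by auto
      also have "\<dots> \<le> exp B * (B * (r - s))" using B(4)[of s r] r st by (intro mult_left_mono) auto
      also have "\<dots> \<le> exp B * (B * (t - s))" using B(1) r by (intro mult_left_mono) auto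
      finally show ?thesis .
    qed
    have i1: "set_integrable lborel {s..t} (\<lambda>r. (exp (u r) - exp (u s)) * U r)"
      by (rule set_integrable_bounded_interval[where B="exp B * (B * (t - s)) * B"])
         (use dexp B st in \<open>auto simp: abs_mult intro!: mult_mono\<close>)
    have i2: "set_integrable lborel {s..t} (\<lambda>r. exp (u s) * U r)"
      using abs_prim_on_integrable st by simp
    have "(LBINT r:{s..t}. exp (u r) * U r)
        = (LBINT r:{s..t}. exp (u s) * U r + (exp (u r) - exp (u s)) * U r)"
      by (simp add: algebra_simps)
    also have "\<dots> = exp (u s) * (u t - u s) + (LBINT r:{s..t}. (exp (u r) - exp (u s)) * U r)"
      by (subst set_integral_add(2)[OF i2 i1]) (simp add: abs_prim_on_diff[OF st])
    finally have eq: "(LBINT r:{s..t}. exp (u r) * U r) = \<dots>" .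
    have r1: "\<bar>LBINT r:{s..t}. (exp (u r) - exp (u s)) * U r\<bar> \<le> (exp B * (B * (t - s)) * B) * (t - s)"
      by (rule LBINT_interval_bound)
         (use dexp B st in \<open>auto simp: abs_mult intro!: mult_mono\<close>)
    have r2: "\<bar>exp (u t) - exp (u s) - exp (u s) * (u t - u s)\<bar> \<le> (exp B * (B * (t - s))) * (B * (t - s))"
    proof -
      have "\<bar>exp (u t) - exp (u s) - exp (u s) * (u t - u s)\<bar> \<le> \<bar>(exp (u t) - exp (u s)) * (u t - u s)\<bar>"
        using conv[of "u s" "u t"] conv[of "u t" "u s"] by (auto simp: algebra_simps)
      also have "\<dots> \<le> (exp B * (B * (t - s))) * (B * (t - s))"
        unfolding abs_mult using dexp[of t] B(1) B(4)[of s t] st by (intro mult_mono) auto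
      finally show ?thesis .
    qed
    have "\<bar>exp (u t) - exp (u s) - (LBINT r:{s..t}. exp (u r) * U r)\<bar>
       \<le> (exp B * (B * (t - s))) * (B * (t - s)) + (exp B * (B * (t - s)) * B) * (t - s)"
      using r1 r2 unfolding eq by linarith
    also have "\<dots> = 2 * exp B * B\<^sup>2 * (t - s)\<^sup>2" by (simp add: power2_eq_square algebra_simps)
    finally show "\<bar>exp (u t) - exp (u s) - (LBINT r:{s..t}. exp (u r) * U r)\<bar> \<le> 2 * exp B * B\<^sup>2 * (t - s)\<^sup>2" .
  qed (auto intro!: borel_measurable_times borel_measurable_add borel_measurable_exp abs_prim_on_measurable)
qed

text \<open>A barrier argument: after the last time at which \<open>u \<ge> 0\<close> holds, \<open>u\<close> would be negative and
  nondecreasing at once.\<close>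

lemma abs_prim_on_nonneg:
  assumes U: "\<And>s. s \<in> {0..T} \<Longrightarrow> u s \<le> 0 \<Longrightarrow> 0 \<le> U s" and u0: "0 \<le> u 0" and t: "t \<in> {0..T}"
  shows "0 \<le> u t"
proof (rule ccontr)
  assume neg: "\<not> 0 \<le> u t"
  define S where "S = {s\<in>{0..t}. 0 \<le> u s}"
  have "continuous_on {0..t} u" by (rule continuous_on_subset[OF abs_prim_on_continuous]) (use t in auto)
  then have "closed S" unfolding S_def
    using continuous_closed_preimage[of "{0..t}" u "{0..}"] by (simp add: vimage_def Int_def)
  moreover have "bdd_above S" "S \<noteq> {}" using t u0 by (auto simp: S_def bdd_above_def)
  ultimately have m: "Sup S \<in> S" by (intro closed_contains_Sup) auto
  \<comment> \<open>the last time up to \<open>t\<close> at which \<open>u\<close> is nonnegative\<close>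
  define s where "s = Sup S"
  have s: "0 \<le> s" "s \<le> t" "0 \<le> u s" using m by (auto simp: S_def s_def)
  have after: "u r < 0" if "s < r" "r \<le> t" for r
  proof (rule ccontr)
    assume "\<not> u r < 0"
    then have "r \<in> S" using that s by (auto simp: S_def)
    then have "r \<le> s" unfolding s_def using \<open>bdd_above S\<close> by (rule cSup_upper)
    with that show False by simp
  qed
  have "0 \<le> (LBINT r:{s..t}. U r)"
    unfolding set_lebesgue_integral_def
  proof (intro integral_nonneg_AE)
    show "AE r in lborel. 0 \<le> indicat_real {s..t} r *\<^sub>R U r"
      using AE_lborel_singleton[of s]
    proof eventually_elim
      case (elim r)
      then show ?case using U[of r] after[of r] s t by (auto simp: indicator_def)
    qed
  qed
  with abs_prim_on_diff[of s t] s t neg show False by simp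
qed

end

text \<open>The product rule. Replacing the coefficients \<open>u r\<close> and \<open>v r\<close> by their values at \<open>s\<close> costs
  \<open>O((t - s)\<^sup>2)\<close>, and so does the product of the two increments.\<close>

lemma abs_prim_on_mult:
  assumes ac1: "abs_prim_on T u U" and ac2: "abs_prim_on T v V"
  shows "abs_prim_on T (\<lambda>t. u t * v t) (\<lambda>t. u t * V t + U t * v t)"
proof -
  note [measurable] = abs_prim_on_measurable[OF ac1] abs_prim_on_measurable[OF ac2]
  obtain B where B: "0 \<le> B" "\<And>s. s \<in> {0..T} \<Longrightarrow> \<bar>U s\<bar> \<le> B" "\<And>s. s \<in> {0..T} \<Longrightarrow> \<bar>u s\<bar> \<le> B"
    "\<And>s t. 0 \<le> s \<Longrightarrow> s \<le> t \<Longrightarrow> t \<le> T \<Longrightarrow> \<bar>u t - u s\<bar> \<le> B * (t - s)"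
    using abs_prim_on_lipschitz[OF ac1] by metis
  obtain C where C: "0 \<le> C" "\<And>s. s \<in> {0..T} \<Longrightarrow> \<bar>V s\<bar> \<le> C" "\<And>s. s \<in> {0..T} \<Longrightarrow> \<bar>v s\<bar> \<le> C"
    "\<And>s t. 0 \<le> s \<Longrightarrow> s \<le> t \<Longrightarrow> t \<le> T \<Longrightarrow> \<bar>v t - v s\<bar> \<le> C * (t - s)"
    using abs_prim_on_lipschitz[OF ac2] by metis
  show ?thesis
  proof (rule abs_prim_onI_quadratic[where B="B * C + B * C" and D="3 * B * C"])
    show "\<bar>u s * V s + U s * v s\<bar> \<le> B * C + B * C" if s: "s \<in> {0..T}" for s
    proof -
      have "\<bar>u s * V s\<bar> \<le> B * C" "\<bar>U s * v s\<bar> \<le> B * C"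
        unfolding abs_mult using B C s by (auto intro!: mult_mono)
      then show ?thesis by linarith
    qed
    fix s t assume st: "0 \<le> s" "s \<le> t" "t \<le> T"
    have du: "\<bar>u r - u s\<bar> \<le> B * (t - s)" and dv: "\<bar>v r - v s\<bar> \<le> C * (t - s)" if r: "r \<in> {s..t}" for r
    proof -
      have "B * (r - s) \<le> B * (t - s)" "C * (r - s) \<le> C * (t - s)"
        using B(1) C(1) r by (auto intro!: mult_left_mono)
      then show "\<bar>u r - u s\<bar> \<le> B * (t - s)" "\<bar>v r - v s\<bar> \<le> C * (t - s)"
        using B(4)[of s r] C(4)[of s r] r st by auto
    qed
    let ?R = "\<lambda>r. (u r - u s) * V r + U r * (v r - v s)"
    have Rb: "\<bar>?R r\<bar> \<le> 2 * B * C * (t - s)" if r: "r \<in> {s..t}" for r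
    proof -
      have "\<bar>(u r - u s) * V r\<bar> \<le> (B * (t - s)) * C"
        unfolding abs_mult using du[OF r] C(2)[of r] B(1) r st by (intro mult_mono) auto
      moreover have "\<bar>U r * (v r - v s)\<bar> \<le> B * (C * (t - s))"
        unfolding abs_mult using dv[OF r] B(2)[of r] B(1) r st by (intro mult_mono) auto
      ultimately show ?thesis by (simp add: algebra_simps)
    qed
    have i1: "set_integrable lborel {s..t} ?R"
      by (rule set_integrable_bounded_interval[OF _ Rb]) measurable
    have i2: "set_integrable lborel {s..t} (\<lambda>r. u s * V r)" "set_integrable lborel {s..t} (\<lambda>r. U r * v s)"
      using abs_prim_on_integrable[OF ac1] abs_prim_on_integrable[OF ac2] st by auto
    have "(LBINT r:{s..t}. u r * V r + U r * v r)
        = (LBINT r:{s..t}. (u s * V r + U r * v s) + ?R r)"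
      by (simp add: algebra_simps)
    also have "\<dots> = (u s * (v t - v s) + (u t - u s) * v s) + (LBINT r:{s..t}. ?R r)"
      by (subst set_integral_add(2)[OF set_integral_add(1)[OF i2] i1], subst set_integral_add(2)[OF i2])
         (simp add: abs_prim_on_diff[OF ac1 st] abs_prim_on_diff[OF ac2 st])
    finally have eq: "(LBINT r:{s..t}. u r * V r + U r * v r) = \<dots>" .
    have r1: "\<bar>LBINT r:{s..t}. ?R r\<bar> \<le> (2 * B * C * (t - s)) * (t - s)"
      by (rule LBINT_interval_bound[OF _ Rb]) (use st in auto)
    have r2: "\<bar>(u t - u s) * (v t - v s)\<bar> \<le> (B * (t - s)) * (C * (t - s))"
      unfolding abs_mult using du[of t] dv[of t] B(1) st by (intro mult_mono) auto
    have "u t * v t - u s * v s - (LBINT r:{s..t}. u r * V r + U r * v r)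
        = (u t - u s) * (v t - v s) - (LBINT r:{s..t}. ?R r)"
      unfolding eq by (simp add: algebra_simps)
    with r1 r2 have "\<bar>u t * v t - u s * v s - (LBINT r:{s..t}. u r * V r + U r * v r)\<bar>
        \<le> (B * (t - s)) * (C * (t - s)) + (2 * B * C * (t - s)) * (t - s)" by linarith
    also have "\<dots> = 3 * B * C * (t - s)\<^sup>2" by (simp add: power2_eq_square algebra_simps)
    finally show "\<bar>u t * v t - u s * v s - (LBINT r:{s..t}. u r * V r + U r * v r)\<bar> \<le> 3 * B * C * (t - s)\<^sup>2" .
  qed (auto intro!: borel_measurable_times borel_measurable_add abs_prim_on_measurable[OF ac1] abs_prim_on_measurable[OF ac2])
qed

lemma LBINT_param_measurable:
  fixes h :: "'q \<Rightarrow> real \<Rightarrow> real"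
  assumes h: "(\<lambda>x. h (fst x) (snd x)) \<in> borel_measurable (N \<Otimes>\<^sub>M borel)" and t [measurable]: "t \<in> borel_measurable N"
  shows "(\<lambda>q. LBINT s:{0..t q}. h q s) \<in> borel_measurable N"
  unfolding set_lebesgue_integral_def
proof (rule lborel.borel_measurable_lebesgue_integral)
  have [measurable]: "(\<lambda>x. h (fst x) (snd x)) \<in> borel_measurable (N \<Otimes>\<^sub>M lborel)"
    using h by (simp cong: measurable_cong_sets)
  have [measurable]: "snd \<in> borel_measurable (N \<Otimes>\<^sub>M lborel)" "(\<lambda>x. t (fst x)) \<in> borel_measurable (N \<Otimes>\<^sub>M lborel)"
    by (simp_all cong: measurable_cong_sets)
  have "(\<lambda>x. (if 0 \<le> snd x \<and> snd x \<le> t (fst x) then 1 else 0) * h (fst x) (snd x)) \<in> borel_measurable (N \<Otimes>\<^sub>M lborel)"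
    by measurable
  then show "(\<lambda>(q, s). indicat_real {0..t q} s *\<^sub>R h q s) \<in> borel_measurable (N \<Otimes>\<^sub>M lborel)"
    by (simp add: case_prod_beta indicator_def of_bool_def)
qed

lemma abs_prim_on_const_slope: "abs_prim_on T (\<lambda>t. c + d * t) (\<lambda>_. d)"
  unfolding abs_prim_on_def
proof (intro conjI ballI)
  fix t assume "t \<in> {0..T}"
  then show "c + d * t = c + d * 0 + (LBINT s:{0..t}. d)"
    by (simp add: set_lebesgue_integral_def mult.commute)
qed (auto intro!: exI[of _ "\<bar>d\<bar>"])

lemma abs_prim_on_lincomb:
  assumes u: "abs_prim_on T u U" and v: "abs_prim_on T v V"
  shows "abs_prim_on T (\<lambda>t. k * u t + l * v t) (\<lambda>t. k * U t + l * V t)"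
  unfolding abs_prim_on_def
proof (intro conjI ballI)
  note [measurable] = abs_prim_on_measurable[OF u] abs_prim_on_measurable[OF v]
  show "(\<lambda>t. k * u t + l * v t) \<in> borel_measurable borel" "(\<lambda>t. k * U t + l * V t) \<in> borel_measurable borel"
    by measurable
  obtain B where B: "\<forall>s\<in>{0..T}. \<bar>U s\<bar> \<le> B" using u unfolding abs_prim_on_def by blast
  obtain D where D: "\<forall>s\<in>{0..T}. \<bar>V s\<bar> \<le> D" using v unfolding abs_prim_on_def by blast
  have "\<bar>k * U s + l * V s\<bar> \<le> \<bar>k\<bar> * B + \<bar>l\<bar> * D" if "s \<in> {0..T}" for s
    using B D that by (intro order_trans[OF abs_triangle_ineq] add_mono) (auto simp: abs_mult intro!: mult_left_mono)
  then show "\<exists>B. \<forall>s\<in>{0..T}. \<bar>k * U s + l * V s\<bar> \<le> B" by blast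
  fix t assume t: "t \<in> {0..T}"
  have "u t - u 0 = (LBINT r:{0..t}. U r)" "v t - v 0 = (LBINT r:{0..t}. V r)"
    using abs_prim_on_diff[OF u, of 0 t] abs_prim_on_diff[OF v, of 0 t] t by auto
  moreover have "(LBINT r:{0..t}. k * U r + l * V r) = k * (LBINT r:{0..t}. U r) + l * (LBINT r:{0..t}. V r)"
    using abs_prim_on_integrable[OF u, of 0 t] abs_prim_on_integrable[OF v, of 0 t] t
    by (subst set_integral_add) auto
  ultimately show "k * u t + l * v t = k * u 0 + l * v 0 + (LBINT r:{0..t}. k * U r + l * V r)"
    by (simp add: algebra_simps)
qed

lemma abs_prim_on_cong:
  assumes u: "abs_prim_on T u U" and "u' \<in> borel_measurable borel" "U' \<in> borel_measurable borel"
    and eq: "\<And>t. t \<in> {0..T} \<Longrightarrow> u' t = u t" "\<And>t. t \<in> {0..T} \<Longrightarrow> U' t = U t"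
  shows "abs_prim_on T u' U'"
  unfolding abs_prim_on_def
proof (intro conjI ballI)
  obtain B where B: "\<forall>s\<in>{0..T}. \<bar>U s\<bar> \<le> B" using u unfolding abs_prim_on_def by blast
  then show "\<exists>B. \<forall>s\<in>{0..T}. \<bar>U' s\<bar> \<le> B" using eq(2) by auto
  fix t assume t: "t \<in> {0..T}"
  have "(LBINT r:{0..t}. U' r) = (LBINT r:{0..t}. U r)"
    by (rule set_lebesgue_integral_cong) (use t eq(2) in auto)
  moreover have "u' 0 = u 0" using t by (intro eq) auto
  ultimately show "u' t = u' 0 + (LBINT r:{0..t}. U' r)"
    using abs_prim_on_diff[OF u, of 0 t] t eq(1)[OF t] by simp
qed (use assms in auto)

lemma LBINT_singleton [simp]: "(LBINT s:{a}. h s) = (0 :: real)"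
  unfolding set_lebesgue_integral_def
  by (rule integral_eq_zero_AE) (use AE_lborel_singleton[of a] in \<open>eventually_elim, auto simp: indicator_def\<close>)

lemma abs_prim_on_primitive:
  assumes U: "U \<in> borel_measurable borel" "\<And>s. s \<in> {0..T} \<Longrightarrow> \<bar>U s\<bar> \<le> B"
  shows "abs_prim_on T (\<lambda>t. c + (LBINT s:{0..t}. U s)) U"
proof -
  have "(\<lambda>t. LBINT s:{0..t}. U s) \<in> borel_measurable borel"
    by (rule LBINT_param_measurable[of "\<lambda>_. U" borel "\<lambda>t. t"]) (use U(1) in simp_all)
  moreover have "\<exists>B. \<forall>s\<in>{0..T}. \<bar>U s\<bar> \<le> B" using U(2) by blast
  ultimately show ?thesis using U(1) unfolding abs_prim_on_def by simp
qed

text \<open>Variation of constants for \<open>y' = g - a y\<close> with measurable bounded coefficients.\<close>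

lemma damped_solution:
  fixes a g :: "real \<Rightarrow> real" and c :: real
  assumes a: "a \<in> borel_measurable borel" "\<And>t. \<bar>a t\<bar> \<le> A" and g: "g \<in> borel_measurable borel" "\<And>t. \<bar>g t\<bar> \<le> G"
  defines "E \<equiv> \<lambda>t. LBINT s:{0..t}. a s"
  defines "y \<equiv> \<lambda>t. exp (- E t) * (c + (LBINT s:{0..t}. exp (E s) * g s))"
  shows "abs_prim_on T y (\<lambda>t. g t - a t * y t)"
proof -
  have "abs_prim_on T (\<lambda>t. 0 + E t) a"
    unfolding E_def by (rule abs_prim_on_primitive[OF a])
  then have E: "abs_prim_on T E a" by simp
  note [measurable] = abs_prim_on_measurable(1)[OF E]
  obtain B where B: "\<And>s. s \<in> {0..T} \<Longrightarrow> \<bar>E s\<bar> \<le> B"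
    using abs_prim_on_lipschitz[OF E] by metis
  define Y where "Y = (\<lambda>t. c + (LBINT s:{0..t}. exp (E s) * g s))"
  have "\<bar>exp (E t) * g t\<bar> \<le> exp B * G" if "t \<in> {0..T}" for t
    unfolding abs_mult using B[OF that] g(2)[of t] by (intro mult_mono) auto
  moreover have "(\<lambda>t. exp (E t) * g t) \<in> borel_measurable borel" using g(1) by measurable
  ultimately have Y: "abs_prim_on T Y (\<lambda>t. exp (E t) * g t)"
    unfolding Y_def by (intro abs_prim_on_primitive)
  have "abs_prim_on T (\<lambda>t. exp (-1 * E t + 0 * E t)) (\<lambda>t. exp (-1 * E t + 0 * E t) * (-1 * a t + 0 * a t))"
    by (rule abs_prim_on_exp[OF abs_prim_on_lincomb[OF E E]])
  from abs_prim_on_mult[OF this Y]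
  have "abs_prim_on T (\<lambda>t. exp (- E t) * Y t) (\<lambda>t. exp (- E t) * (exp (E t) * g t) + exp (- E t) * (- a t) * Y t)"
    by simp
  also have "(\<lambda>t. exp (- E t) * (exp (E t) * g t) + exp (- E t) * (- a t) * Y t) = (\<lambda>t. g t - a t * y t)"
    by (simp add: y_def Y_def fun_eq_iff exp_minus)
  finally show ?thesis by (simp add: y_def Y_def)
qed

text \<open>The damping never increases \<open>|u|\<close>, so the bound does not contain the size of \<open>a\<close>. This is what
  makes the unbounded collision frequency harmless. The comparison function \<open>c + G t - u\<close> has
  a nonnegative derivative wherever it is nonpositive.\<close>

lemma damped_upper_bound:
  assumes u: "abs_prim_on T u (\<lambda>t. g t - a t * u t)"
    and a: "\<And>t. t \<in> {0..T} \<Longrightarrow> 0 \<le> a t" and g: "\<And>t. t \<in> {0..T} \<Longrightarrow> g t \<le> G"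
    and u0: "u 0 \<le> c" and c: "0 \<le> c" and G: "0 \<le> G" and t: "t \<in> {0..T}"
  shows "u t \<le> c + G * t"
proof -
  have z: "abs_prim_on T (\<lambda>t. 1 * (c + G * t) + (-1) * u t) (\<lambda>t. 1 * G + (-1) * (g t - a t * u t))"
    by (rule abs_prim_on_lincomb[OF abs_prim_on_const_slope u])
  have "0 \<le> 1 * (c + G * t) + (-1) * u t"
  proof (rule abs_prim_on_nonneg[OF z _ _ t])
    fix s assume s: "s \<in> {0..T}" and "1 * (c + G * s) + (-1) * u s \<le> 0"
    then have "c + G * s \<le> u s" by simp
    moreover have "0 \<le> c + G * s" using c G s by simp
    ultimately have "0 \<le> a s * u s" using a[OF s] by (intro mult_nonneg_nonneg) auto
    with g[OF s] show "0 \<le> 1 * G + (-1) * (g s - a s * u s)" by simp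
  qed (use u0 in simp)
  then show ?thesis by simp
qed

lemma damped_bound:
  assumes u: "abs_prim_on T u (\<lambda>t. g t - a t * u t)"
    and a: "\<And>t. t \<in> {0..T} \<Longrightarrow> 0 \<le> a t" and g: "\<And>t. t \<in> {0..T} \<Longrightarrow> \<bar>g t\<bar> \<le> G"
    and u0: "\<bar>u 0\<bar> \<le> c" and t: "t \<in> {0..T}"
  shows "\<bar>u t\<bar> \<le> c + G * t"
proof -
  have c: "0 \<le> c" using u0 by simp
  have G: "0 \<le> G" using g[OF t] by simp
  have "abs_prim_on T (\<lambda>t. (-1) * u t + 0 * u t) (\<lambda>t. (-1) * (g t - a t * u t) + 0 * (g t - a t * u t))"
    by (rule abs_prim_on_lincomb[OF u u])
  then have "abs_prim_on T (\<lambda>t. - u t) (\<lambda>t. (- g t) - a t * (- u t))" by (simp add: algebra_simps)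
  from damped_upper_bound[OF this a _ _ c G t] g u0 have "- u t \<le> c + G * t"
    by (force simp: abs_le_iff)
  moreover have "u t \<le> c + G * t"
    by (rule damped_upper_bound[OF u a _ _ c G t]) (use g u0 in \<open>force simp: abs_le_iff\<close>)+
  ultimately show ?thesis by simp
qed

section \<open>The collision measure in parametrised form\<close>

lemma borel_measurable_projections [measurable]:
  "(fst :: 'a::second_countable_topology \<times> 'b::second_countable_topology \<Rightarrow> 'a) \<in> borel_measurable borel"
  "(snd :: 'a::second_countable_topology \<times> 'b::second_countable_topology \<Rightarrow> 'b) \<in> borel_measurable borel"
  by (intro borel_measurable_continuous_onI continuous_intros)+

type_synonym coll_par = "((real^3) \<times> real \<times> real \<times> real) \<times> (real^3)"

type_synonym coll_state = "(real^3) \<times> (real^3) \<times> (real^3) \<times> real \<times> real \<times> real"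

abbreviation coll_base :: "coll_par measure" where
  "coll_base \<equiv> lborel \<Otimes>\<^sub>M sphere_measure"

lemma sets_sphere_measure [simp, measurable_cong]: "sets sphere_measure = sets borel"
  by (simp add: sphere_measure_def)

lemma space_sphere_measure [simp]: "space sphere_measure = UNIV"
  by (simp add: sphere_measure_def)

lemma finite_sphere_measure: "finite_measure sphere_measure"
proof
  have "emeasure sphere_measure (space sphere_measure)
      = (\<integral>\<^sup>+x. 3 * indicator (ball 0 1) x \<partial>(lborel :: (real^3) measure))"
    unfolding space_sphere_measure unfolding sphere_measure_def
    by (subst emeasure_distr, measurable, simp only: vimage_UNIV space_density space_lborel space_borel Int_UNIV_left,
        subst emeasure_density, measurable, simp_all)
  also have "\<dots> = 3 * emeasure lborel (ball (0::real^3) 1)"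
    by (rule nn_integral_cmult_indicator) simp
  also have "\<dots> < \<infinity>"
    using emeasure_lborel_ball_finite[of "0::real^3" 1] by (auto simp: ennreal_mult_less_top)
  finally show "emeasure sphere_measure (space sphere_measure) \<noteq> \<infinity>" by simp
qed

lemma AE_sphere_measure_norm: "AE \<omega> in sphere_measure. norm \<omega> = 1"
  unfolding sphere_measure_def
proof (subst AE_distr_iff)
  have "AE x in lborel. (x :: real^3) \<noteq> 0" by (rule AE_lborel_singleton)
  then show "AE x in density lborel (\<lambda>x :: real^3. 3 * indicator (ball 0 1) x). norm (x /\<^sub>R norm x) = 1"
    by (subst AE_density, measurable) (auto elim!: eventually_mono)
qed measurable

interpretation sphere: finite_measure sphere_measure
  by (rule finite_sphere_measure)

interpretation coll_base: sigma_finite_measure coll_base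
  by (intro sigma_finite_pair_measure lborel.sigma_finite_measure_axioms sphere.sigma_finite_measure_axioms)

lemma AE_coll_base_norm: "AE p in coll_base. norm (snd p) = 1"
proof -
  interpret pair_sigma_finite "lborel :: ((real^3) \<times> real \<times> real \<times> real) measure" sphere_measure ..
  have [measurable]: "snd \<in> borel_measurable coll_base"
    by (simp cong: measurable_cong_sets)
  have "{p \<in> space coll_base. norm (snd p) = 1} \<in> sets coll_base" by measurable
  then show ?thesis
    by (rule AE_pair_measure) (use AE_sphere_measure_norm in simp)
qed

text \<open>The map along which the collision measure is the image of a density on the \<open>\<sigma>\<close>-finite product
  \<open>coll_base\<close>. That product does not depend on \<open>(v, I)\<close>, which makes parametrised measurability available.\<close>

definition coll_param :: "real^3 \<Rightarrow> real \<Rightarrow> coll_par \<Rightarrow> coll_state" where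
  "coll_param v I = (\<lambda>((vs, Is, I', Is'), \<omega>).
     let c = (v + vs) /\<^sub>R 2; s = sqrt (coll_energy v vs I Is - I' - Is')
     in (vs, c + s *\<^sub>R \<omega>, c - s *\<^sub>R \<omega>, Is, I', Is'))"

text \<open>Positivity of the internal energies and \<open>|\<omega>| = 1\<close>, which holds almost everywhere, are
  built into the density; with them the conservation of energy holds at every parameter with nonzero density.\<close>

definition coll_dens :: "real \<Rightarrow> real \<Rightarrow> real \<Rightarrow> real^3 \<Rightarrow> real \<Rightarrow> coll_par \<Rightarrow> real" where
  "coll_dens \<delta> \<alpha> C v I = (\<lambda>((vs, Is, I', Is'), \<omega>).
     if norm \<omega> = 1 \<and> 0 < Is \<and> 0 < I' \<and> 0 < Is' then W_density \<delta> \<alpha> C v I vs Is I' Is' else 0)"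

lemma W_density_nonneg: "0 \<le> C \<Longrightarrow> 0 \<le> W_density \<delta> \<alpha> C v I vs Is I' Is'"
  by (simp add: W_density_def Let_def)

lemma coll_dens_nonneg: "0 \<le> C \<Longrightarrow> 0 \<le> coll_dens \<delta> \<alpha> C v I p"
  by (simp add: coll_dens_def W_density_nonneg split: prod.split)

lemma coll_energy_measurable [measurable (raw)]:
  assumes "f \<in> borel_measurable N" "g \<in> borel_measurable N" "h \<in> borel_measurable N" "k \<in> borel_measurable N"
  shows "(\<lambda>x. coll_energy (f x) (g x) (h x) (k x)) \<in> borel_measurable N"
  unfolding coll_energy_def using assms by measurable

lemma W_density_measurable:
  assumes [measurable]: "V \<in> borel_measurable N" "J \<in> borel_measurable N" "Vs \<in> borel_measurable N"
    "Js \<in> borel_measurable N" "J' \<in> borel_measurable N" "Js' \<in> borel_measurable N"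
  shows "(\<lambda>x. W_density \<delta> \<alpha> C (V x) (J x) (Vs x) (Js x) (J' x) (Js' x)) \<in> borel_measurable N"
  unfolding W_density_def Let_def by measurable

lemma coll_dens_measurable [measurable (raw)]:
  assumes [measurable]: "V \<in> borel_measurable N" "J \<in> borel_measurable N"
    "P \<in> measurable N coll_base"
  shows "(\<lambda>x. coll_dens \<delta> \<alpha> C (V x) (J x) (P x)) \<in> borel_measurable N"
proof -
  have [measurable]: "(\<lambda>x. fst (P x)) \<in> borel_measurable N" "(\<lambda>x. snd (P x)) \<in> borel_measurable N"
    using measurable_compose[OF assms(3) measurable_fst] measurable_compose[OF assms(3) measurable_snd]
    by (simp_all cong: measurable_cong_sets)
  show ?thesis
    unfolding coll_dens_def case_prod_beta
    by (intro measurable_If W_density_measurable) measurable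
qed

lemma coll_param_measurable [measurable (raw)]:
  assumes [measurable]: "V \<in> borel_measurable N" "J \<in> borel_measurable N"
    "P \<in> measurable N coll_base"
  shows "(\<lambda>x. coll_param (V x) (J x) (P x)) \<in> borel_measurable N"
proof -
  have [measurable]: "(\<lambda>x. fst (P x)) \<in> borel_measurable N" "(\<lambda>x. snd (P x)) \<in> borel_measurable N"
    using measurable_compose[OF assms(3) measurable_fst] measurable_compose[OF assms(3) measurable_snd]
    by (simp_all cong: measurable_cong_sets)
  show ?thesis
    unfolding coll_param_def case_prod_beta Let_def by measurable
qed

abbreviation coll_region :: "coll_state set" where
  "coll_region \<equiv> UNIV \<times> UNIV \<times> UNIV \<times> {0<..} \<times> {0<..} \<times> {0<..}"

lemma coll_region_borel [measurable]: "coll_region \<in> sets borel"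
proof -
  have "coll_region = {z. 0 < fst (snd (snd (snd z))) \<and> 0 < fst (snd (snd (snd (snd z)))) \<and> 0 < snd (snd (snd (snd (snd z))))}"
    by auto
  also have "\<dots> \<in> sets borel" by measurable
  finally show ?thesis .
qed

lemma W_measure_altdef:
  "W_measure \<delta> \<alpha> C v I = restrict_space
     (distr (density coll_base (\<lambda>((vs, Is, I', Is'), \<omega>). ennreal (W_density \<delta> \<alpha> C v I vs Is I' Is')))
        borel (coll_param v I)) coll_region"
  by (simp add: W_measure_def coll_param_def)

lemma space_W_measure: "space (W_measure \<delta> \<alpha> C v I) = coll_region"
  by (simp add: W_measure_def space_restrict_space)

context
  fixes \<delta> \<alpha> C :: real and v :: "real^3" and I :: real and G :: "coll_state \<Rightarrow> real"
  assumes C: "0 \<le> C" and G [measurable]: "G \<in> borel_measurable borel"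
begin

lemma AE_W_density_eq_coll_dens:
  "AE p in coll_base.
     W_density \<delta> \<alpha> C v I (fst (fst p)) (fst (snd (fst p))) (fst (snd (snd (fst p)))) (snd (snd (snd (fst p)))) *\<^sub>R
     (indicator coll_region (coll_param v I p) *\<^sub>R G (coll_param v I p))
   = coll_dens \<delta> \<alpha> C v I p * G (coll_param v I p)"
  using AE_coll_base_norm
  by eventually_elim (auto simp: coll_dens_def coll_param_def Let_def indicator_def split: prod.split)

lemma W_integral_measurable:
  "coll_param v I \<in> measurable (density coll_base h) borel"
  "(\<lambda>z. indicator coll_region z *\<^sub>R G z) \<in> borel_measurable borel"
  "(\<lambda>p. indicator coll_region (coll_param v I p) *\<^sub>R G (coll_param v I p)) \<in> borel_measurable coll_base"
  "(\<lambda>p. W_density \<delta> \<alpha> C v I (fst (fst p)) (fst (snd (fst p))) (fst (snd (snd (fst p)))) (snd (snd (snd (fst p)))))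
     \<in> borel_measurable coll_base"
  "(\<lambda>p. coll_dens \<delta> \<alpha> C v I p * G (coll_param v I p)) \<in> borel_measurable coll_base"
proof -
  have 1: "coll_param v I \<in> measurable coll_base borel"
    by (rule coll_param_measurable[of "\<lambda>_. v" _ "\<lambda>_. I" "\<lambda>p. p"]) auto
  then show "coll_param v I \<in> measurable (density coll_base h) borel"
    by (simp cong: measurable_cong_sets)
  show 2: "(\<lambda>z. indicator coll_region z *\<^sub>R G z) \<in> borel_measurable borel"
    by (intro borel_measurable_scaleR borel_measurable_indicator coll_region_borel G)
  show "(\<lambda>p. indicator coll_region (coll_param v I p) *\<^sub>R G (coll_param v I p)) \<in> borel_measurable coll_base"
    by (rule measurable_compose[OF 1 2])
  show "(\<lambda>p. coll_dens \<delta> \<alpha> C v I p * G (coll_param v I p)) \<in> borel_measurable coll_base"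
    by (intro borel_measurable_times measurable_compose[OF 1 G] coll_dens_measurable) auto
  have [measurable]: "fst \<in> borel_measurable coll_base" "snd \<in> borel_measurable coll_base"
    by (simp_all cong: measurable_cong_sets)
  show "(\<lambda>p. W_density \<delta> \<alpha> C v I (fst (fst p)) (fst (snd (fst p))) (fst (snd (snd (fst p)))) (snd (snd (snd (fst p)))))
     \<in> borel_measurable coll_base"
    by (intro W_density_measurable) measurable
qed

lemma W_integrable_iff:
  "integrable (W_measure \<delta> \<alpha> C v I) G \<longleftrightarrow>
     integrable coll_base (\<lambda>p. coll_dens \<delta> \<alpha> C v I p * G (coll_param v I p))"
  unfolding W_measure_altdef case_prod_beta
  by (subst integrable_restrict_space, simp,
      subst integrable_distr_eq[OF W_integral_measurable(1,2)],
      subst integrable_density[OF W_integral_measurable(3,4)],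
      simp add: W_density_nonneg C)
     (intro integrable_cong_AE AE_W_density_eq_coll_dens W_integral_measurable(3-5) borel_measurable_scaleR)

lemma W_integral_eq:
  "(\<integral>z. G z \<partial>W_measure \<delta> \<alpha> C v I) = (\<integral>p. coll_dens \<delta> \<alpha> C v I p * G (coll_param v I p) \<partial>coll_base)"
  unfolding W_measure_altdef case_prod_beta
  by (subst integral_restrict_space, simp,
      subst integral_distr[OF W_integral_measurable(1,2)],
      subst integral_density[OF W_integral_measurable(3,4)],
      simp add: W_density_nonneg C)
     (intro integral_cong_AE AE_W_density_eq_coll_dens W_integral_measurable(3-5) borel_measurable_scaleR)

end

lemma W_integral_cong_region:
  assumes "\<And>z. z \<in> coll_region \<Longrightarrow> G z = H z"
  shows "(\<integral>z. G z \<partial>W_measure \<delta> \<alpha> C v I) = (\<integral>z. H z \<partial>W_measure \<delta> \<alpha> C v I)"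
    and "integrable (W_measure \<delta> \<alpha> C v I) G \<longleftrightarrow> integrable (W_measure \<delta> \<alpha> C v I) H"
  by (intro Bochner_Integration.integral_cong Bochner_Integration.integrable_cong refl;
      use assms in \<open>simp add: space_W_measure\<close>)+

text \<open>A family of measures varying with \<open>(v, I)\<close> is traded for one fixed measure with a jointly measurable
  density, so that Fubini's measurability theorem applies.\<close>

lemma W_integral_measurable_param:
  fixes G :: "'q \<Rightarrow> coll_state \<Rightarrow> real"
  assumes C: "0 \<le> C" and G: "case_prod G \<in> borel_measurable (N \<Otimes>\<^sub>M borel)"
    and [measurable]: "V \<in> borel_measurable N" "J \<in> borel_measurable N"
  shows "(\<lambda>q. \<integral>z. G q z \<partial>W_measure \<delta> \<alpha> C (V q) (J q)) \<in> borel_measurable N"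
proof -
  have "(\<lambda>q. \<integral>p. coll_dens \<delta> \<alpha> C (V q) (J q) p * G q (coll_param (V q) (J q) p) \<partial>coll_base) \<in> borel_measurable N"
  proof (rule coll_base.borel_measurable_lebesgue_integral)
    have [measurable]: "(\<lambda>x. V (fst x)) \<in> borel_measurable (N \<Otimes>\<^sub>M coll_base)" "(\<lambda>x. J (fst x)) \<in> borel_measurable (N \<Otimes>\<^sub>M coll_base)"
      by (auto intro!: measurable_compose[OF measurable_fst])
    have "(\<lambda>x. (fst x, coll_param (V (fst x)) (J (fst x)) (snd x))) \<in> measurable (N \<Otimes>\<^sub>M coll_base) (N \<Otimes>\<^sub>M borel)"
      by (intro measurable_Pair coll_param_measurable) auto
    from measurable_compose[OF this G]
    have "(\<lambda>x. G (fst x) (coll_param (V (fst x)) (J (fst x)) (snd x))) \<in> borel_measurable (N \<Otimes>\<^sub>M coll_base)"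
      by simp
    then show "(\<lambda>(q, p). coll_dens \<delta> \<alpha> C (V q) (J q) p * G q (coll_param (V q) (J q) p))
      \<in> borel_measurable (N \<Otimes>\<^sub>M coll_base)"
      unfolding case_prod_beta by (intro borel_measurable_times coll_dens_measurable) auto
  qed
  also have "?this \<longleftrightarrow> (\<lambda>q. \<integral>z. G q z \<partial>W_measure \<delta> \<alpha> C (V q) (J q)) \<in> borel_measurable N"
  proof (rule measurable_cong)
    fix q assume "q \<in> space N"
    then have "G q \<in> borel_measurable borel"
      using measurable_compose[OF measurable_Pair1' G] by simp
    from W_integral_eq[OF C this]
    show "(\<integral>p. coll_dens \<delta> \<alpha> C (V q) (J q) p * G q (coll_param (V q) (J q) p) \<partial>coll_base)
        = (\<integral>z. G q z \<partial>W_measure \<delta> \<alpha> C (V q) (J q))" by simp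
  qed
  finally show ?thesis .
qed

section \<open>Gaussian integrals over the collision parameters\<close>

lemma nn_integral_lborel_pair:
  fixes f :: "'a::euclidean_space \<times> 'b::euclidean_space \<Rightarrow> ennreal"
  assumes "f \<in> borel_measurable borel"
  shows "(\<integral>\<^sup>+z. f z \<partial>lborel) = (\<integral>\<^sup>+x. \<integral>\<^sup>+y. f (x, y) \<partial>lborel \<partial>lborel)"
proof -
  have "f \<in> borel_measurable (lborel \<Otimes>\<^sub>M lborel)"
    using assms by (simp add: lborel_prod)
  from lborel.nn_integral_fst[OF this] show ?thesis
    by (simp add: lborel_prod)
qed

lemma nn_integral_lborel_quadruple:
  fixes f :: "'a::euclidean_space \<times> 'b::euclidean_space \<times> 'c::euclidean_space \<times> 'd::euclidean_space \<Rightarrow> ennreal"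
  assumes f: "f \<in> borel_measurable borel"
  shows "(\<integral>\<^sup>+z. f z \<partial>lborel) = (\<integral>\<^sup>+x. \<integral>\<^sup>+y. \<integral>\<^sup>+z. \<integral>\<^sup>+t. f (x, y, z, t) \<partial>lborel \<partial>lborel \<partial>lborel \<partial>lborel)"
proof -
  have "(\<lambda>q. f (x, q)) \<in> borel_measurable borel" for x
    by (rule measurable_compose[OF _ f]) (intro borel_measurable_continuous_onI continuous_intros)
  moreover have "(\<lambda>q. f (x, y, q)) \<in> borel_measurable borel" for x y
    by (rule measurable_compose[OF _ f]) (intro borel_measurable_continuous_onI continuous_intros)
  ultimately show ?thesis
    using f by (simp add: nn_integral_lborel_pair)
qed

lemma nn_integral_exp_tail:
  fixes c :: real
  assumes c: "0 < c"
  shows "(\<integral>\<^sup>+x. ennreal (exp (- c * x)) * indicator {0..} x \<partial>lborel) = ennreal (1 / c)"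
proof -
  have "((\<lambda>x. exp (- c * x)) \<longlongrightarrow> 0) at_top"
    by (rule filterlim_compose[OF exp_at_bot])
       (rule filterlim_tendsto_neg_mult_at_bot[OF tendsto_const _ filterlim_ident], use c in simp)
  then have lim: "((\<lambda>x. - (exp (- c * x) / c)) \<longlongrightarrow> - (0 / c)) at_top"
    by (intro tendsto_intros) (use c in auto)
  have "(\<integral>\<^sup>+x. ennreal (exp (- c * x)) * indicator {0..} x \<partial>lborel) = ennreal (- (0 / c) - (- (exp (- c * 0) / c)))"
    by (rule nn_integral_FTC_atLeast[OF _ _ _ lim]) (use c in \<open>auto intro!: derivative_eq_intros\<close>)
  then show ?thesis by simp
qed

lemma nn_integral_inverse_square: "(\<integral>\<^sup>+x. ennreal (1 / (1 + x)\<^sup>2) * indicator {0..} x \<partial>lborel) = 1"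
proof -
  have "((\<lambda>x::real. 1 / (1 + x)) \<longlongrightarrow> 0) at_top"
    by (intro tendsto_divide_0[OF tendsto_const] filterlim_at_top_imp_at_infinity
         filterlim_tendsto_add_at_top[OF tendsto_const filterlim_ident])
  then have lim: "((\<lambda>x::real. - (1 / (1 + x))) \<longlongrightarrow> - 0) at_top"
    by (intro tendsto_intros)
  have "(\<integral>\<^sup>+x. ennreal (1 / (1 + x)\<^sup>2) * indicator {0..} x \<partial>lborel) = ennreal (- 0 - (- (1 / (1 + 0))))"
    by (rule nn_integral_FTC_atLeast[OF _ _ _ lim])
       (auto intro!: derivative_eq_intros simp: power2_eq_square field_simps)
  then show ?thesis by simp
qed

lemma nn_integral_gaussian_finite: "(\<integral>\<^sup>+x. ennreal (exp (- (x\<^sup>2) / 8)) \<partial>(lborel :: real measure)) < \<infinity>"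
proof -
  let ?h = "\<lambda>x::real. ennreal (exp (- 1 * x)) * indicator {0..} x"
  have b: "ennreal (exp (- (x\<^sup>2) / 8)) \<le> ennreal (exp 2) * (?h x + ?h (- x))" for x :: real
  proof -
    \<comment> \<open>completing the square in \<open>x\<^sup>2 / 8 - |x|\<close> produces the constant \<open>exp 2\<close>\<close>
    have "0 \<le> (\<bar>x\<bar> - 4)\<^sup>2" by simp
    then have "- (x\<^sup>2) / 8 \<le> 2 - \<bar>x\<bar>" by (simp add: power2_diff)
    then have "ennreal (exp (- (x\<^sup>2) / 8)) \<le> ennreal (exp 2 * exp (- \<bar>x\<bar>))"
      by (intro ennreal_leI) (simp flip: exp_add)
    also have "\<dots> = ennreal (exp 2) * ennreal (exp (- \<bar>x\<bar>))" by (simp add: ennreal_mult)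
    also have "\<dots> \<le> ennreal (exp 2) * (?h x + ?h (- x))"
      by (intro mult_left_mono) (auto simp: indicator_def abs_if)
    finally show ?thesis .
  qed
  have r: "(\<integral>\<^sup>+x. ?h (- x) \<partial>lborel) = (\<integral>\<^sup>+x. ?h x \<partial>lborel)"
    using nn_integral_real_affine[of ?h "-1" 0] by simp
  have "(\<integral>\<^sup>+x. ennreal (exp (- (x\<^sup>2) / 8)) \<partial>(lborel :: real measure))
      \<le> (\<integral>\<^sup>+x. ennreal (exp 2) * (?h x + ?h (- x)) \<partial>lborel)"
    by (intro nn_integral_mono b)
  also have "\<dots> = ennreal (exp 2) * ((\<integral>\<^sup>+x. ?h x \<partial>lborel) + (\<integral>\<^sup>+x. ?h (- x) \<partial>lborel))"
    by (subst nn_integral_cmult, measurable, subst nn_integral_add, measurable)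
  also have "\<dots> = ennreal (exp 2) * (1 + 1)"
    unfolding r using nn_integral_exp_tail[of 1] by simp
  also have "\<dots> < \<infinity>" by (simp add: ennreal_mult_less_top)
  finally show ?thesis .
qed

lemma nn_integral_gaussian_vector_finite:
  "(\<integral>\<^sup>+x. ennreal (exp (- (norm x)\<^sup>2 / 8)) \<partial>(lborel :: 'a::euclidean_space measure)) < \<infinity>"
proof -
  have "ennreal (exp (- (norm x)\<^sup>2 / 8)) = (\<Prod>b\<in>Basis. ennreal (exp (- ((x \<bullet> b)\<^sup>2) / 8)))" for x :: 'a
  proof -
    have "(norm x)\<^sup>2 = (\<Sum>b\<in>Basis. (x \<bullet> b)\<^sup>2)"
      unfolding power2_norm_eq_inner by (subst euclidean_inner) (simp add: power2_eq_square)
    then have "exp (- (norm x)\<^sup>2 / 8) = (\<Prod>b\<in>Basis. exp (- ((x \<bullet> b)\<^sup>2) / 8))"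
      by (subst exp_sum[symmetric]) (simp_all add: sum_negf sum_divide_distrib)
    then show ?thesis by (simp add: prod_ennreal)
  qed
  then have "(\<integral>\<^sup>+x. ennreal (exp (- (norm x)\<^sup>2 / 8)) \<partial>(lborel :: 'a::euclidean_space measure))
     = (\<Prod>b\<in>(Basis :: 'a set). (\<integral>\<^sup>+x. ennreal (exp (- (x\<^sup>2) / 8)) \<partial>lborel))"
    by (simp only:) (rule nn_integral_lborel_prod, auto)
  also have "\<dots> < \<infinity>"
    using nn_integral_gaussian_finite by (simp add: power_less_top_ennreal)
  finally show ?thesis .
qed

text \<open>Total mass of \<open>exp (- (|v\<^sub>*|\<^sup>2 + I\<^sub>*) / 8) dv\<^sub>* dI\<^sub>* d\<omega>\<close>, the factor \<open>8\<close> being the integral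
  over \<open>I\<^sub>*\<close>.\<close>

definition coll_mass :: ennreal where
  "coll_mass = emeasure sphere_measure UNIV *
     ((\<integral>\<^sup>+x. ennreal (exp (- (norm x)\<^sup>2 / 8)) \<partial>(lborel :: (real^3) measure)) * ennreal 8)"

lemma coll_mass_finite: "coll_mass < top"
  unfolding coll_mass_def
  using nn_integral_gaussian_vector_finite[where 'a="real^3"] sphere.emeasure_finite[of UNIV]
  by (intro ennreal_mult_less_top[THEN iffD2] disjI2 conjI) (simp_all add: less_top[symmetric])

text \<open>All bounds used for the integrands are independent of \<open>\<omega>\<close>, so only the total mass of the sphere
  enters. It then suffices to bound the integral over the outgoing internal energies by a Gaussian in the
  remaining variables.\<close>

lemma nn_integral_coll_base_le:
  fixes h :: "(real^3) \<times> real \<times> real \<times> real \<Rightarrow> ennreal"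
  assumes h: "h \<in> borel_measurable borel"
    and le: "\<And>vs Is. (\<integral>\<^sup>+I'. \<integral>\<^sup>+Is'. h (vs, Is, I', Is') \<partial>lborel \<partial>lborel)
               \<le> B * (ennreal (exp (- ((norm vs)\<^sup>2 + Is) / 8)) * indicator {0..} Is)"
  shows "(\<integral>\<^sup>+p. h (fst p) \<partial>coll_base) \<le> B * coll_mass"
proof -
  let ?g = "\<lambda>vs::real^3. ennreal (exp (- (norm vs)\<^sup>2 / 8))"
  let ?k = "\<lambda>x::real. ennreal (exp (- (1/8) * x)) * indicator {0..} x"
  have [measurable]: "(\<lambda>p. h (fst p)) \<in> borel_measurable coll_base"
    by (rule measurable_compose[OF measurable_fst]) (use h in simp)
  have "(\<integral>\<^sup>+p. h (fst p) \<partial>coll_base) = (\<integral>\<^sup>+q. \<integral>\<^sup>+\<omega>. h q \<partial>sphere_measure \<partial>lborel)"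
    by (subst sphere.nn_integral_fst[symmetric]) auto
  also have "\<dots> = (\<integral>\<^sup>+q. h q \<partial>lborel) * emeasure sphere_measure UNIV"
    using h by (simp add: nn_integral_multc)
  also have "(\<integral>\<^sup>+q. h q \<partial>lborel) \<le> (\<integral>\<^sup>+vs. \<integral>\<^sup>+Is. B * (?g vs * ?k Is) \<partial>lborel \<partial>lborel)"
    unfolding nn_integral_lborel_quadruple[OF h]
  proof (intro nn_integral_mono)
    fix vs :: "real^3" and Is :: real
    have "ennreal (exp (- ((norm vs)\<^sup>2 + Is) / 8)) * indicator {0..} Is = ?g vs * ?k Is"
    proof -
      have "exp (- ((norm vs)\<^sup>2 + Is) / 8) = exp (- (norm vs)\<^sup>2 / 8) * exp (- (1/8) * Is)"
        unfolding exp_add[symmetric] by (rule arg_cong[where f=exp]) simp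
      then show ?thesis by (simp only: ennreal_mult exp_ge_zero mult.assoc)
    qed
    with le[of vs Is] show "(\<integral>\<^sup>+I'. \<integral>\<^sup>+Is'. h (vs, Is, I', Is') \<partial>lborel \<partial>lborel) \<le> B * (?g vs * ?k Is)"
      by simp
  qed
  also have "\<dots> = B * ((\<integral>\<^sup>+vs. ?g vs \<partial>lborel) * (\<integral>\<^sup>+Is. ?k Is \<partial>lborel))"
  proof -
    have "(\<integral>\<^sup>+Is. B * (?g vs * ?k Is) \<partial>lborel) = B * (?g vs * (\<integral>\<^sup>+Is. ?k Is \<partial>lborel))" for vs
      by (subst nn_integral_cmult, measurable, subst nn_integral_cmult, measurable)
    moreover have "(\<integral>\<^sup>+vs. B * (?g vs * c) \<partial>lborel) = B * ((\<integral>\<^sup>+vs. ?g vs \<partial>lborel) * c)" for c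
      by (subst nn_integral_cmult, measurable, subst nn_integral_multc, measurable)
    ultimately show ?thesis by (simp only:)
  qed
  also have "(\<integral>\<^sup>+Is. ?k Is \<partial>lborel) = ennreal 8"
    using nn_integral_exp_tail[of "1/8"] by simp
  finally show ?thesis
    unfolding coll_mass_def by (simp add: mult_right_mono mult_ac)
qed

text \<open>From \<open>ln y \<le> y\<close> at \<open>y = x e / k\<close>.\<close>

lemma powr_le_exp:
  fixes k e :: real
  assumes "0 \<le> k" "0 < e"
  obtains c where "0 < c" "\<And>x. 0 < x \<Longrightarrow> x powr k \<le> c * exp (e * x)"
proof (cases "k = 0")
  case True
  have "x powr k \<le> 1 * exp (e * x)" if "0 < x" for x
    using True that assms by simp
  then show ?thesis using that[of 1] by simp
next
  case False
  then have k: "0 < k" using assms by simp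
  have "x powr k \<le> exp (k * ln (k / e)) * exp (e * x)" if x: "0 < x" for x
  proof -
    have "ln x = ln (k / e) + ln (x * e / k)"
      using x k assms by (simp add: ln_mult ln_div)
    also have "ln (x * e / k) \<le> x * e / k" using ln_bound[of "x * e / k"] x k assms by simp
    finally have "k * ln x \<le> k * (ln (k / e) + x * e / k)" using k by simp
    also have "\<dots> = k * ln (k / e) + e * x" using k by (simp add: field_simps)
    finally show ?thesis using x by (simp add: powr_def flip: exp_add)
  qed
  then show ?thesis using that[of "exp (k * ln (k / e))"] by simp
qed

section \<open>Weights and pointwise bounds of the collision kernel\<close>

locale polyatomic_kernel =
  fixes \<delta> \<alpha> C \<beta> :: real
  assumes \<delta>: "2 \<le> \<delta>" and \<alpha>: "0 \<le> \<alpha>" "\<alpha> \<le> 2" and C: "0 < C" and \<beta>: "5 < \<beta>"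
begin

abbreviation M :: "real^3 \<Rightarrow> real \<Rightarrow> real" where "M \<equiv> maxwellian \<delta>"
abbreviation w :: "real^3 \<Rightarrow> real \<Rightarrow> real" where "w \<equiv> weight \<beta>"
abbreviation dens :: "real^3 \<Rightarrow> real \<Rightarrow> coll_par \<Rightarrow> real" where "dens \<equiv> coll_dens \<delta> \<alpha> C"
abbreviation sqrtM :: "real^3 \<Rightarrow> real \<Rightarrow> real" where "sqrtM v I \<equiv> sqrt (M v I)"

definition maxw_const :: real where
  "maxw_const = 1 / sqrt ((2 * pi) powr (3 / 2) * Gamma (\<delta> / 2))"

lemma Gamma_half_pos: "0 < Gamma (\<delta> / 2)" using \<delta> by (intro Gamma_real_pos) simp

lemma maxw_const_pos: "0 < maxw_const"
  using Gamma_half_pos by (simp add: maxw_const_def)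

lemma maxwellian_pos: "0 < I \<Longrightarrow> 0 < M v I"
  using Gamma_half_pos by (simp add: maxwellian_def)

lemma sqrt_maxwellian:
  assumes "0 < I"
  shows "sqrtM v I = maxw_const * I powr (\<delta> / 4 - 1 / 2) * exp (- (norm v)\<^sup>2 / 4 - I / 2)"
proof (rule real_sqrt_unique)
  have "(I powr (\<delta> / 4 - 1 / 2))\<^sup>2 = I powr (\<delta> / 2 - 1)"
    using assms by (simp add: power2_eq_square flip: powr_add)
  moreover have "(exp (- (norm v)\<^sup>2 / 4 - I / 2))\<^sup>2 = exp (- (norm v)\<^sup>2 / 2 - I)"
    by (simp add: power2_eq_square flip: exp_add)
  moreover have "maxw_const\<^sup>2 = 1 / ((2 * pi) powr (3 / 2) * Gamma (\<delta> / 2))"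
    using Gamma_half_pos by (simp add: maxw_const_def power_divide)
  ultimately show "(maxw_const * I powr (\<delta> / 4 - 1 / 2) * exp (- (norm v)\<^sup>2 / 4 - I / 2))\<^sup>2 = M v I"
    by (simp add: power_mult_distrib maxwellian_def)
qed (use maxw_const_pos in auto)

text \<open>The factor \<open>I\<^bsup>\<delta>/4-1/2\<^esup>\<close> of \<open>\<surd>M\<close> is absorbed by half of the exponential decay in \<open>I\<close>.\<close>

definition gauss_const :: real where
  "gauss_const = (SOME c. 0 < c \<and> (\<forall>v I. 0 < I \<longrightarrow> sqrtM v I \<le> c * exp (- ((norm v)\<^sup>2 + I) / 4)))"

lemma gauss_const:
  shows "0 < gauss_const" and "0 < I \<Longrightarrow> sqrtM v I \<le> gauss_const * exp (- ((norm v)\<^sup>2 + I) / 4)"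
proof -
  obtain c where c: "0 < c" "\<And>x. 0 < x \<Longrightarrow> x powr (\<delta> / 4 - 1 / 2) \<le> c * exp (1 / 4 * x)"
    using powr_le_exp[of "\<delta> / 4 - 1 / 2" "1/4"] \<delta> by auto
  have "sqrtM v I \<le> (maxw_const * c) * exp (- ((norm v)\<^sup>2 + I) / 4)" if I: "0 < I" for v I
  proof -
    have "sqrtM v I = maxw_const * I powr (\<delta> / 4 - 1 / 2) * exp (- (norm v)\<^sup>2 / 4 - I / 2)"
      by (rule sqrt_maxwellian[OF I])
    also have "\<dots> \<le> maxw_const * (c * exp (1 / 4 * I)) * exp (- (norm v)\<^sup>2 / 4 - I / 2)"
      using c(2)[OF I] maxw_const_pos by (intro mult_right_mono mult_left_mono) auto
    also have "\<dots> = (maxw_const * c) * (exp (1 / 4 * I) * exp (- (norm v)\<^sup>2 / 4 - I / 2))" by simp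
    also have "exp (1 / 4 * I) * exp (- (norm v)\<^sup>2 / 4 - I / 2) = exp (- ((norm v)\<^sup>2 + I) / 4)"
      unfolding exp_add[symmetric] by (rule arg_cong[where f=exp]) (simp add: field_simps)
    finally show ?thesis .
  qed
  moreover have "0 < maxw_const * c" using c maxw_const_pos by simp
  ultimately have "\<exists>c. 0 < c \<and> (\<forall>v I. 0 < I \<longrightarrow> sqrtM v I \<le> c * exp (- ((norm v)\<^sup>2 + I) / 4))" by blast
  from someI_ex[OF this, folded gauss_const_def]
  show "0 < gauss_const" and "0 < I \<Longrightarrow> sqrtM v I \<le> gauss_const * exp (- ((norm v)\<^sup>2 + I) / 4)" by blast+
qed

text \<open>The weight with exponent \<open>2\<close>. It is comparable to \<open>1 + |v|\<^sup>2 + I\<close>, hence to the conserved energy, and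
  it bounds the growth of the collision frequency.\<close>

definition quad_weight :: "real^3 \<Rightarrow> real \<Rightarrow> real" where
  "quad_weight v I = (1 + norm v + sqrt I)\<^sup>2"

lemma quad_weight_ge: "0 \<le> I \<Longrightarrow> 1 + (norm v)\<^sup>2 + I \<le> quad_weight v I"
proof -
  assume I: "0 \<le> I"
  have "quad_weight v I = 1 + (norm v)\<^sup>2 + (sqrt I)\<^sup>2 + 2 * norm v + 2 * sqrt I + 2 * norm v * sqrt I"
    by (simp add: quad_weight_def power2_eq_square algebra_simps)
  moreover have "(sqrt I)\<^sup>2 = I" using I by simp
  moreover have "0 \<le> norm v" "0 \<le> sqrt I" "0 \<le> norm v * sqrt I" using I by auto
  ultimately show ?thesis by linarith
qed

lemma quad_weight_le: "0 \<le> I \<Longrightarrow> quad_weight v I \<le> 3 * (1 + (norm v)\<^sup>2 + I)"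
proof -
  assume I: "0 \<le> I"
  have "0 \<le> (norm v - 1)\<^sup>2 + (sqrt I - 1)\<^sup>2 + (norm v - sqrt I)\<^sup>2" by simp
  moreover have "(sqrt I)\<^sup>2 = I" using I by simp
  ultimately show ?thesis by (simp add: quad_weight_def power2_eq_square algebra_simps)
qed

lemma quad_weight_ge_1: "0 \<le> I \<Longrightarrow> 1 \<le> quad_weight v I"
  using quad_weight_ge[of I v] by (smt (verit) zero_le_power2)

lemma weight_eq: "0 \<le> I \<Longrightarrow> w v I = quad_weight v I powr (\<beta> / 2)"
proof -
  assume I: "0 \<le> I"
  have p: "0 < 1 + norm v + sqrt I" using I by (simp add: add_pos_nonneg)
  have "quad_weight v I = (1 + norm v + sqrt I) powr 2"
    unfolding quad_weight_def using p by (simp add: powr_realpow)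
  then show ?thesis by (simp add: weight_def powr_powr)
qed

lemma weight_ge_1: "0 \<le> I \<Longrightarrow> 1 \<le> w v I"
  using quad_weight_ge_1[of I v] \<beta> by (simp add: weight_eq ge_one_powr_ge_zero)

lemma quad_weight_le_weight: "0 \<le> I \<Longrightarrow> quad_weight v I \<le> w v I"
  using quad_weight_ge_1[of I v] \<beta> powr_mono[of 1 "\<beta> / 2" "quad_weight v I"] by (simp add: weight_eq)

text \<open>Integrable decay in the internal energy alone: \<open>1 / w\<close> is at most \<open>(1 + I)\<^bsup>-2\<^esup>\<close>. This is the
  decay that makes the gain term integrable in the outgoing energies.\<close>

lemma square_le_weight: "0 \<le> I \<Longrightarrow> (1 + I)\<^sup>2 \<le> w v I"
proof -
  assume I: "0 \<le> I"
  have "1 + I \<le> quad_weight v I" using quad_weight_ge[OF I, of v] by (smt (verit) zero_le_power2)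
  then have "(1 + I)\<^sup>2 \<le> (quad_weight v I)\<^sup>2" using I by (intro power_mono) auto
  also have "\<dots> = quad_weight v I powr 2" using quad_weight_ge_1[OF I, of v] by (simp add: powr_realpow)
  also have "\<dots> \<le> w v I"
    unfolding weight_eq[OF I] by (rule powr_mono) (use quad_weight_ge_1[OF I, of v] \<beta> in auto)
  finally show ?thesis .
qed

text \<open>\<open>\<surd>M\<close> compensates both the weight and the growth of the collision frequency; this turns the nonlocal
  loss term \<open>K\<^sub>1\<close> into a bounded operator.\<close>

lemma weighted_maxwellian_bounded:
  obtains c where "1 \<le> c" "\<And>v I. 0 < I \<Longrightarrow> sqrtM v I * (w v I * quad_weight v I) \<le> c"
proof -
  obtain c2 where c2: "0 < c2" "\<And>x. 0 < x \<Longrightarrow> x powr (\<beta> / 2 + 1) \<le> c2 * exp (1 / 12 * x)"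
    using powr_le_exp[of "\<beta> / 2 + 1" "1/12"] \<beta> by auto
  let ?c = "1 + gauss_const * c2 * exp (1 / 4)"
  have "sqrtM v I * (w v I * quad_weight v I) \<le> ?c" if I: "0 < I" for v I
  proof -
    let ?X = "quad_weight v I"
    have X: "1 \<le> ?X" using quad_weight_ge_1 I by simp
    have "w v I * ?X = ?X powr (\<beta> / 2 + 1)"
      using X I by (simp add: weight_eq powr_add)
    also have "\<dots> \<le> c2 * exp (1 / 12 * ?X)" using X by (intro c2(2)) simp
    finally have a: "w v I * ?X \<le> c2 * exp (1 / 12 * ?X)" .
    \<comment> \<open>the energy is at least \<open>quad_weight / 3 - 1\<close>, which leaves the rate \<open>1 / 12\<close>\<close>
    have "- ((norm v)\<^sup>2 + I) / 4 \<le> 1 / 4 - 1 / 12 * ?X"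
      using quad_weight_le[of I v] I by simp
    then have "gauss_const * exp (- ((norm v)\<^sup>2 + I) / 4) \<le> gauss_const * exp (1 / 4 - 1 / 12 * ?X)" using gauss_const(1) by simp
    with gauss_const(2)[OF I, of v] have b: "sqrtM v I \<le> gauss_const * exp (1 / 4 - 1 / 12 * ?X)" by simp
    have "sqrtM v I * (w v I * ?X) \<le> (gauss_const * exp (1 / 4 - 1 / 12 * ?X)) * (c2 * exp (1 / 12 * ?X))"
      by (rule mult_mono[OF b a])
         (use gauss_const(1) X weight_ge_1[of I v] I in auto)
    also have "\<dots> = gauss_const * c2 * (exp (1 / 4 - 1 / 12 * ?X) * exp (1 / 12 * ?X))" by simp
    also have "exp (1 / 4 - 1 / 12 * ?X) * exp (1 / 12 * ?X) = exp (1 / 4)"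
      unfolding exp_add[symmetric] by simp
    finally show ?thesis by simp
  qed
  moreover have "1 \<le> ?c" using gauss_const(1) c2 by simp
  ultimately show ?thesis by (rule that[rotated])
qed

text \<open>The common majorant of the gain and loss densities. The exponential is what remains of
  \<open>\<surd>M\<^sub>*\<close>.\<close>

definition dom_kernel :: "real^3 \<Rightarrow> real \<Rightarrow> (real^3) \<times> real \<times> real \<times> real \<Rightarrow> real" where
  "dom_kernel v I = (\<lambda>(vs, Is, I', Is'). let \<Phi> = coll_energy v vs I Is in
     if 0 < Is \<and> 0 < I' \<and> 0 < Is' \<and> I' + Is' < \<Phi>
     then \<Phi> powr (- 1 - \<alpha> / 2) * exp (- ((norm vs)\<^sup>2 + Is) / 4) else 0)"

lemma dom_kernel_nonneg: "0 \<le> dom_kernel v I q"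
  by (simp add: dom_kernel_def Let_def split: prod.split)

lemma dom_kernel_measurable: "dom_kernel v I \<in> borel_measurable borel"
  unfolding dom_kernel_def case_prod_beta Let_def by measurable

lemma coll_energy_conservation:
  assumes z: "coll_param v I ((vs, Is, I', Is'), \<omega>) = (vs, v', vs', Is, I', Is')"
    and "norm \<omega> = 1" "I' + Is' < coll_energy v vs I Is"
  shows "(norm v')\<^sup>2 / 2 + (norm vs')\<^sup>2 / 2 + I' + Is' = (norm v)\<^sup>2 / 2 + (norm vs)\<^sup>2 / 2 + I + Is"
proof -
  define s where "s = sqrt (coll_energy v vs I Is - I' - Is')"
  have s2: "s\<^sup>2 = coll_energy v vs I Is - I' - Is'" using assms by (simp add: s_def)
  have v': "v' = (1/2) *\<^sub>R (v + vs) + s *\<^sub>R \<omega>" "vs' = (1/2) *\<^sub>R (v + vs) - s *\<^sub>R \<omega>"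
    using z by (auto simp: coll_param_def Let_def s_def)
  have o: "\<omega> \<bullet> \<omega> = 1" using assms(2) by (simp add: norm_eq_1)
  have "(norm v')\<^sup>2 + (norm vs')\<^sup>2 = (1/2) * ((v + vs) \<bullet> (v + vs)) + 2 * s\<^sup>2 * (\<omega> \<bullet> \<omega>)"
    unfolding v' power2_norm_eq_inner
    by (simp add: inner_add_left inner_add_right inner_diff_left inner_diff_right power2_eq_square inner_commute algebra_simps)
  also have "\<dots> = (1/2) * ((v + vs) \<bullet> (v + vs)) + 2 * (((v - vs) \<bullet> (v - vs)) / 4 + I + Is - I' - Is')"
    unfolding s2 o by (simp add: coll_energy_def power2_norm_eq_inner)
  also have "\<dots> = v \<bullet> v + vs \<bullet> vs + 2 * I + 2 * Is - 2 * I' - 2 * Is'"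
    by (simp add: inner_add_left inner_add_right inner_diff_left inner_diff_right inner_commute field_simps)
  finally show ?thesis by (simp add: power2_norm_eq_inner)
qed

text \<open>The square root of \<open>M'M'\<^sub>* / (I'I'\<^sub>*)\<^bsup>\<delta>/2-1\<^esup> = M M\<^sub>* / (I I\<^sub>*)\<^bsup>\<delta>/2-1\<^esup>\<close>, which is conservation of
  energy in the exponentials.\<close>

lemma detailed_balance:
  assumes "0 < I" "0 < Is" "0 < I'" "0 < Is'"
    and "(norm v')\<^sup>2 / 2 + (norm vs')\<^sup>2 / 2 + I' + Is' = (norm v)\<^sup>2 / 2 + (norm vs)\<^sup>2 / 2 + I + Is"
  shows "sqrtM v' I' * sqrtM vs' Is' * (I * Is) powr (\<delta> / 4 - 1 / 2)
       = sqrtM v I * sqrtM vs Is * (I' * Is') powr (\<delta> / 4 - 1 / 2)"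
proof -
  have "exp (- (norm v')\<^sup>2 / 4 - I' / 2) * exp (- (norm vs')\<^sup>2 / 4 - Is' / 2)
      = exp (- (norm v)\<^sup>2 / 4 - I / 2) * exp (- (norm vs)\<^sup>2 / 4 - Is / 2)"
    unfolding exp_add[symmetric] by (rule arg_cong[where f=exp]) (use assms(5) in simp)
  then have "(maxw_const * maxw_const * (I powr (\<delta> / 4 - 1 / 2) * Is powr (\<delta> / 4 - 1 / 2) * I' powr (\<delta> / 4 - 1 / 2) * Is' powr (\<delta> / 4 - 1 / 2))) *
      (exp (- (norm v')\<^sup>2 / 4 - I' / 2) * exp (- (norm vs')\<^sup>2 / 4 - Is' / 2))
    = (maxw_const * maxw_const * (I powr (\<delta> / 4 - 1 / 2) * Is powr (\<delta> / 4 - 1 / 2) * I' powr (\<delta> / 4 - 1 / 2) * Is' powr (\<delta> / 4 - 1 / 2))) *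
      (exp (- (norm v)\<^sup>2 / 4 - I / 2) * exp (- (norm vs)\<^sup>2 / 4 - Is / 2))" by simp
  then show ?thesis
    using assms(1-4) by (simp add: sqrt_maxwellian powr_mult mult_ac)
qed

text \<open>The gain part of \<open>\<Gamma>\<close>, with the factor \<open>1 / \<surd>M\<close> moved under the integral.\<close>

definition gain_kernel :: "real^3 \<Rightarrow> real \<Rightarrow> coll_state \<Rightarrow> real" where
  "gain_kernel v I = (\<lambda>(vs, v', vs', Is, I', Is').
     sqrtM v' I' * sqrtM vs' Is' / (I' * Is') powr (\<delta> / 2 - 1) / sqrtM v I)"

definition loss_kernel :: "real \<Rightarrow> coll_state \<Rightarrow> real" where
  "loss_kernel I = (\<lambda>(vs, v', vs', Is, I', Is'). sqrtM vs Is / (I * Is) powr (\<delta> / 2 - 1))"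

lemma kernel_scalar_bound:
  fixes \<Phi> x :: real
  assumes \<Phi>: "0 < \<Phi>" and x: "0 \<le> x" "x \<le> \<Phi> powr (\<delta> - 2)" and y: "0 \<le> y" "y \<le> \<Phi>"
  shows "x / \<Phi> powr (\<delta> + (\<alpha> - 1) / 2) * sqrt y \<le> \<Phi> powr (- 1 - \<alpha> / 2)"
proof -
  have "sqrt y \<le> \<Phi> powr (1 / 2)" using y by (simp add: powr_half_sqrt)
  then have "x / \<Phi> powr (\<delta> + (\<alpha> - 1) / 2) * sqrt y \<le> \<Phi> powr (\<delta> - 2) / \<Phi> powr (\<delta> + (\<alpha> - 1) / 2) * \<Phi> powr (1 / 2)"
    using x y by (intro mult_mono divide_right_mono) auto
  also have "\<dots> = \<Phi> powr (\<delta> - 2 - (\<delta> + (\<alpha> - 1) / 2) + 1 / 2)"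
    by (simp only: powr_add powr_diff)
  also have "\<delta> - 2 - (\<delta> + (\<alpha> - 1) / 2) + 1 / 2 = - 1 - \<alpha> / 2" by (simp add: field_simps)
  finally show ?thesis .
qed

definition dom_const :: real where
  "dom_const = 2 * C * gauss_const"

lemma dom_const_pos: "0 < dom_const"
  using C gauss_const(1) by (simp add: dom_const_def)

text \<open>In the gain term detailed balance replaces \<open>\<surd>M'\<surd>M'\<^sub>* / \<surd>M\<close> by \<open>\<surd>M\<^sub>*\<close> times powers of the internal
  energies. All four internal energies are at most \<open>\<Phi>\<close>, so every product of powers that is left, in gain
  and loss alike, is at most \<open>\<Phi>\<^bsup>\<delta>-2\<^esup>\<close>.\<close>

lemma kernels_dominated:
  assumes I: "0 < I"
  shows "dens v I p * gain_kernel v I (coll_param v I p) \<le> dom_const * dom_kernel v I (fst p)"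
    and "dens v I p * loss_kernel I (coll_param v I p) \<le> dom_const * dom_kernel v I (fst p)"
proof -
  have "dens v I p * gain_kernel v I (coll_param v I p) \<le> dom_const * dom_kernel v I (fst p) \<and>
        dens v I p * loss_kernel I (coll_param v I p) \<le> dom_const * dom_kernel v I (fst p)"
  proof -
    obtain vs Is I' Is' \<omega> where p: "p = ((vs, Is, I', Is'), \<omega>)" by (metis prod.collapse)
    define \<Phi> where "\<Phi> = coll_energy v vs I Is"
    show ?thesis
    proof (cases "norm \<omega> = 1 \<and> 0 < Is \<and> 0 < I' \<and> 0 < Is' \<and> I' + Is' < \<Phi>")
      case False
      then have "dens v I p = 0"
        by (auto simp: coll_dens_def p W_density_def \<Phi>_def)
      then show ?thesis using dom_const_pos dom_kernel_nonneg[of v I "fst p"] by simp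
    next
      case True
      then have pos: "0 < Is" "0 < I'" "0 < Is'" "I' + Is' < \<Phi>" "norm \<omega> = 1" by auto
      obtain v' vs' where z: "coll_param v I p = (vs, v', vs', Is, I', Is')"
        by (auto simp: coll_param_def p Let_def)
      have en: "(norm v')\<^sup>2 / 2 + (norm vs')\<^sup>2 / 2 + I' + Is' = (norm v)\<^sup>2 / 2 + (norm vs)\<^sup>2 / 2 + I + Is"
        by (rule coll_energy_conservation[OF z[unfolded p] pos(5) pos(4)[unfolded \<Phi>_def]])
      have \<Phi>0: "0 < \<Phi>" and IL: "I \<le> \<Phi>" "Is \<le> \<Phi>" "I' \<le> \<Phi>" "Is' \<le> \<Phi>"
        using pos I by (auto simp: \<Phi>_def coll_energy_def)
      let ?a = "\<delta> / 2 - 1" and ?b = "\<delta> / 4 - 1 / 2"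
      have a: "?a = ?b + ?b" by simp
      have dens: "dens v I p = 2 * C * (((I * Is) powr ?a * (I' * Is') powr ?a) / \<Phi> powr (\<delta> + (\<alpha> - 1) / 2) * sqrt (\<Phi> - I' - Is'))"
        using pos I by (simp add: coll_dens_def p W_density_def Let_def \<Phi>_def[symmetric] powr_mult mult_ac)
      have g: "(I * Is) powr ?a * (I' * Is') powr ?a * gain_kernel v I (vs, v', vs', Is, I', Is')
          = (I * Is) powr ?b * (I' * Is') powr ?b * sqrtM vs Is"
      proof -
        have "(I * Is) powr ?a * (I' * Is') powr ?a * gain_kernel v I (vs, v', vs', Is, I', Is')
            = (I * Is) powr ?b * (sqrtM v' I' * sqrtM vs' Is' * (I * Is) powr ?b) / sqrtM v I"
          using pos I unfolding a powr_add gain_kernel_def by simp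
        also have "\<dots> = (I * Is) powr ?b * (I' * Is') powr ?b * sqrtM vs Is"
          unfolding detailed_balance[OF I pos(1-3) en] using maxwellian_pos[OF I, of v] by simp
        finally show ?thesis .
      qed
      have l: "(I * Is) powr ?a * (I' * Is') powr ?a * loss_kernel I (vs, v', vs', Is, I', Is')
          = (I' * Is') powr ?a * sqrtM vs Is"
        using pos I by (simp add: loss_kernel_def)
      have mono: "(x * y) powr k \<le> \<Phi> powr (2 * k)" if "0 < x" "x \<le> \<Phi>" "0 < y" "y \<le> \<Phi>" "0 \<le> k" for x y k
      proof -
        have "(x * y) powr k \<le> (\<Phi> * \<Phi>) powr k" using that by (intro powr_mono2 mult_mono) auto
        also have "\<dots> = \<Phi> powr (2 * k)" using \<Phi>0 by (simp add: powr_mult flip: powr_add)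
        finally show ?thesis .
      qed
      have b: "0 \<le> ?b" "0 \<le> ?a" using \<delta> by auto
      have gb: "(I * Is) powr ?b * (I' * Is') powr ?b \<le> \<Phi> powr (\<delta> - 2)"
      proof -
        have "(I * Is) powr ?b * (I' * Is') powr ?b \<le> \<Phi> powr (2 * ?b) * \<Phi> powr (2 * ?b)"
          by (rule mult_mono[OF mono mono]) (use IL pos I b in auto)
        also have "\<dots> = \<Phi> powr (\<delta> - 2)" by (simp flip: powr_add)
        finally show ?thesis .
      qed
      have lb: "(I' * Is') powr ?a \<le> \<Phi> powr (\<delta> - 2)"
        using mono[of I' Is' ?a] IL pos b by simp
      have dom: "dom_kernel v I (fst p) = \<Phi> powr (- 1 - \<alpha> / 2) * exp (- ((norm vs)\<^sup>2 + Is) / 4)"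
        using pos by (simp add: dom_kernel_def p Let_def \<Phi>_def)
      have main: "2 * C * (x * sqrtM vs Is / \<Phi> powr (\<delta> + (\<alpha> - 1) / 2) * sqrt (\<Phi> - I' - Is')) \<le> dom_const * dom_kernel v I (fst p)"
        if "0 \<le> x" "x \<le> \<Phi> powr (\<delta> - 2)" for x
      proof -
        have "(x / \<Phi> powr (\<delta> + (\<alpha> - 1) / 2) * sqrt (\<Phi> - I' - Is')) * sqrtM vs Is
            \<le> \<Phi> powr (- 1 - \<alpha> / 2) * (gauss_const * exp (- ((norm vs)\<^sup>2 + Is) / 4))"
          using kernel_scalar_bound[OF \<Phi>0 that, of "\<Phi> - I' - Is'"] gauss_const(2)[OF pos(1), of vs] pos that maxwellian_pos[OF pos(1), of vs]
          by (intro mult_mono) auto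
        then have "2 * C * ((x / \<Phi> powr (\<delta> + (\<alpha> - 1) / 2) * sqrt (\<Phi> - I' - Is')) * sqrtM vs Is)
            \<le> 2 * C * (\<Phi> powr (- 1 - \<alpha> / 2) * (gauss_const * exp (- ((norm vs)\<^sup>2 + Is) / 4)))"
          using C by (intro mult_left_mono) auto
        then show ?thesis unfolding dom dom_const_def by (simp add: mult_ac)
      qed
      have "dens v I p * gain_kernel v I (coll_param v I p)
          = 2 * C * (((I * Is) powr ?b * (I' * Is') powr ?b) * sqrtM vs Is / \<Phi> powr (\<delta> + (\<alpha> - 1) / 2) * sqrt (\<Phi> - I' - Is'))"
        unfolding dens z g[symmetric] by (simp add: mult_ac)
      moreover have "dens v I p * loss_kernel I (coll_param v I p)
          = 2 * C * ((I' * Is') powr ?a * sqrtM vs Is / \<Phi> powr (\<delta> + (\<alpha> - 1) / 2) * sqrt (\<Phi> - I' - Is'))"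
        unfolding dens z l[symmetric] by (simp add: mult_ac)
      ultimately show ?thesis
        using main[OF _ gb] main[OF _ lb] by simp
    qed
  qed
  then show "dens v I p * gain_kernel v I (coll_param v I p) \<le> dom_const * dom_kernel v I (fst p)"
    and "dens v I p * loss_kernel I (coll_param v I p) \<le> dom_const * dom_kernel v I (fst p)" by auto
qed

end

section \<open>Integrals of the dominating kernel\<close>

context polyatomic_kernel
begin

lemma nn_integral_product_decay:
  fixes r s :: "real \<Rightarrow> ennreal"
  assumes [measurable]: "r \<in> borel_measurable borel" "s \<in> borel_measurable borel"
  shows "(\<integral>\<^sup>+x. \<integral>\<^sup>+y. k * (r x * s y) \<partial>lborel \<partial>lborel) = k * ((\<integral>\<^sup>+x. r x \<partial>lborel) * (\<integral>\<^sup>+y. s y \<partial>lborel))"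
proof -
  have "(\<integral>\<^sup>+y. k * (r x * s y) \<partial>lborel) = k * (r x * (\<integral>\<^sup>+y. s y \<partial>lborel))" for x
    by (subst nn_integral_cmult, measurable, subst nn_integral_cmult, measurable)
  moreover have "(\<integral>\<^sup>+x. k * (r x * c) \<partial>lborel) = k * ((\<integral>\<^sup>+x. r x \<partial>lborel) * c)" for c
    by (subst nn_integral_cmult, measurable, subst nn_integral_multc, measurable)
  ultimately show ?thesis by (simp only:)
qed

text \<open>The region \<open>I' + I'\<^sub>* < \<Phi>\<close> is enlarged to the square \<open>(0, \<Phi>)\<^sup>2\<close>, over which the integral of \<open>r(I') s(I'\<^sub>*)\<close>
  factorises.\<close>

lemma nn_integral_dom_kernel_le:
  fixes r s :: "real \<Rightarrow> real"
  assumes [measurable]: "r \<in> borel_measurable borel" "s \<in> borel_measurable borel"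
    and nn: "\<And>x. 0 < x \<Longrightarrow> 0 \<le> r x" "\<And>x. 0 < x \<Longrightarrow> 0 \<le> s x"
    and rI: "\<And>\<Phi>. 0 < \<Phi> \<Longrightarrow> (\<integral>\<^sup>+x. ennreal (r x) * indicator {0<..<\<Phi>} x \<partial>lborel) \<le> ennreal (R \<Phi>)"
    and sI: "\<And>\<Phi>. 0 < \<Phi> \<Longrightarrow> (\<integral>\<^sup>+x. ennreal (s x) * indicator {0<..<\<Phi>} x \<partial>lborel) \<le> ennreal (S \<Phi>)"
    and RS: "\<And>\<Phi>. 0 < \<Phi> \<Longrightarrow> 0 \<le> R \<Phi>" "\<And>\<Phi>. 0 < \<Phi> \<Longrightarrow> 0 \<le> S \<Phi>"
    and I: "0 < I" and B: "0 \<le> B"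
    and le: "\<And>vs Is. 0 < Is \<Longrightarrow> coll_energy v vs I Is powr (- 1 - \<alpha> / 2) * (R (coll_energy v vs I Is) * S (coll_energy v vs I Is))
               * exp (- ((norm vs)\<^sup>2 + Is) / 4) \<le> B * exp (- ((norm vs)\<^sup>2 + Is) / 8)"
  shows "(\<integral>\<^sup>+p. (\<lambda>((vs, Is, I', Is'), \<omega>). ennreal (dom_kernel v I (vs, Is, I', Is') * (r I' * s Is'))) p \<partial>coll_base)
     \<le> ennreal B * coll_mass"
proof -
  let ?h = "\<lambda>q. ennreal (dom_kernel v I q * (r (fst (snd (snd q))) * s (snd (snd (snd q)))))"
  have "(\<integral>\<^sup>+p. ?h (fst p) \<partial>coll_base) \<le> ennreal B * coll_mass"
  proof (rule nn_integral_coll_base_le)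
    note [measurable] = dom_kernel_measurable
    show "?h \<in> borel_measurable borel" by measurable
    fix vs :: "real^3" and Is :: real
    define \<Phi> where "\<Phi> = coll_energy v vs I Is"
    show "(\<integral>\<^sup>+I'. \<integral>\<^sup>+Is'. ?h (vs, Is, I', Is') \<partial>lborel \<partial>lborel)
        \<le> ennreal B * (ennreal (exp (- ((norm vs)\<^sup>2 + Is) / 8)) * indicator {0..} Is)"
    proof (cases "0 < Is")
      case False
      then have "?h (vs, Is, I', Is') = 0" for I' Is' by (simp add: dom_kernel_def)
      then show ?thesis by simp
    next
      case True
      then have \<Phi>: "0 < \<Phi>" using I unfolding \<Phi>_def coll_energy_def by (smt (verit) zero_le_power2 divide_nonneg_pos)
      let ?k = "\<Phi> powr (- 1 - \<alpha> / 2) * exp (- ((norm vs)\<^sup>2 + Is) / 4)"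
      have "(\<integral>\<^sup>+I'. \<integral>\<^sup>+Is'. ?h (vs, Is, I', Is') \<partial>lborel \<partial>lborel)
        \<le> (\<integral>\<^sup>+I'. \<integral>\<^sup>+Is'. ennreal ?k * ((ennreal (r I') * indicator {0<..<\<Phi>} I') * (ennreal (s Is') * indicator {0<..<\<Phi>} Is')) \<partial>lborel \<partial>lborel)"
        by (intro nn_integral_mono)
           (use nn in \<open>auto simp: dom_kernel_def \<Phi>_def[symmetric] Let_def indicator_def ennreal_mult' ennreal_mult''\<close>)
      also have "\<dots> = ennreal ?k * ((\<integral>\<^sup>+x. ennreal (r x) * indicator {0<..<\<Phi>} x \<partial>lborel) * (\<integral>\<^sup>+x. ennreal (s x) * indicator {0<..<\<Phi>} x \<partial>lborel))"
        by (rule nn_integral_product_decay) measurable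
      also have "\<dots> \<le> ennreal ?k * (ennreal (R \<Phi>) * ennreal (S \<Phi>))"
        by (intro mult_left_mono mult_mono rI sI \<Phi>) auto
      also have "\<dots> = ennreal (?k * (R \<Phi> * S \<Phi>))"
        using RS[OF \<Phi>] by (simp add: ennreal_mult)
      also have "\<dots> \<le> ennreal (B * exp (- ((norm vs)\<^sup>2 + Is) / 8))"
        using le[OF True, of vs] by (intro ennreal_leI) (simp add: \<Phi>_def mult_ac)
      also have "\<dots> = ennreal B * (ennreal (exp (- ((norm vs)\<^sup>2 + Is) / 8)) * indicator {0..} Is)"
        using True B by (simp add: ennreal_mult)
      finally show ?thesis .
    qed
  qed
  then show ?thesis by (simp add: case_prod_beta)
qed

lemma nn_integral_one_Ioo: "0 < \<Phi> \<Longrightarrow> (\<integral>\<^sup>+x. ennreal 1 * indicator {0<..<\<Phi>} x \<partial>lborel) \<le> ennreal \<Phi>" for \<Phi> :: real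
  by simp

lemma nn_integral_decay_Ioo:
  fixes \<Phi> :: real
  assumes "0 < \<Phi>"
  shows "(\<integral>\<^sup>+x. ennreal (1 / (1 + x)\<^sup>2) * indicator {0<..<\<Phi>} x \<partial>lborel) \<le> ennreal (min 1 \<Phi>)"
proof -
  have "(\<integral>\<^sup>+x. ennreal (1 / (1 + x)\<^sup>2) * indicator {0<..<\<Phi>} x \<partial>lborel)
      \<le> (\<integral>\<^sup>+x. ennreal (1 / (1 + x)\<^sup>2) * indicator {0..} x \<partial>lborel)"
    by (intro nn_integral_mono) (auto simp: indicator_def)
  also have "\<dots> = 1" by (rule nn_integral_inverse_square)
  finally have 1: "(\<integral>\<^sup>+x. ennreal (1 / (1 + x)\<^sup>2) * indicator {0<..<\<Phi>} x \<partial>lborel) \<le> 1" .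
  have "(\<integral>\<^sup>+x. ennreal (1 / (1 + x)\<^sup>2) * indicator {0<..<\<Phi>} x \<partial>lborel)
      \<le> (\<integral>\<^sup>+x. ennreal 1 * indicator {0<..<\<Phi>} x \<partial>lborel)"
  proof (intro nn_integral_mono)
    fix x :: real
    show "ennreal (1 / (1 + x)\<^sup>2) * indicator {0<..<\<Phi>} x \<le> ennreal 1 * indicator {0<..<\<Phi>} x"
    proof (cases "0 < x")
      case True
      then have "1 / (1 + x)\<^sup>2 \<le> 1" by (simp add: divide_le_eq one_le_power)
      then show ?thesis by (auto simp: indicator_def)
    qed (simp add: indicator_def)
  qed
  also have "\<dots> \<le> ennreal \<Phi>" by (rule nn_integral_one_Ioo[OF assms])
  finally show ?thesis using 1 by (simp add: min_def)
qed

text \<open>Here \<open>min 1 \<Phi>\<close> bounds the integral of \<open>(1 + I')\<^bsup>-2\<^esup>\<close> over \<open>(0, \<Phi>)\<close> and \<open>\<Phi>\<close> that of \<open>dI'\<^sub>*\<close>. For small \<open>\<Phi>\<close> the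
  bound \<open>\<Phi>\<close> for both compensates the singularity and needs \<open>\<alpha> \<le> 2\<close>; for large \<open>\<Phi>\<close> the decay
  gives the bound \<open>1\<close> and needs \<open>\<alpha> \<ge> 0\<close>.\<close>

lemma energy_powr_gain_le:
  fixes \<Phi> :: real
  assumes "0 < \<Phi>"
  shows "\<Phi> powr (- 1 - \<alpha> / 2) * (\<Phi> * min 1 \<Phi>) \<le> 1"
proof (cases "\<Phi> \<le> 1")
  case True
  have "\<Phi> powr (- 1 - \<alpha> / 2) * (\<Phi> * min 1 \<Phi>) = \<Phi> powr (- 1 - \<alpha> / 2) * \<Phi> powr 2"
    using True assms by (simp add: powr_realpow power2_eq_square)
  also have "\<dots> = \<Phi> powr (1 - \<alpha> / 2)" by (simp flip: powr_add)
  also have "\<dots> \<le> 1" using True assms \<alpha> by (intro powr_le1) auto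
  finally show ?thesis .
next
  case False
  have "\<Phi> powr (- 1 - \<alpha> / 2) * (\<Phi> * min 1 \<Phi>) = \<Phi> powr (- 1 - \<alpha> / 2) * \<Phi> powr 1"
    using False assms by simp
  also have "\<dots> = \<Phi> powr (- \<alpha> / 2)" unfolding powr_add[symmetric] by simp
  also have "\<dots> \<le> \<Phi> powr 0" using False \<alpha> by (intro powr_mono) auto
  finally show ?thesis using assms by simp
qed

text \<open>Without decay in the outgoing energies the growth \<open>\<Phi>\<^bsup>1-\<alpha>/2\<^esup>\<close> of the collision frequency remains.\<close>

lemma energy_powr_loss_le:
  fixes \<Phi> :: real
  assumes "0 < \<Phi>"
  shows "\<Phi> powr (- 1 - \<alpha> / 2) * (\<Phi> * \<Phi>) \<le> 1 + \<Phi>"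
proof -
  have "\<Phi> powr (- 1 - \<alpha> / 2) * (\<Phi> * \<Phi>) = \<Phi> powr (- 1 - \<alpha> / 2) * \<Phi> powr 2"
    using assms by (simp add: powr_realpow power2_eq_square)
  also have "\<dots> = \<Phi> powr (1 - \<alpha> / 2)" by (simp flip: powr_add)
  also have "\<dots> \<le> (1 + \<Phi>) powr (1 - \<alpha> / 2)" using assms \<alpha> by (intro powr_mono2) auto
  also have "\<dots> \<le> (1 + \<Phi>) powr 1" using assms \<alpha> by (intro powr_mono) auto
  finally show ?thesis using assms by simp
qed

lemma nn_integral_dom_kernel_decay1:
  assumes I: "0 < I"
  shows "(\<integral>\<^sup>+p. (\<lambda>((vs, Is, I', Is'), \<omega>). ennreal (dom_kernel v I (vs, Is, I', Is') * (1 / (1 + I')\<^sup>2 * 1))) p \<partial>coll_base)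
     \<le> ennreal 1 * coll_mass"
proof (rule nn_integral_dom_kernel_le[where R="\<lambda>\<Phi>. min 1 \<Phi>" and S="\<lambda>\<Phi>. \<Phi>"])
  fix vs :: "real^3" and Is :: real assume Is: "0 < Is"
  show "coll_energy v vs I Is powr (- 1 - \<alpha> / 2) * (min 1 (coll_energy v vs I Is) * coll_energy v vs I Is) * exp (- ((norm vs)\<^sup>2 + Is) / 4)
      \<le> 1 * exp (- ((norm vs)\<^sup>2 + Is) / 8)"
    using energy_powr_gain_le[of "coll_energy v vs I Is"] I Is
    by (intro mult_mono) (auto simp: coll_energy_def mult.commute add_nonneg_pos)
qed (use I nn_integral_decay_Ioo nn_integral_one_Ioo in auto)

lemma nn_integral_dom_kernel_decay2:
  assumes I: "0 < I"
  shows "(\<integral>\<^sup>+p. (\<lambda>((vs, Is, I', Is'), \<omega>). ennreal (dom_kernel v I (vs, Is, I', Is') * (1 * (1 / (1 + Is')\<^sup>2)))) p \<partial>coll_base)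
     \<le> ennreal 1 * coll_mass"
proof (rule nn_integral_dom_kernel_le[where S="\<lambda>\<Phi>. min 1 \<Phi>" and R="\<lambda>\<Phi>. \<Phi>"])
  fix vs :: "real^3" and Is :: real assume Is: "0 < Is"
  show "coll_energy v vs I Is powr (- 1 - \<alpha> / 2) * (coll_energy v vs I Is * min 1 (coll_energy v vs I Is)) * exp (- ((norm vs)\<^sup>2 + Is) / 4)
      \<le> 1 * exp (- ((norm vs)\<^sup>2 + Is) / 8)"
    using energy_powr_gain_le[of "coll_energy v vs I Is"] I Is
    by (intro mult_mono) (auto simp: coll_energy_def add_nonneg_pos)
qed (use I nn_integral_decay_Ioo nn_integral_one_Ioo in auto)

lemma nn_integral_dom_kernel:
  assumes I: "0 < I"
  shows "(\<integral>\<^sup>+p. (\<lambda>((vs, Is, I', Is'), \<omega>). ennreal (dom_kernel v I (vs, Is, I', Is') * (1 * 1))) p \<partial>coll_base)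
     \<le> ennreal (8 * quad_weight v I) * coll_mass"
proof (rule nn_integral_dom_kernel_le[where S="\<lambda>\<Phi>. \<Phi>" and R="\<lambda>\<Phi>. \<Phi>"])
  fix vs :: "real^3" and Is :: real assume Is: "0 < Is"
  let ?\<Phi> = "coll_energy v vs I Is" and ?Y = "(norm vs)\<^sup>2 + Is"
  have "(norm (v - vs))\<^sup>2 \<le> 2 * (norm v)\<^sup>2 + 2 * (norm vs)\<^sup>2"
  proof -
    have "0 \<le> (norm (v + vs))\<^sup>2" by simp
    then show ?thesis by (simp add: power2_norm_eq_inner inner_simps inner_commute)
  qed
  then have "1 + ?\<Phi> \<le> 1 + ((norm v)\<^sup>2 + I) + ?Y"
    unfolding coll_energy_def using zero_le_power2[of "norm v"] zero_le_power2[of "norm vs"] by linarith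
  also have "\<dots> \<le> (1 + (norm v)\<^sup>2 + I) * (1 + ?Y)"
    using I Is by (simp add: algebra_simps)
  also have "\<dots> \<le> quad_weight v I * (8 * exp (?Y / 8))"
  proof (rule mult_mono)
    show "1 + (norm v)\<^sup>2 + I \<le> quad_weight v I" using quad_weight_ge[of I v] I by simp
    show "1 + ?Y \<le> 8 * exp (?Y / 8)"
    proof -
      have "1 + ?Y \<le> 8 * (1 + ?Y / 8)" by (simp add: field_simps)
      also have "\<dots> \<le> 8 * exp (?Y / 8)"
        by (intro mult_left_mono exp_ge_add_one_self) simp
      finally show ?thesis .
    qed
    show "0 \<le> quad_weight v I" by (simp add: quad_weight_def)
    show "0 \<le> 1 + ?Y" using Is zero_le_power2[of "norm vs"] by linarith
  qed
  finally have "1 + ?\<Phi> \<le> 8 * quad_weight v I * exp (?Y / 8)" by simp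
  moreover have "0 < ?\<Phi>" using I Is by (auto simp: coll_energy_def add_nonneg_pos)
  ultimately have "?\<Phi> powr (- 1 - \<alpha> / 2) * (?\<Phi> * ?\<Phi>) \<le> 8 * quad_weight v I * exp (?Y / 8)"
    using energy_powr_loss_le[of ?\<Phi>] by linarith
  then have "?\<Phi> powr (- 1 - \<alpha> / 2) * (?\<Phi> * ?\<Phi>) * exp (- ?Y / 4) \<le> 8 * quad_weight v I * exp (?Y / 8) * exp (- ?Y / 4)"
    by (intro mult_right_mono) auto
  also have "\<dots> = 8 * quad_weight v I * (exp (?Y / 8) * exp (- ?Y / 4))" by simp
  also have "exp (?Y / 8) * exp (- ?Y / 4) = exp (- ?Y / 8)"
    unfolding exp_add[symmetric] by (rule arg_cong[where f=exp]) (simp add: field_simps)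
  finally show "?\<Phi> powr (- 1 - \<alpha> / 2) * (?\<Phi> * ?\<Phi>) * exp (- ?Y / 4) \<le> 8 * quad_weight v I * exp (- ?Y / 8)" .
qed (use I nn_integral_one_Ioo in \<open>auto simp: quad_weight_def\<close>)

end

section \<open>Gain and loss operators\<close>

definition borel2 :: "(real^3 \<Rightarrow> real \<Rightarrow> real) \<Rightarrow> bool" where
  "borel2 f \<longleftrightarrow> (\<lambda>z. f (fst z) (snd z)) \<in> borel_measurable borel"

lemma borel2_compose:
  assumes "borel2 f" and [measurable]: "V \<in> borel_measurable N" "J \<in> borel_measurable N"
  shows "(\<lambda>x. f (V x) (J x)) \<in> borel_measurable N"
proof -
  have "(\<lambda>x. (V x, J x)) \<in> borel_measurable N" by measurable
  from measurable_compose[OF this assms(1)[unfolded borel2_def]] show ?thesis by simp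
qed

lemma maxwellian_measurable [measurable (raw)]:
  assumes [measurable]: "V \<in> borel_measurable N" "J \<in> borel_measurable N"
  shows "(\<lambda>x. maxwellian \<delta> (V x) (J x)) \<in> borel_measurable N"
  unfolding maxwellian_def by measurable

lemma borel2_sqrt_maxwellian: "borel2 (\<lambda>v I. sqrt (maxwellian \<delta> v I))"
  unfolding borel2_def by measurable

lemma borel2_add: "borel2 f \<Longrightarrow> borel2 g \<Longrightarrow> borel2 (\<lambda>v I. f v I + g v I)"
  and borel2_diff: "borel2 f \<Longrightarrow> borel2 g \<Longrightarrow> borel2 (\<lambda>v I. f v I - g v I)"
  unfolding borel2_def by auto

lemma W_integral_bound:
  fixes H :: "coll_par \<Rightarrow> ennreal"
  assumes C: "0 \<le> C" and G: "G \<in> borel_measurable borel"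
    and le: "\<And>p. ennreal \<bar>coll_dens \<delta> \<alpha> C v I p * G (coll_param v I p)\<bar> \<le> H p"
    and H: "(\<integral>\<^sup>+p. H p \<partial>coll_base) \<le> ennreal B" and B: "0 \<le> B"
  shows "integrable (W_measure \<delta> \<alpha> C v I) G" and "\<bar>\<integral>z. G z \<partial>W_measure \<delta> \<alpha> C v I\<bar> \<le> B"
proof -
  let ?g = "\<lambda>p. coll_dens \<delta> \<alpha> C v I p * G (coll_param v I p)"
  have nn: "(\<integral>\<^sup>+p. ennreal (norm (?g p)) \<partial>coll_base) \<le> ennreal B"
    by (rule order_trans[OF nn_integral_mono H]) (use le in simp)
  have i: "integrable coll_base ?g"
    by (rule integrableI_bounded[OF W_integral_measurable(5)[OF C G]])
       (use nn in \<open>auto intro: le_less_trans simp: ennreal_less_top\<close>)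
  then show "integrable (W_measure \<delta> \<alpha> C v I) G" by (simp add: W_integrable_iff[OF C G])
  have "ennreal (norm (\<integral>p. ?g p \<partial>coll_base)) \<le> ennreal B"
    by (rule order_trans[OF integral_norm_bound_ennreal[OF i] nn])
  with B show "\<bar>\<integral>z. G z \<partial>W_measure \<delta> \<alpha> C v I\<bar> \<le> B"
    by (simp add: W_integral_eq[OF C G])
qed

context polyatomic_kernel
begin

definition gain_pair :: "(real^3 \<Rightarrow> real \<Rightarrow> real) \<Rightarrow> (real^3 \<Rightarrow> real \<Rightarrow> real) \<Rightarrow> coll_state \<Rightarrow> real" where
  "gain_pair f g = (\<lambda>(vs, v', vs', Is, I', Is'). f v' I' * g vs' Is')"

definition loss_fun :: "(real^3 \<Rightarrow> real \<Rightarrow> real) \<Rightarrow> coll_state \<Rightarrow> real" where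
  "loss_fun f = (\<lambda>(vs, v', vs', Is, I', Is'). f vs Is)"

abbreviation Wm :: "real^3 \<Rightarrow> real \<Rightarrow> coll_state measure" where "Wm \<equiv> W_measure \<delta> \<alpha> C"

text \<open>\<open>\<surd>M gain f g\<close> is the gain part of \<open>Q(\<surd>M f, \<surd>M g)\<close>.\<close>

definition gain :: "(real^3 \<Rightarrow> real \<Rightarrow> real) \<Rightarrow> (real^3 \<Rightarrow> real \<Rightarrow> real) \<Rightarrow> real^3 \<Rightarrow> real \<Rightarrow> real" where
  "gain f g v I = (\<integral>z. gain_kernel v I z * gain_pair f g z \<partial>Wm v I)"

text \<open>\<open>loss f\<close> is the frequency with which \<open>\<surd>M f\<close> scatters particles out of \<open>(v, I)\<close>; for \<open>f = \<surd>M\<close> it is \<open>\<nu>\<close>.\<close>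

definition loss :: "(real^3 \<Rightarrow> real \<Rightarrow> real) \<Rightarrow> real^3 \<Rightarrow> real \<Rightarrow> real" where
  "loss f v I = (\<integral>z. loss_kernel I z * loss_fun f z \<partial>Wm v I)"

lemma gain_kernel_measurable [measurable (raw)]:
  assumes [measurable]: "V \<in> borel_measurable N" "J \<in> borel_measurable N" "Z \<in> borel_measurable N"
  shows "(\<lambda>x. gain_kernel (V x) (J x) (Z x)) \<in> borel_measurable N"
  unfolding gain_kernel_def case_prod_beta by measurable

lemma loss_kernel_measurable [measurable (raw)]:
  assumes [measurable]: "J \<in> borel_measurable N" "Z \<in> borel_measurable N"
  shows "(\<lambda>x. loss_kernel (J x) (Z x)) \<in> borel_measurable N"
  unfolding loss_kernel_def case_prod_beta by measurable

lemma gain_integrand_measurable: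
  assumes f: "borel2 f" and g: "borel2 g"
  shows "(\<lambda>z. gain_kernel v I z * gain_pair f g z) \<in> borel_measurable borel"
  unfolding gain_pair_def case_prod_beta
  by (intro borel_measurable_times borel2_compose[OF f] borel2_compose[OF g]) measurable

lemma loss_integrand_measurable:
  assumes f: "borel2 f"
  shows "(\<lambda>z. loss_kernel I z * loss_fun f z) \<in> borel_measurable borel"
  unfolding loss_fun_def case_prod_beta
  by (intro borel_measurable_times borel2_compose[OF f]) measurable

definition base_const :: real where "base_const = dom_const * enn2real coll_mass"

lemma base_const_nonneg: "0 \<le> base_const" using dom_const_pos by (simp add: base_const_def)

lemma ennreal_base_const: "ennreal dom_const * coll_mass = ennreal base_const"
  using dom_const_pos coll_mass_finite by (simp add: base_const_def ennreal_mult ennreal_enn2real_if less_top[symmetric])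

lemma gain_kernel_nonneg: "0 < I \<Longrightarrow> z \<in> coll_region \<Longrightarrow> 0 \<le> gain_kernel v I z"
  using maxwellian_pos by (auto simp: gain_kernel_def intro!: divide_nonneg_nonneg mult_nonneg_nonneg less_imp_le)

lemma loss_kernel_nonneg: "0 < I \<Longrightarrow> z \<in> coll_region \<Longrightarrow> 0 \<le> loss_kernel I z"
  using maxwellian_pos by (auto simp: loss_kernel_def intro!: divide_nonneg_nonneg less_imp_le)

lemma coll_dens_support:
  assumes "dens v I ((vs, Is, I', Is'), \<omega>) \<noteq> 0"
  shows "norm \<omega> = 1" "0 < Is" "0 < I'" "0 < Is'" "I' + Is' < coll_energy v vs I Is"
  using assms by (auto simp: coll_dens_def W_density_def Let_def split: if_splits)

text \<open>The hypothesis on \<open>f v' I' g v'\<^sub>* I'\<^sub>*\<close> may use that the outgoing pair carries at least the energy of \<open>(v, I)\<close>;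
  the weighted estimate is obtained by putting \<open>1 / w(v, I)\<close> into \<open>k\<close>.\<close>

lemma gain_general_bound:
  assumes f: "borel2 f" and g: "borel2 g" and I: "0 < I" and k: "0 \<le> k"
    and le: "\<And>v' I' vs' Is'. 0 < I' \<Longrightarrow> 0 < Is' \<Longrightarrow>
       (norm v)\<^sup>2 / 2 + I \<le> (norm v')\<^sup>2 / 2 + (norm vs')\<^sup>2 / 2 + I' + Is' \<Longrightarrow>
       \<bar>f v' I' * g vs' Is'\<bar> \<le> k * (1 / (1 + I')\<^sup>2 + 1 / (1 + Is')\<^sup>2)"
  shows "integrable (Wm v I) (\<lambda>z. gain_kernel v I z * gain_pair f g z)"
    and "\<bar>gain f g v I\<bar> \<le> 2 * base_const * k"
proof -
  let ?int = "\<lambda>p. dens v I p * (gain_kernel v I (coll_param v I p) * gain_pair f g (coll_param v I p))"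
  let ?h1 = "\<lambda>((vs, Is, I', Is'), \<omega>). ennreal (dom_kernel v I (vs, Is, I', Is') * (1 / (1 + I')\<^sup>2 * 1))"
  let ?h2 = "\<lambda>((vs, Is, I', Is'), \<omega>). ennreal (dom_kernel v I (vs, Is, I', Is') * (1 * (1 / (1 + Is')\<^sup>2)))"
  have [measurable]: "(\<lambda>p. fst p) \<in> borel_measurable coll_base"
    by (simp cong: measurable_cong_sets)
  note [measurable] = dom_kernel_measurable
  have [measurable]: "?h1 \<in> borel_measurable coll_base" "?h2 \<in> borel_measurable coll_base"
    unfolding case_prod_beta prod.collapse by measurable
  have H: "(\<integral>\<^sup>+p. ennreal (k * dom_const) * (?h1 p + ?h2 p) \<partial>coll_base) \<le> ennreal (2 * base_const * k)"
  proof -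
    have "(\<integral>\<^sup>+p. ennreal (k * dom_const) * (?h1 p + ?h2 p) \<partial>coll_base)
      = ennreal (k * dom_const) * ((\<integral>\<^sup>+p. ?h1 p \<partial>coll_base) + (\<integral>\<^sup>+p. ?h2 p \<partial>coll_base))"
      by (subst nn_integral_cmult, measurable, subst nn_integral_add, measurable)
    also have "\<dots> \<le> ennreal (k * dom_const) * (ennreal 1 * coll_mass + ennreal 1 * coll_mass)"
      by (intro mult_left_mono add_mono nn_integral_dom_kernel_decay1[OF I] nn_integral_dom_kernel_decay2[OF I]) auto
    also have "\<dots> = ennreal (2 * k) * (ennreal dom_const * coll_mass)"
      using k dom_const_pos by (simp add: ennreal_mult mult_ac distrib_left flip: mult_2)
    also have "\<dots> = ennreal (2 * base_const * k)"
      unfolding ennreal_base_const using k base_const_nonneg by (simp add: ennreal_mult[symmetric] mult_ac)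
    finally show ?thesis .
  qed
  have "ennreal \<bar>?int p\<bar>
      \<le> ennreal (k * dom_const) * (?h1 p + ?h2 p)" for p
  proof -
    obtain vs Is I' Is' \<omega> where p: "p = ((vs, Is, I', Is'), \<omega>)" by (metis prod.collapse)
    show ?thesis
    proof (cases "dens v I p = 0")
      case False
      note s = coll_dens_support[OF False[unfolded p]]
      obtain v' vs' where z: "coll_param v I p = (vs, v', vs', Is, I', Is')"
        by (auto simp: coll_param_def p Let_def)
      have zr: "coll_param v I p \<in> coll_region" unfolding z using s by simp
      have "(norm v')\<^sup>2 / 2 + (norm vs')\<^sup>2 / 2 + I' + Is' = (norm v)\<^sup>2 / 2 + (norm vs)\<^sup>2 / 2 + I + Is"
        by (rule coll_energy_conservation[OF z[unfolded p] s(1) s(5)])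
      then have "(norm v)\<^sup>2 / 2 + I \<le> (norm v')\<^sup>2 / 2 + (norm vs')\<^sup>2 / 2 + I' + Is'"
        using s(2) zero_le_power2[of "norm vs"] by linarith
      from le[OF s(3,4) this]
      have fg: "\<bar>gain_pair f g (coll_param v I p)\<bar> \<le> k * (1 / (1 + I')\<^sup>2 + 1 / (1 + Is')\<^sup>2)"
        by (simp add: z gain_pair_def)
      have nn: "0 \<le> dens v I p * gain_kernel v I (coll_param v I p)"
        using coll_dens_nonneg gain_kernel_nonneg[OF I zr] C by simp
      have "\<bar>?int p\<bar>
          = (dens v I p * gain_kernel v I (coll_param v I p)) * \<bar>gain_pair f g (coll_param v I p)\<bar>"
        unfolding mult.assoc[symmetric] by (subst abs_mult) (simp only: abs_of_nonneg[OF nn])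
      also have "\<dots> \<le> (dom_const * dom_kernel v I (fst p)) * (k * (1 / (1 + I')\<^sup>2 + 1 / (1 + Is')\<^sup>2))"
        by (rule mult_mono[OF kernels_dominated(1)[OF I] fg]) (use dom_const_pos dom_kernel_nonneg in auto)
      also have "\<dots> = (k * dom_const) * (dom_kernel v I (fst p) * (1 / (1 + I')\<^sup>2) + dom_kernel v I (fst p) * (1 / (1 + Is')\<^sup>2))"
        by (simp add: algebra_simps)
      finally have "ennreal \<bar>?int p\<bar>
        \<le> ennreal ((k * dom_const) * (dom_kernel v I (fst p) * (1 / (1 + I')\<^sup>2) + dom_kernel v I (fst p) * (1 / (1 + Is')\<^sup>2)))"
        by (rule ennreal_leI)
      also have "\<dots> = ennreal (k * dom_const) * (?h1 p + ?h2 p)"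
        using k dom_const_pos dom_kernel_nonneg[of v I "(vs, Is, I', Is')"]
        by (subst ennreal_mult) (auto simp: p)
      finally show ?thesis .
    qed simp
  qed
  from W_integral_bound[OF less_imp_le[OF C] gain_integrand_measurable[OF f g] this H] k base_const_nonneg
  show "integrable (Wm v I) (\<lambda>z. gain_kernel v I z * gain_pair f g z)"
    and "\<bar>gain f g v I\<bar> \<le> 2 * base_const * k"
    by (auto simp: gain_def)
qed

lemma loss_bound:
  assumes f: "borel2 f" and I: "0 < I" and b: "0 \<le> b" and le: "\<And>v I. 0 < I \<Longrightarrow> \<bar>f v I\<bar> \<le> b"
  shows "integrable (Wm v I) (\<lambda>z. loss_kernel I z * loss_fun f z)"
    and "\<bar>loss f v I\<bar> \<le> 8 * base_const * b * quad_weight v I"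
proof -
  let ?int = "\<lambda>p. dens v I p * (loss_kernel I (coll_param v I p) * loss_fun f (coll_param v I p))"
  let ?h = "\<lambda>((vs, Is, I', Is'), \<omega>). ennreal (dom_kernel v I (vs, Is, I', Is') * (1 * 1))"
  have [measurable]: "(\<lambda>p. fst p) \<in> borel_measurable coll_base"
    by (simp cong: measurable_cong_sets)
  note [measurable] = dom_kernel_measurable
  have [measurable]: "?h \<in> borel_measurable coll_base"
    unfolding case_prod_beta prod.collapse by measurable
  have q: "0 \<le> quad_weight v I" by (simp add: quad_weight_def)
  have H: "(\<integral>\<^sup>+p. ennreal (b * dom_const) * ?h p \<partial>coll_base) \<le> ennreal (8 * base_const * b * quad_weight v I)"
  proof -
    have "(\<integral>\<^sup>+p. ennreal (b * dom_const) * ?h p \<partial>coll_base) = ennreal (b * dom_const) * (\<integral>\<^sup>+p. ?h p \<partial>coll_base)"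
      by (subst nn_integral_cmult, measurable)
    also have "\<dots> \<le> ennreal (b * dom_const) * (ennreal (8 * quad_weight v I) * coll_mass)"
      by (intro mult_left_mono nn_integral_dom_kernel[OF I]) auto
    also have "\<dots> = ennreal (8 * b * quad_weight v I) * (ennreal dom_const * coll_mass)"
      using b dom_const_pos q by (simp add: ennreal_mult mult_ac)
    also have "\<dots> = ennreal (8 * base_const * b * quad_weight v I)"
      unfolding ennreal_base_const using b base_const_nonneg q by (simp add: ennreal_mult[symmetric] mult_ac)
    finally show ?thesis .
  qed
  have "ennreal \<bar>?int p\<bar>
      \<le> ennreal (b * dom_const) * ?h p" for p
  proof -
    obtain vs Is I' Is' \<omega> where p: "p = ((vs, Is, I', Is'), \<omega>)" by (metis prod.collapse)
    show ?thesis
    proof (cases "dens v I p = 0")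
      case False
      note s = coll_dens_support[OF False[unfolded p]]
      obtain v' vs' where z: "coll_param v I p = (vs, v', vs', Is, I', Is')"
        by (auto simp: coll_param_def p Let_def)
      have zr: "coll_param v I p \<in> coll_region" unfolding z using s by simp
      have fb: "\<bar>loss_fun f (coll_param v I p)\<bar> \<le> b" using le[OF s(2)] by (simp add: z loss_fun_def)
      have nn: "0 \<le> dens v I p * loss_kernel I (coll_param v I p)"
        using coll_dens_nonneg loss_kernel_nonneg[OF I zr] C by simp
      have "\<bar>?int p\<bar>
          = (dens v I p * loss_kernel I (coll_param v I p)) * \<bar>loss_fun f (coll_param v I p)\<bar>"
        unfolding mult.assoc[symmetric] by (subst abs_mult) (simp only: abs_of_nonneg[OF nn])
      also have "\<dots> \<le> (dom_const * dom_kernel v I (fst p)) * b"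
        by (rule mult_mono[OF kernels_dominated(2)[OF I] fb]) (use dom_const_pos dom_kernel_nonneg in auto)
      finally have "ennreal \<bar>?int p\<bar>
        \<le> ennreal ((dom_const * dom_kernel v I (fst p)) * b)"
        by (rule ennreal_leI)
      also have "\<dots> = ennreal (b * dom_const) * ?h p"
        using b dom_const_pos dom_kernel_nonneg[of v I "(vs, Is, I', Is')"]
        by (simp add: p ennreal_mult mult_ac)
      finally show ?thesis .
    qed simp
  qed
  from W_integral_bound[OF less_imp_le[OF C] loss_integrand_measurable[OF f] this H] b base_const_nonneg q
  show "integrable (Wm v I) (\<lambda>z. loss_kernel I z * loss_fun f z)"
    and "\<bar>loss f v I\<bar> \<le> 8 * base_const * b * quad_weight v I"
    by (auto simp: loss_def)
qed

end

section \<open>Weighted bounds for gain and loss\<close>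

text \<open>Joint measurability of a family of phase space functions, in curried form.\<close>

definition borel_family :: "'q measure \<Rightarrow> ('q \<Rightarrow> real^3 \<Rightarrow> real \<Rightarrow> real) \<Rightarrow> bool" where
  "borel_family N f \<longleftrightarrow> (\<lambda>x. f (fst x) (fst (snd x)) (snd (snd x))) \<in> borel_measurable (N \<Otimes>\<^sub>M borel)"

lemma borel_family_compose:
  assumes f: "borel_family N f" and A: "A \<in> measurable L N"
    and [measurable]: "V \<in> borel_measurable L" "J \<in> borel_measurable L"
  shows "(\<lambda>x. f (A x) (V x) (J x)) \<in> borel_measurable L"
proof -
  have "(\<lambda>x. (A x, V x, J x)) \<in> measurable L (N \<Otimes>\<^sub>M borel)"
    using A by measurable
  from measurable_compose[OF this f[unfolded borel_family_def]] show ?thesis by simp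
qed

context polyatomic_kernel
begin

lemma gain_measurable:
  assumes f: "borel_family N f" and g: "borel_family N g"
    and V [measurable]: "V \<in> borel_measurable N" and J [measurable]: "J \<in> borel_measurable N"
  shows "(\<lambda>q. gain (f q) (g q) (V q) (J q)) \<in> borel_measurable N"
  unfolding gain_def
proof (rule W_integral_measurable_param[OF less_imp_le[OF C] _ V J])
  have [measurable]: "snd \<in> measurable (N \<Otimes>\<^sub>M borel) borel" by simp
  show "(\<lambda>(q, z). gain_kernel (V q) (J q) z * gain_pair (f q) (g q) z) \<in> borel_measurable (N \<Otimes>\<^sub>M borel)"
    unfolding gain_pair_def case_prod_beta
    by (intro borel_measurable_times gain_kernel_measurable borel_family_compose[OF f] borel_family_compose[OF g]) measurable
qed

lemma loss_measurable:
  assumes f: "borel_family N f"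
    and V [measurable]: "V \<in> borel_measurable N" and J [measurable]: "J \<in> borel_measurable N"
  shows "(\<lambda>q. loss (f q) (V q) (J q)) \<in> borel_measurable N"
  unfolding loss_def
proof (rule W_integral_measurable_param[OF less_imp_le[OF C] _ V J])
  have [measurable]: "snd \<in> measurable (N \<Otimes>\<^sub>M borel) borel" by simp
  show "(\<lambda>(q, z). loss_kernel (J q) z * loss_fun (f q) z) \<in> borel_measurable (N \<Otimes>\<^sub>M borel)"
    unfolding loss_fun_def case_prod_beta
    by (intro borel_measurable_times loss_kernel_measurable borel_family_compose[OF f]) measurable
qed

text \<open>By conservation of energy one of the two outgoing particles has at least half of the energy of \<open>(v, I)\<close>, so its
  weight dominates \<open>w(v, I)\<close> up to \<open>12\<^bsup>\<beta>/2\<^esup>\<close>. The weight of the other one supplies the decay in its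
  internal energy.\<close>

lemma inverse_weights_le:
  assumes "0 < I" "0 < I'" "0 < Is'"
    and en: "(norm v)\<^sup>2 / 2 + I \<le> (norm v')\<^sup>2 / 2 + (norm vs')\<^sup>2 / 2 + I' + Is'"
  shows "1 / (w v' I' * w vs' Is') \<le> 12 powr (\<beta> / 2) / w v I * (1 / (1 + I')\<^sup>2 + 1 / (1 + Is')\<^sup>2)"
proof -
  let ?X = "quad_weight v I" and ?X' = "quad_weight v' I'" and ?Xs' = "quad_weight vs' Is'"
  have pos: "1 \<le> ?X" "1 \<le> ?X'" "1 \<le> ?Xs'" using quad_weight_ge_1 assms by auto
  have wpos: "1 \<le> w v I" "1 \<le> w v' I'" "1 \<le> w vs' Is'" using weight_ge_1 assms by auto
  have "?X \<le> 6 * (?X' + ?Xs')"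
  proof -
    have X: "?X \<le> 3 * (1 + (norm v)\<^sup>2 + I)" "1 + (norm v')\<^sup>2 + I' \<le> ?X'" "1 + (norm vs')\<^sup>2 + Is' \<le> ?Xs'"
      using quad_weight_le quad_weight_ge assms(1-3) by simp_all
    have en': "(norm v)\<^sup>2 + 2 * I \<le> (norm v')\<^sup>2 + (norm vs')\<^sup>2 + 2 * I' + 2 * Is'"
      using en by (simp add: field_simps)
    have "x \<le> 6 * (y + z)"
      if "x \<le> 3 * (1 + a + I)" "1 + b + I' \<le> y" "1 + c + Is' \<le> z" "a + 2 * I \<le> b + c + 2 * I' + 2 * Is'" "0 \<le> b" "0 \<le> c"
      for x y z a b c :: real
      using that assms(1-3) by argo
    from this[OF X en'] show ?thesis by simp
  qed
  then have X: "?X \<le> 12 * max ?X' ?Xs'"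
    using max.cobounded1[of ?X' ?Xs'] max.cobounded2[of ?Xs' ?X'] by argo
  have "w v I \<le> (12 * max ?X' ?Xs') powr (\<beta> / 2)"
    unfolding weight_eq[OF less_imp_le[OF assms(1)]] using X pos \<beta> by (intro powr_mono2) auto
  also have "\<dots> = 12 powr (\<beta> / 2) * (max ?X' ?Xs') powr (\<beta> / 2)"
    using pos by (simp add: powr_mult)
  also have "(max ?X' ?Xs') powr (\<beta> / 2) = max (w v' I') (w vs' Is')"
  proof (cases "?X' \<le> ?Xs'")
    case True
    then have "?X' powr (\<beta> / 2) \<le> ?Xs' powr (\<beta> / 2)" using pos \<beta> by (intro powr_mono2) auto
    with True show ?thesis using assms(2,3) by (simp add: weight_eq)
  next
    case False
    then have "?Xs' powr (\<beta> / 2) \<le> ?X' powr (\<beta> / 2)" using pos \<beta> by (intro powr_mono2) auto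
    with False show ?thesis using assms(2,3) by (simp add: weight_eq)
  qed
  finally have W: "w v I \<le> 12 powr (\<beta> / 2) * max (w v' I') (w vs' Is')" .
  have d: "1 / w v' I' \<le> 1 / (1 + I')\<^sup>2" "1 / w vs' Is' \<le> 1 / (1 + Is')\<^sup>2"
    using square_le_weight[of I' v'] square_le_weight[of Is' vs'] assms(2,3) by (intro frac_le; simp)+
  have "1 / (w v' I' * w vs' Is') = 1 / max (w v' I') (w vs' Is') * (1 / min (w v' I') (w vs' Is'))"
    by (auto simp: max_def min_def)
  also have "\<dots> \<le> (12 powr (\<beta> / 2) / w v I) * (1 / (1 + I')\<^sup>2 + 1 / (1 + Is')\<^sup>2)"
  proof (rule mult_mono)
    show "1 / max (w v' I') (w vs' Is') \<le> 12 powr (\<beta> / 2) / w v I"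
      using W wpos by (simp add: field_simps)
    have "1 / min (w v' I') (w vs' Is') \<le> 1 / w v' I' + 1 / w vs' Is'"
      using wpos by (auto simp: min_def)
    with d show "1 / min (w v' I') (w vs' Is') \<le> 1 / (1 + I')\<^sup>2 + 1 / (1 + Is')\<^sup>2" by linarith
  qed (use wpos in auto)
  finally show ?thesis .
qed

definition bounded_by :: "real \<Rightarrow> (real^3 \<Rightarrow> real \<Rightarrow> real) \<Rightarrow> bool" where
  "bounded_by d f \<longleftrightarrow> borel2 f \<and> 0 \<le> d \<and> (\<forall>v. \<forall>I>0. \<bar>f v I\<bar> \<le> d)"

definition weight_bounded_by :: "real \<Rightarrow> (real^3 \<Rightarrow> real \<Rightarrow> real) \<Rightarrow> bool" where
  "weight_bounded_by b f \<longleftrightarrow> borel2 f \<and> 0 \<le> b \<and> (\<forall>v. \<forall>I>0. \<bar>f v I\<bar> \<le> b / w v I)"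

lemma weight_bounded_imp_bounded: "weight_bounded_by b f \<Longrightarrow> bounded_by b f"
proof -
  assume f: "weight_bounded_by b f"
  have "\<bar>f v I\<bar> \<le> b" if "0 < I" for v I
  proof -
    have "\<bar>f v I\<bar> \<le> b / w v I" using f that by (auto simp: weight_bounded_by_def)
    also have "\<dots> \<le> b / 1" using f weight_ge_1[of I v] that
      by (intro frac_le) (auto simp: weight_bounded_by_def)
    finally show ?thesis by simp
  qed
  with f show ?thesis by (auto simp: weight_bounded_by_def bounded_by_def)
qed

lemma weight_bounded_decay:
  assumes "weight_bounded_by b f" "0 < I"
  shows "\<bar>f v I\<bar> \<le> b * (1 / (1 + I)\<^sup>2)"
proof -
  have "\<bar>f v I\<bar> \<le> b / w v I" using assms by (auto simp: weight_bounded_by_def)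
  also have "\<dots> \<le> b / (1 + I)\<^sup>2"
    using square_le_weight[of I v] assms by (intro frac_le) (auto simp: weight_bounded_by_def)
  finally show ?thesis by simp
qed

text \<open>The three constants \<open>2 base_const\<close>, \<open>8 base_const\<close> and \<open>2 base_const 12\<^bsup>\<beta>/2\<^esup>\<close> of the estimates below are at
  most this one.\<close>

definition op_const :: real where
  "op_const = 1 + 8 * base_const * 12 powr (\<beta> / 2)"

lemma op_const_ge: "1 \<le> op_const" "2 * base_const * 12 powr (\<beta> / 2) \<le> op_const" "2 * base_const \<le> op_const" "8 * base_const \<le> op_const"
proof -
  have "1 \<le> (12::real) powr (\<beta> / 2)" using \<beta> by (intro ge_one_powr_ge_zero) auto
  then have "8 * base_const * 1 \<le> 8 * base_const * 12 powr (\<beta> / 2)"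
    using base_const_nonneg by (intro mult_left_mono) auto
  moreover have "2 * base_const * 12 powr (\<beta> / 2) \<le> 8 * base_const * 12 powr (\<beta> / 2)"
    using base_const_nonneg by (intro mult_right_mono) auto
  ultimately show "1 \<le> op_const" "2 * base_const * 12 powr (\<beta> / 2) \<le> op_const" "2 * base_const \<le> op_const" "8 * base_const \<le> op_const"
    using base_const_nonneg by (auto simp: op_const_def)
qed

text \<open>One weighted factor already makes the gain term bounded. The difference estimates rely on this: a
  difference of solutions is measured in the norm without weight.\<close>

lemma gain_weight_bounded_left:
  assumes f: "weight_bounded_by a f" and g: "bounded_by b g" and I: "0 < I"
  shows "integrable (Wm v I) (\<lambda>z. gain_kernel v I z * gain_pair f g z)"
    and "\<bar>gain f g v I\<bar> \<le> op_const * a * b"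
proof -
  have ab: "0 \<le> a * b" "borel2 f" "borel2 g" using f g by (auto simp: weight_bounded_by_def bounded_by_def)
  have le: "\<bar>f v' I' * g vs' Is'\<bar> \<le> (a * b) * (1 / (1 + I')\<^sup>2 + 1 / (1 + Is')\<^sup>2)" if "0 < I'" "0 < Is'" for v' vs' :: "real^3" and I' Is' :: real
  proof -
    have "\<bar>f v' I' * g vs' Is'\<bar> \<le> (a * (1 / (1 + I')\<^sup>2)) * b"
      unfolding abs_mult using weight_bounded_decay[OF f that(1)] g that f
      by (intro mult_mono) (auto simp: bounded_by_def weight_bounded_by_def)
    also have "\<dots> \<le> (a * b) * (1 / (1 + I')\<^sup>2 + 1 / (1 + Is')\<^sup>2)"
      using ab(1) that by (simp add: distrib_left)
    finally show ?thesis .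
  qed
  show "integrable (Wm v I) (\<lambda>z. gain_kernel v I z * gain_pair f g z)"
    by (rule gain_general_bound(1)[OF ab(2,3) I ab(1)]) (rule le)
  have "\<bar>gain f g v I\<bar> \<le> 2 * base_const * (a * b)"
    by (rule gain_general_bound(2)[OF ab(2,3) I ab(1)]) (rule le)
  also have "\<dots> \<le> op_const * (a * b)" using op_const_ge(3) ab(1) by (rule mult_right_mono)
  finally show "\<bar>gain f g v I\<bar> \<le> op_const * a * b" by simp
qed

lemma gain_weight_bounded_right:
  assumes f: "bounded_by a f" and g: "weight_bounded_by b g" and I: "0 < I"
  shows "integrable (Wm v I) (\<lambda>z. gain_kernel v I z * gain_pair f g z)"
    and "\<bar>gain f g v I\<bar> \<le> op_const * a * b"
proof -
  have ab: "0 \<le> a * b" "borel2 f" "borel2 g" using f g by (auto simp: weight_bounded_by_def bounded_by_def)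
  have le: "\<bar>f v' I' * g vs' Is'\<bar> \<le> (a * b) * (1 / (1 + I')\<^sup>2 + 1 / (1 + Is')\<^sup>2)" if "0 < I'" "0 < Is'" for v' vs' :: "real^3" and I' Is' :: real
  proof -
    have "\<bar>f v' I' * g vs' Is'\<bar> \<le> a * (b * (1 / (1 + Is')\<^sup>2))"
      unfolding abs_mult using weight_bounded_decay[OF g that(2)] f that
      by (intro mult_mono) (auto simp: bounded_by_def)
    also have "\<dots> \<le> (a * b) * (1 / (1 + I')\<^sup>2 + 1 / (1 + Is')\<^sup>2)"
      using ab(1) that by (simp add: distrib_left)
    finally show ?thesis .
  qed
  show "integrable (Wm v I) (\<lambda>z. gain_kernel v I z * gain_pair f g z)"
    by (rule gain_general_bound(1)[OF ab(2,3) I ab(1)]) (rule le)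
  have "\<bar>gain f g v I\<bar> \<le> 2 * base_const * (a * b)"
    by (rule gain_general_bound(2)[OF ab(2,3) I ab(1)]) (rule le)
  also have "\<dots> \<le> op_const * (a * b)" using op_const_ge(3) ab(1) by (rule mult_right_mono)
  finally show "\<bar>gain f g v I\<bar> \<le> op_const * a * b" by simp
qed

lemma gain_weight_bounded:
  assumes f: "weight_bounded_by a f" and g: "weight_bounded_by b g" and I: "0 < I"
  shows "\<bar>gain f g v I\<bar> \<le> op_const * a * b / w v I"
proof -
  have ab: "0 \<le> a" "0 \<le> b" "borel2 f" "borel2 g" using f g by (auto simp: weight_bounded_by_def)
  have w: "1 \<le> w v I" using weight_ge_1 I by simp
  let ?k = "a * b * (12 powr (\<beta> / 2) / w v I)"
  have k: "0 \<le> ?k" using ab w by simp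
  have "\<bar>gain f g v I\<bar> \<le> 2 * base_const * ?k"
  proof (rule gain_general_bound(2)[OF ab(3,4) I k])
    fix v' vs' :: "real^3" and I' Is' :: real
    assume I': "0 < I'" "0 < Is'" and en: "(norm v)\<^sup>2 / 2 + I \<le> (norm v')\<^sup>2 / 2 + (norm vs')\<^sup>2 / 2 + I' + Is'"
    have "\<bar>f v' I' * g vs' Is'\<bar> \<le> (a / w v' I') * (b / w vs' Is')"
      unfolding abs_mult using f g I' weight_ge_1[of I' v'] by (intro mult_mono) (auto simp: weight_bounded_by_def)
    also have "\<dots> = a * b * (1 / (w v' I' * w vs' Is'))" by simp
    also have "\<dots> \<le> a * b * (12 powr (\<beta> / 2) / w v I * (1 / (1 + I')\<^sup>2 + 1 / (1 + Is')\<^sup>2))"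
      using ab by (intro mult_left_mono inverse_weights_le[OF I I' en]) auto
    finally show "\<bar>f v' I' * g vs' Is'\<bar> \<le> ?k * (1 / (1 + I')\<^sup>2 + 1 / (1 + Is')\<^sup>2)" by (simp only: mult.assoc)
  qed
  also have "\<dots> = (2 * base_const * 12 powr (\<beta> / 2)) * (a * b / w v I)" by simp
  also have "\<dots> \<le> op_const * (a * b / w v I)"
    using op_const_ge(2) ab w by (intro mult_right_mono) auto
  finally show ?thesis by simp
qed

lemma loss_bounded:
  assumes f: "bounded_by b f" and I: "0 < I"
  shows "integrable (Wm v I) (\<lambda>z. loss_kernel I z * loss_fun f z)"
    and "\<bar>loss f v I\<bar> \<le> op_const * b * quad_weight v I"
proof -
  have b: "borel2 f" "0 \<le> b" "\<And>v I. 0 < I \<Longrightarrow> \<bar>f v I\<bar> \<le> b" using f by (auto simp: bounded_by_def)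
  show "integrable (Wm v I) (\<lambda>z. loss_kernel I z * loss_fun f z)"
    by (rule loss_bound(1)[OF b(1) I b(2,3)])
  have "\<bar>loss f v I\<bar> \<le> 8 * base_const * (b * quad_weight v I)"
    using loss_bound(2)[OF b(1) I b(2,3), of v] by (simp add: mult.assoc)
  also have "\<dots> \<le> op_const * (b * quad_weight v I)"
    using op_const_ge(4) b(2) by (intro mult_right_mono) (auto simp: quad_weight_def)
  finally show "\<bar>loss f v I\<bar> \<le> op_const * b * quad_weight v I" by simp
qed

definition maxw_bound :: real where
  "maxw_bound = (SOME c. 1 \<le> c \<and> (\<forall>v I. 0 < I \<longrightarrow> sqrtM v I * (w v I * quad_weight v I) \<le> c))"

lemma maxw_bound: "1 \<le> maxw_bound" "0 < I \<Longrightarrow> sqrtM v I * (w v I * quad_weight v I) \<le> maxw_bound"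
proof -
  have "\<exists>c. 1 \<le> c \<and> (\<forall>v I. 0 < I \<longrightarrow> sqrtM v I * (w v I * quad_weight v I) \<le> c)"
    by (rule weighted_maxwellian_bounded) blast
  from someI_ex[OF this, folded maxw_bound_def]
  show "1 \<le> maxw_bound" "0 < I \<Longrightarrow> sqrtM v I * (w v I * quad_weight v I) \<le> maxw_bound" by blast+
qed

lemma sqrt_maxwellian_quad_le: "0 < I \<Longrightarrow> sqrtM v I * quad_weight v I \<le> maxw_bound / w v I"
  using maxw_bound(2)[of I v] weight_ge_1[of I v] by (simp add: pos_le_divide_eq mult_ac)

lemma weight_bounded_sqrt_maxwellian: "weight_bounded_by maxw_bound sqrtM"
  unfolding weight_bounded_by_def
proof (intro conjI allI impI)
  fix v I assume I: "(0::real) < I"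
  have "sqrtM v I * 1 \<le> sqrtM v I * quad_weight v I"
    using quad_weight_ge_1[of I v] I maxwellian_pos[OF I, of v] by (intro mult_left_mono) auto
  also have "\<dots> \<le> maxw_bound / w v I" by (rule sqrt_maxwellian_quad_le[OF I])
  finally show "\<bar>sqrtM v I\<bar> \<le> maxw_bound / w v I" using maxwellian_pos[OF I, of v] by simp
qed (use maxw_bound(1) borel2_sqrt_maxwellian in auto)

end

section \<open>Source term and collision frequency\<close>

context polyatomic_kernel
begin

abbreviation gain_ok :: "(real^3 \<Rightarrow> real \<Rightarrow> real) \<Rightarrow> (real^3 \<Rightarrow> real \<Rightarrow> real) \<Rightarrow> real^3 \<Rightarrow> real \<Rightarrow> bool" where
  "gain_ok f g v I \<equiv> integrable (Wm v I) (\<lambda>z. gain_kernel v I z * gain_pair f g z)"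

abbreviation loss_ok :: "(real^3 \<Rightarrow> real \<Rightarrow> real) \<Rightarrow> real^3 \<Rightarrow> real \<Rightarrow> bool" where
  "loss_ok f v I \<equiv> integrable (Wm v I) (\<lambda>z. loss_kernel I z * loss_fun f z)"

lemma gain_pair_distribs:
  "k * gain_pair (\<lambda>v I. f1 v I + f2 v I) g z = k * gain_pair f1 g z + k * gain_pair f2 g z"
  "k * gain_pair f (\<lambda>v I. g1 v I + g2 v I) z = k * gain_pair f g1 z + k * gain_pair f g2 z"
  "k * gain_pair (\<lambda>v I. f1 v I - f2 v I) g z = k * gain_pair f1 g z - k * gain_pair f2 g z"
  "k * gain_pair f (\<lambda>v I. g1 v I - g2 v I) z = k * gain_pair f g1 z - k * gain_pair f g2 z"
  "k * loss_fun (\<lambda>v I. f1 v I + f2 v I) z = k * loss_fun f1 z + k * loss_fun f2 z"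
  "k * loss_fun (\<lambda>v I. f1 v I - f2 v I) z = k * loss_fun f1 z - k * loss_fun f2 z"
  by (simp_all add: gain_pair_def loss_fun_def case_prod_beta algebra_simps)

lemma gain_add_left:
  "gain_ok f1 g v I \<Longrightarrow> gain_ok f2 g v I \<Longrightarrow>
    gain (\<lambda>v I. f1 v I + f2 v I) g v I = gain f1 g v I + gain f2 g v I"
  unfolding gain_def gain_pair_distribs(1) by (rule Bochner_Integration.integral_add)

lemma gain_add_right:
  "gain_ok f g1 v I \<Longrightarrow> gain_ok f g2 v I \<Longrightarrow>
    gain f (\<lambda>v I. g1 v I + g2 v I) v I = gain f g1 v I + gain f g2 v I"
  unfolding gain_def gain_pair_distribs(2) by (rule Bochner_Integration.integral_add)

lemma gain_diff_left:
  "gain_ok f1 g v I \<Longrightarrow> gain_ok f2 g v I \<Longrightarrow>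
    gain (\<lambda>v I. f1 v I - f2 v I) g v I = gain f1 g v I - gain f2 g v I"
  unfolding gain_def gain_pair_distribs(3) by (rule Bochner_Integration.integral_diff)

lemma gain_diff_right:
  "gain_ok f g1 v I \<Longrightarrow> gain_ok f g2 v I \<Longrightarrow>
    gain f (\<lambda>v I. g1 v I - g2 v I) v I = gain f g1 v I - gain f g2 v I"
  unfolding gain_def gain_pair_distribs(4) by (rule Bochner_Integration.integral_diff)

lemma loss_add:
  "loss_ok f1 v I \<Longrightarrow> loss_ok f2 v I \<Longrightarrow>
    loss (\<lambda>v I. f1 v I + f2 v I) v I = loss f1 v I + loss f2 v I"
  unfolding loss_def gain_pair_distribs(5) by (rule Bochner_Integration.integral_add)

lemma loss_diff:
  "loss_ok f1 v I \<Longrightarrow> loss_ok f2 v I \<Longrightarrow>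
    loss (\<lambda>v I. f1 v I - f2 v I) v I = loss f1 v I - loss f2 v I"
  unfolding loss_def gain_pair_distribs(6) by (rule Bochner_Integration.integral_diff)

lemma gain_nonneg:
  assumes "0 < I" "\<And>v I. 0 < I \<Longrightarrow> 0 \<le> f v I" "\<And>v I. 0 < I \<Longrightarrow> 0 \<le> g v I"
  shows "0 \<le> gain f g v I"
  unfolding gain_def
proof (rule Bochner_Integration.integral_nonneg)
  fix z assume "z \<in> space (Wm v I)"
  then have z: "z \<in> coll_region" by (simp add: space_W_measure)
  then have "0 \<le> gain_pair f g z" using assms(2,3) by (auto simp: gain_pair_def)
  with gain_kernel_nonneg[OF assms(1) z] show "0 \<le> gain_kernel v I z * gain_pair f g z" by simp
qed

lemma loss_nonneg:
  assumes "0 < I" "\<And>v I. 0 < I \<Longrightarrow> 0 \<le> f v I"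
  shows "0 \<le> loss f v I"
  unfolding loss_def
proof (rule Bochner_Integration.integral_nonneg)
  fix z assume "z \<in> space (Wm v I)"
  then have z: "z \<in> coll_region" by (simp add: space_W_measure)
  then have "0 \<le> loss_fun f z" using assms(2) by (auto simp: loss_fun_def)
  with loss_kernel_nonneg[OF assms(1) z] show "0 \<le> loss_kernel I z * loss_fun f z" by simp
qed

text \<open>\<open>Q(M, M) = 0\<close>, divided by \<open>\<surd>M\<close>: the integrands agree by detailed balance.\<close>

lemma gain_equilibrium:
  assumes I: "0 < I"
  shows "gain sqrtM sqrtM v I = sqrtM v I * loss sqrtM v I"
proof -
  have b: "borel2 sqrtM" by (rule borel2_sqrt_maxwellian)
  have "dens v I p * (gain_kernel v I (coll_param v I p) * gain_pair sqrtM sqrtM (coll_param v I p))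
      = sqrtM v I * (dens v I p * (loss_kernel I (coll_param v I p) * loss_fun sqrtM (coll_param v I p)))" for p
  proof -
    obtain vs Is I' Is' \<omega> where p: "p = ((vs, Is, I', Is'), \<omega>)" by (metis prod.collapse)
    show ?thesis
    proof (cases "dens v I p = 0")
      case False
      note s = coll_dens_support[OF False[unfolded p]]
      obtain v' vs' where z: "coll_param v I p = (vs, v', vs', Is, I', Is')"
        by (auto simp: coll_param_def p Let_def)
      note en = coll_energy_conservation[OF z[unfolded p] s(1) s(5)]
      let ?a = "\<delta> / 2 - 1" and ?b = "\<delta> / 4 - 1 / 2"
      have a: "?a = ?b + ?b" by simp
      note db = detailed_balance[OF I s(2-4) en]
      have pos: "0 < sqrtM v I" "0 < (I * Is) powr ?b" "0 < (I' * Is') powr ?b"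
        using maxwellian_pos I s by auto
      have "(sqrtM v' I' * sqrtM vs' Is') * (sqrtM v' I' * sqrtM vs' Is') * ((I * Is) powr ?b * (I * Is) powr ?b)
          = (sqrtM v I * sqrtM vs Is) * (sqrtM v I * sqrtM vs Is) * ((I' * Is') powr ?b * (I' * Is') powr ?b)"
        using arg_cong2[OF db db, of "(*)"] by (simp only: mult_ac)
      then have "gain_kernel v I (coll_param v I p) * gain_pair sqrtM sqrtM (coll_param v I p)
          = sqrtM v I * (loss_kernel I (coll_param v I p) * loss_fun sqrtM (coll_param v I p))"
        unfolding z gain_kernel_def gain_pair_def loss_kernel_def loss_fun_def prod.case a powr_add
        using pos by (simp add: field_simps)
      then show ?thesis by simp
    qed simp
  qed
  then show ?thesis
    unfolding gain_def loss_def
      W_integral_eq[OF less_imp_le[OF C] gain_integrand_measurable[OF b b]]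
      W_integral_eq[OF less_imp_le[OF C] loss_integrand_measurable[OF b]]
    by (simp only: integral_mult_right_zero)
qed

text \<open>The collision frequency of \<open>M + \<surd>M f\<close>, which is nonnegative if that function is.\<close>

definition damp :: "(real^3 \<Rightarrow> real \<Rightarrow> real) \<Rightarrow> real^3 \<Rightarrow> real \<Rightarrow> real" where
  "damp f v I = loss sqrtM v I + loss f v I"

text \<open>Everything on the right-hand side \<open>K f + \<Gamma>(f, f) - \<nu> f\<close> except the local term \<open>- damp f \<cdot> f\<close>.\<close>

definition source :: "(real^3 \<Rightarrow> real \<Rightarrow> real) \<Rightarrow> real^3 \<Rightarrow> real \<Rightarrow> real" where
  "source f v I = gain sqrtM f v I + gain f sqrtM v I + gain f f v I - sqrtM v I * loss f v I"

lemma bounded_sqrt_maxwellian: "bounded_by maxw_bound sqrtM"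
  by (rule weight_bounded_imp_bounded[OF weight_bounded_sqrt_maxwellian])

lemma gain_okI:
  "weight_bounded_by a f \<Longrightarrow> bounded_by b g \<Longrightarrow> 0 < I \<Longrightarrow> gain_ok f g v I"
  "bounded_by a f \<Longrightarrow> weight_bounded_by b g \<Longrightarrow> 0 < I \<Longrightarrow> gain_ok f g v I"
  by (rule gain_weight_bounded_left(1) gain_weight_bounded_right(1); assumption)+

text \<open>The three gain terms have weighted bounds, and in the loss term \<open>\<surd>M\<close> absorbs \<open>quad_weight\<close> and the weight.\<close>

lemma source_bound:
  assumes f: "weight_bounded_by b f" and I: "0 < I"
  shows "\<bar>source f v I\<bar> \<le> op_const * (3 * maxw_bound + 1) * (b * (1 + b)) / w v I"
proof -
  let ?K = op_const and ?m = maxw_bound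
  have b: "0 \<le> b" using f by (simp add: weight_bounded_by_def)
  have w: "1 \<le> w v I" using weight_ge_1 I by simp
  note mw = weight_bounded_sqrt_maxwellian
  have g: "\<bar>gain sqrtM f v I\<bar> \<le> ?K * ?m * b / w v I" "\<bar>gain f sqrtM v I\<bar> \<le> ?K * b * ?m / w v I"
    "\<bar>gain f f v I\<bar> \<le> ?K * b * b / w v I"
    using gain_weight_bounded[OF mw f I] gain_weight_bounded[OF f mw I] gain_weight_bounded[OF f f I] by auto
  have "\<bar>sqrtM v I * loss f v I\<bar> \<le> sqrtM v I * (?K * b * quad_weight v I)"
    unfolding abs_mult using loss_bounded(2)[OF weight_bounded_imp_bounded[OF f] I, of v] maxwellian_pos[OF I, of v]
    by (intro mult_mono) auto
  also have "\<dots> = ?K * b * (sqrtM v I * quad_weight v I)" by simp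
  also have "\<dots> \<le> ?K * b * (?m / w v I)"
    using sqrt_maxwellian_quad_le[OF I] b op_const_ge(1) by (intro mult_left_mono) auto
  finally have l: "\<bar>sqrtM v I * loss f v I\<bar> \<le> ?K * b * ?m / w v I" by simp
  have "\<bar>source f v I\<bar> \<le> ?K * ?m * b / w v I + ?K * b * ?m / w v I + ?K * b * b / w v I + ?K * b * ?m / w v I"
    using g l unfolding source_def by linarith
  also have "\<dots> = ?K * (3 * ?m * b + b * b) / w v I"
    by (simp add: algebra_simps add_divide_distrib[symmetric])
  also have "\<dots> \<le> ?K * ((3 * ?m + 1) * (b * (1 + b))) / w v I"
  proof (intro divide_right_mono mult_left_mono)
    have "0 \<le> 3 * ?m * (b * b) + b" using b maxw_bound(1) by simp
    then show "3 * ?m * b + b * b \<le> (3 * ?m + 1) * (b * (1 + b))" by (simp add: algebra_simps)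
  qed (use op_const_ge(1) w in auto)
  finally show ?thesis by simp
qed

lemma bounded_diff:
  assumes "weight_bounded_by b f1" "weight_bounded_by b f2" "0 \<le> d"
    and "\<And>v I. 0 < I \<Longrightarrow> \<bar>f1 v I - f2 v I\<bar> \<le> d"
  shows "bounded_by d (\<lambda>v I. f1 v I - f2 v I)"
  using assms by (auto simp: bounded_by_def weight_bounded_by_def intro: borel2_diff)

lemma source_diff:
  assumes f1: "weight_bounded_by b f1" and f2: "weight_bounded_by b f2" and I: "0 < I" and d: "0 \<le> d"
    and fd: "\<And>v I. 0 < I \<Longrightarrow> \<bar>f1 v I - f2 v I\<bar> \<le> d"
  shows "\<bar>source f1 v I - source f2 v I\<bar> \<le> op_const * (3 * maxw_bound + 2 * b) * d"
proof -
  let ?K = op_const and ?m = maxw_bound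
  let ?h = "\<lambda>v I. f1 v I - f2 v I"
  note h = bounded_diff[OF f1 f2 d fd]
  note mw = weight_bounded_sqrt_maxwellian and ms = bounded_sqrt_maxwellian
  note b1 = weight_bounded_imp_bounded[OF f1] and b2 = weight_bounded_imp_bounded[OF f2]
  have w: "1 \<le> w v I" using weight_ge_1 I by simp
  have e1: "gain sqrtM f1 v I - gain sqrtM f2 v I = gain sqrtM ?h v I"
    by (rule gain_diff_right[symmetric]; rule gain_okI(1)[OF mw _ I]) (rule b1 b2)+
  have e2: "gain f1 sqrtM v I - gain f2 sqrtM v I = gain ?h sqrtM v I"
    by (rule gain_diff_left[symmetric]; rule gain_okI(2)[OF _ mw I]) (rule b1 b2)+
  have e3: "gain f1 f1 v I - gain f1 f2 v I = gain f1 ?h v I"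
    by (rule gain_diff_right[symmetric]; rule gain_okI(1)[OF f1 _ I]) (rule b1 b2)+
  have e4: "gain f1 f2 v I - gain f2 f2 v I = gain ?h f2 v I"
    by (rule gain_diff_left[symmetric]; rule gain_okI(2)[OF _ f2 I]) (rule b1 b2)+
  have e5: "loss f1 v I - loss f2 v I = loss ?h v I"
    by (rule loss_diff[symmetric]; rule loss_bounded(1)[OF _ I]) (rule b1 b2)+
  have g: "\<bar>gain sqrtM ?h v I\<bar> \<le> ?K * ?m * d" "\<bar>gain ?h sqrtM v I\<bar> \<le> ?K * d * ?m"
    "\<bar>gain f1 ?h v I\<bar> \<le> ?K * b * d" "\<bar>gain ?h f2 v I\<bar> \<le> ?K * d * b"
    using gain_weight_bounded_left(2)[OF mw h I] gain_weight_bounded_right(2)[OF h mw I]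
      gain_weight_bounded_left(2)[OF f1 h I] gain_weight_bounded_right(2)[OF h f2 I] by auto
  have "\<bar>sqrtM v I * loss ?h v I\<bar> \<le> sqrtM v I * (?K * d * quad_weight v I)"
    unfolding abs_mult using loss_bounded(2)[OF h I, of v] maxwellian_pos[OF I, of v]
    by (intro mult_mono) auto
  also have "\<dots> = ?K * d * (sqrtM v I * quad_weight v I)" by simp
  also have "\<dots> \<le> ?K * d * ?m"
  proof (rule mult_left_mono)
    have "?m / w v I \<le> ?m / 1" using w maxw_bound(1) by (intro frac_le) auto
    with sqrt_maxwellian_quad_le[OF I, of v] show "sqrtM v I * quad_weight v I \<le> ?m" by simp
  qed (use d op_const_ge(1) in auto)
  finally have l: "\<bar>sqrtM v I * loss ?h v I\<bar> \<le> ?K * d * ?m" .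
  have "source f1 v I - source f2 v I = gain sqrtM ?h v I + gain ?h sqrtM v I + gain f1 ?h v I + gain ?h f2 v I - sqrtM v I * loss ?h v I"
    unfolding source_def e1[symmetric] e2[symmetric] e3[symmetric] e4[symmetric] e5[symmetric] by (simp add: algebra_simps)
  then have "\<bar>source f1 v I - source f2 v I\<bar> \<le> ?K * ?m * d + ?K * d * ?m + ?K * b * d + ?K * d * b + ?K * d * ?m"
    using g l by linarith
  also have "\<dots> = ?K * (3 * ?m + 2 * b) * d" by (simp add: algebra_simps)
  finally show ?thesis .
qed

lemma damp_diff:
  assumes f1: "weight_bounded_by b f1" and f2: "weight_bounded_by b f2" and I: "0 < I" and d: "0 \<le> d"
    and fd: "\<And>v I. 0 < I \<Longrightarrow> \<bar>f1 v I - f2 v I\<bar> \<le> d"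
  shows "\<bar>damp f1 v I - damp f2 v I\<bar> \<le> op_const * d * quad_weight v I"
proof -
  have "loss f1 v I - loss f2 v I = loss (\<lambda>v I. f1 v I - f2 v I) v I"
    by (rule loss_diff[symmetric]; rule loss_bounded(1)[OF _ I]) (rule weight_bounded_imp_bounded f1 f2)+
  with loss_bounded(2)[OF bounded_diff[OF f1 f2 d fd] I, of v] show ?thesis by (simp add: damp_def)
qed

lemma damp_bound:
  assumes f: "weight_bounded_by b f" and I: "0 < I"
  shows "\<bar>damp f v I\<bar> \<le> op_const * (maxw_bound + b) * quad_weight v I"
  using loss_bounded(2)[OF bounded_sqrt_maxwellian I, of v]
    loss_bounded(2)[OF weight_bounded_imp_bounded[OF f] I, of v]
  unfolding damp_def by (simp add: algebra_simps)

lemma damp_nonneg: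
  assumes f: "weight_bounded_by b f" and I: "0 < I"
    and pos: "\<And>v I. 0 < I \<Longrightarrow> 0 \<le> sqrtM v I + f v I"
  shows "0 \<le> damp f v I"
proof -
  have "damp f v I = loss (\<lambda>v I. sqrtM v I + f v I) v I"
    unfolding damp_def
    by (rule loss_add[symmetric]; rule loss_bounded(1)[OF _ I])
       (rule bounded_sqrt_maxwellian weight_bounded_imp_bounded[OF f])+
  also have "0 \<le> \<dots>" by (rule loss_nonneg[OF I pos])
  finally show ?thesis .
qed

text \<open>The left-hand side is the gain part of \<open>Q(F, F) / \<surd>M\<close> for \<open>F = M + \<surd>M f\<close>; the terms with
  \<open>loss f\<close> cancel and \<open>\<surd>M \<nu>\<close> is the gain part of \<open>Q(M, M) / \<surd>M\<close>.\<close>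

lemma source_damp_nonneg:
  assumes f: "weight_bounded_by b f" and I: "0 < I"
    and pos: "\<And>v I. 0 < I \<Longrightarrow> 0 \<le> sqrtM v I + f v I"
  shows "0 \<le> source f v I + sqrtM v I * damp f v I"
proof -
  note mw = weight_bounded_sqrt_maxwellian and ms = bounded_sqrt_maxwellian
  note fb = weight_bounded_imp_bounded[OF f]
  let ?F = "\<lambda>v I. sqrtM v I + f v I"
  have Fb: "bounded_by (maxw_bound + b) ?F"
    unfolding bounded_by_def
  proof (intro conjI allI impI)
    show "borel2 ?F" by (rule borel2_add) (use ms fb in \<open>auto simp: bounded_by_def\<close>)
    fix v I assume "(0::real) < I"
    then have "\<bar>sqrtM v I\<bar> \<le> maxw_bound" "\<bar>f v I\<bar> \<le> b"
      using ms fb by (auto simp: bounded_by_def)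
    then show "\<bar>?F v I\<bar> \<le> maxw_bound + b" by linarith
  qed (use ms fb in \<open>auto simp: bounded_by_def\<close>)
  have "gain ?F ?F v I = gain sqrtM ?F v I + gain f ?F v I"
    by (rule gain_add_left; rule gain_okI(1)[OF _ Fb I]) (rule mw f)+
  also have "gain sqrtM ?F v I = gain sqrtM sqrtM v I + gain sqrtM f v I"
    by (rule gain_add_right; rule gain_okI(1)[OF mw _ I]) (rule ms fb)+
  also have "gain f ?F v I = gain f sqrtM v I + gain f f v I"
    by (rule gain_add_right; rule gain_okI(1)[OF f _ I]) (rule ms fb)+
  finally have "gain ?F ?F v I = source f v I + sqrtM v I * damp f v I"
    unfolding source_def damp_def gain_equilibrium[OF I] by (simp add: algebra_simps)
  moreover have "0 \<le> gain ?F ?F v I" by (rule gain_nonneg[OF I pos pos])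
  ultimately show ?thesis by simp
qed

text \<open>The operators of the equation expressed by \<open>gain\<close> and \<open>loss\<close>. The integrands agree only on the region of
  positive internal energies, which is the space of the collision measure.\<close>

lemma coll_nu_eq:
  shows "coll_nu \<delta> \<alpha> C v I = loss sqrtM v I"
    and "0 < I \<Longrightarrow> integrable (Wm v I) (nu_integrand \<delta> v I)"
proof -
  have e: "nu_integrand \<delta> v I z = loss_kernel I z * loss_fun sqrtM z" if "z \<in> coll_region" for z
    using that maxwellian_pos by (auto simp: nu_integrand_def loss_kernel_def loss_fun_def less_imp_le)
  show "coll_nu \<delta> \<alpha> C v I = loss sqrtM v I"
    unfolding coll_nu_def loss_def by (rule W_integral_cong_region(1)[OF e])
  show "integrable (Wm v I) (nu_integrand \<delta> v I)" if "0 < I"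
    using W_integral_cong_region(2)[of "nu_integrand \<delta> v I" _ \<delta> \<alpha> C v I, OF e] loss_bounded(1)[OF bounded_sqrt_maxwellian that] by simp
qed

lemma coll_K1_eq:
  assumes I: "0 < I"
  shows "coll_K1 \<delta> \<alpha> C f v I = sqrtM v I * loss f v I"
    and "bounded_by b f \<Longrightarrow> integrable (Wm v I) (K1_integrand \<delta> f v I)"
proof -
  have e: "K1_integrand \<delta> f v I z = sqrtM v I * (loss_kernel I z * loss_fun f z)" if "z \<in> coll_region" for z
    using that by (auto simp: K1_integrand_def loss_kernel_def loss_fun_def real_sqrt_mult)
  have "coll_K1 \<delta> \<alpha> C f v I = (\<integral>z. sqrtM v I * (loss_kernel I z * loss_fun f z) \<partial>Wm v I)"
    unfolding coll_K1_def by (rule W_integral_cong_region(1)[OF e])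
  then show "coll_K1 \<delta> \<alpha> C f v I = sqrtM v I * loss f v I" by (simp add: loss_def)
  show "integrable (Wm v I) (K1_integrand \<delta> f v I)" if "bounded_by b f"
    using W_integral_cong_region(2)[of "K1_integrand \<delta> f v I" _ \<delta> \<alpha> C v I, OF e] loss_bounded(1)[OF that I, of v]
    by simp
qed

lemma coll_K2_eq:
  assumes I: "0 < I" and f: "weight_bounded_by b f"
  shows "coll_K2 \<delta> \<alpha> C f v I = gain sqrtM f v I + gain f sqrtM v I"
    and "integrable (Wm v I) (K2_integrand \<delta> f)"
proof -
  have m: "0 < sqrtM v I" using maxwellian_pos[OF I] by simp
  let ?G = "\<lambda>z. sqrtM v I * (gain_kernel v I z * gain_pair sqrtM f z + gain_kernel v I z * gain_pair f sqrtM z)"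
  have e: "K2_integrand \<delta> f z = ?G z" if "z \<in> coll_region" for z
  proof -
    obtain vs v' vs' Is I' Is' where z: "z = (vs, v', vs', Is, I', Is')" by (metis prod.collapse)
    have M: "M v' I' = sqrtM v' I' * sqrtM v' I'" "M vs' Is' = sqrtM vs' Is' * sqrtM vs' Is'"
      using that z maxwellian_pos[of I' v'] maxwellian_pos[of Is' vs'] by auto
    have "K2_integrand \<delta> f z = (sqrtM v' I' * sqrtM v' I') * sqrtM vs' Is' / (I' * Is') powr (\<delta> / 2 - 1) * f vs' Is'
     + (sqrtM vs' Is' * sqrtM vs' Is') * sqrtM v' I' / (I' * Is') powr (\<delta> / 2 - 1) * f v' I'"
      using M by (simp add: K2_integrand_def z)
    then show ?thesis using m by (simp add: z gain_kernel_def gain_pair_def field_simps)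
  qed
  have i: "gain_ok sqrtM f v I" "gain_ok f sqrtM v I"
    by (rule gain_okI(2)[OF bounded_sqrt_maxwellian f I] gain_okI(1)[OF f bounded_sqrt_maxwellian I])+
  have "(\<integral>z. K2_integrand \<delta> f z \<partial>Wm v I) = (\<integral>z. ?G z \<partial>Wm v I)"
    by (rule W_integral_cong_region(1)[OF e])
  also have "\<dots> = sqrtM v I * (gain sqrtM f v I + gain f sqrtM v I)"
    using i by (simp add: gain_def)
  finally show "coll_K2 \<delta> \<alpha> C f v I = gain sqrtM f v I + gain f sqrtM v I"
    using m by (simp add: coll_K2_def)
  show "integrable (Wm v I) (K2_integrand \<delta> f)"
    using W_integral_cong_region(2)[of "K2_integrand \<delta> f" ?G \<delta> \<alpha> C v I, OF e] i by simp
qed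

lemma coll_Gamma_eq:
  assumes I: "0 < I" and f: "weight_bounded_by b f"
  shows "coll_Gamma \<delta> \<alpha> C f f v I = gain f f v I - f v I * loss f v I"
    and "integrable (Wm v I) (Q_integrand \<delta> (sqrt_maxw_mult \<delta> f) (sqrt_maxw_mult \<delta> f) v I)"
proof -
  have m: "0 < sqrtM v I" using maxwellian_pos[OF I] by simp
  let ?G = "\<lambda>z. sqrtM v I * (gain_kernel v I z * gain_pair f f z - f v I * (loss_kernel I z * loss_fun f z))"
  let ?Q = "Q_integrand \<delta> (sqrt_maxw_mult \<delta> f) (sqrt_maxw_mult \<delta> f) v I"
  have e: "?Q z = ?G z" if "z \<in> coll_region" for z
  proof -
    obtain vs v' vs' Is I' Is' where z: "z = (vs, v', vs', Is, I', Is')" by (metis prod.collapse)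
    have "sqrtM v' I' * f v' I' * (sqrtM vs' Is' * f vs' Is') / (I' * Is') powr (\<delta> / 2 - 1)
      = sqrtM v I * (gain_kernel v I z * gain_pair f f z)"
      using m by (simp add: z gain_kernel_def gain_pair_def)
    moreover have "sqrtM v I * f v I * (sqrtM vs Is * f vs Is) / (I * Is) powr (\<delta> / 2 - 1)
      = sqrtM v I * (f v I * (loss_kernel I z * loss_fun f z))"
      by (simp add: z loss_kernel_def loss_fun_def)
    ultimately show ?thesis by (simp add: z Q_integrand_def sqrt_maxw_mult_def right_diff_distrib)
  qed
  have i: "gain_ok f f v I" "loss_ok f v I"
    by (rule gain_okI(1)[OF f weight_bounded_imp_bounded[OF f] I] loss_bounded(1)[OF weight_bounded_imp_bounded[OF f] I])+
  have "(\<integral>z. ?Q z \<partial>Wm v I) = (\<integral>z. ?G z \<partial>Wm v I)"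
    by (rule W_integral_cong_region(1)[OF e])
  also have "\<dots> = sqrtM v I * (gain f f v I - f v I * loss f v I)"
    using i by (simp add: gain_def loss_def)
  finally show "coll_Gamma \<delta> \<alpha> C f f v I = gain f f v I - f v I * loss f v I"
    using m by (simp add: coll_Gamma_def coll_Q_def)
  show "integrable (Wm v I) ?Q"
    using W_integral_cong_region(2)[of ?Q ?G \<delta> \<alpha> C v I, OF e] i by simp
qed

lemma coll_K_Gamma_eq:
  assumes I: "0 < I" and f: "weight_bounded_by b f"
  shows "coll_K \<delta> \<alpha> C f v I + coll_Gamma \<delta> \<alpha> C f f v I
       = source f v I - damp f v I * f v I + coll_nu \<delta> \<alpha> C v I * f v I"
  unfolding coll_K_def coll_K1_eq(1)[OF I] coll_K2_eq(1)[OF I f] coll_Gamma_eq(1)[OF I f] coll_nu_eq(1)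
    source_def damp_def by (simp add: algebra_simps)

end

section \<open>The linear problem along characteristics\<close>

definition borel4 :: "(real \<Rightarrow> real^3 \<Rightarrow> real^3 \<Rightarrow> real \<Rightarrow> real) \<Rightarrow> bool" where
  "borel4 f \<longleftrightarrow> (\<lambda>z. f (fst z) (fst (snd z)) (fst (snd (snd z))) (snd (snd (snd z)))) \<in> borel_measurable borel"

lemma borel4_compose:
  assumes "borel4 f" and [measurable]: "\<tau> \<in> borel_measurable N" "X \<in> borel_measurable N" "V \<in> borel_measurable N" "J \<in> borel_measurable N"
  shows "(\<lambda>q. f (\<tau> q) (X q) (V q) (J q)) \<in> borel_measurable N"
proof -
  have "(\<lambda>q. (\<tau> q, X q, V q, J q)) \<in> borel_measurable N" by measurable
  from measurable_compose[OF this assms(1)[unfolded borel4_def]] show ?thesis by simp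
qed

lemma borel4_imp_borel2: "borel4 f \<Longrightarrow> borel2 (f t x)"
  unfolding borel2_def by (rule borel4_compose) auto

lemma borel4_imp_borel_family:
  assumes f: "borel4 f" and [measurable]: "\<tau> \<in> borel_measurable N" "X \<in> borel_measurable N"
  shows "borel_family N (\<lambda>q. f (\<tau> q) (X q))"
  unfolding borel_family_def by (rule borel4_compose[OF f]) measurable

lemma borel_family_const: "borel2 g \<Longrightarrow> borel_family N (\<lambda>_. g)"
  unfolding borel_family_def by (rule borel2_compose) measurable

context polyatomic_kernel
begin

lemma gain_along_measurable:
  assumes f: "borel4 f" and \<tau>: "\<tau> \<in> borel_measurable N" and X: "X \<in> borel_measurable N"
    and V: "V \<in> borel_measurable N" and J: "J \<in> borel_measurable N"
  shows "(\<lambda>q. gain (f (\<tau> q) (X q)) (f (\<tau> q) (X q)) (V q) (J q)) \<in> borel_measurable N"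
    and "(\<lambda>q. gain (f (\<tau> q) (X q)) sqrtM (V q) (J q)) \<in> borel_measurable N"
    and "(\<lambda>q. gain sqrtM (f (\<tau> q) (X q)) (V q) (J q)) \<in> borel_measurable N"
    and "(\<lambda>q. loss (f (\<tau> q) (X q)) (V q) (J q)) \<in> borel_measurable N"
    and "(\<lambda>q. loss sqrtM (V q) (J q)) \<in> borel_measurable N"
  using gain_measurable[OF borel4_imp_borel_family[OF f \<tau> X] borel4_imp_borel_family[OF f \<tau> X] V J]
    gain_measurable[OF borel4_imp_borel_family[OF f \<tau> X] borel_family_const[OF borel2_sqrt_maxwellian, of N \<delta>] V J]
    gain_measurable[OF borel_family_const[OF borel2_sqrt_maxwellian, of N \<delta>] borel4_imp_borel_family[OF f \<tau> X] V J]
    loss_measurable[OF borel4_imp_borel_family[OF f \<tau> X] V J]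
    loss_measurable[OF borel_family_const[OF borel2_sqrt_maxwellian, of N \<delta>] V J] by simp_all

lemma source_along_measurable:
  assumes "borel4 f" "\<tau> \<in> borel_measurable N" "X \<in> borel_measurable N"
    and V [measurable]: "V \<in> borel_measurable N" and J [measurable]: "J \<in> borel_measurable N"
  shows "(\<lambda>q. source (f (\<tau> q) (X q)) (V q) (J q)) \<in> borel_measurable N"
    and "(\<lambda>q. damp (f (\<tau> q) (X q)) (V q) (J q)) \<in> borel_measurable N"
  unfolding source_def damp_def
  by (intro borel_measurable_add borel_measurable_diff borel_measurable_times gain_along_measurable[OF assms]; measurable)+

text \<open>The set that the iteration leaves invariant. Vanishing for \<open>I \<le> 0\<close> turns periodicity into an equality of
  the functions \<open>f t x\<close>, which the collision operators respect.\<close>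

definition phase_bounded :: "real \<Rightarrow> (real \<Rightarrow> real^3 \<Rightarrow> real^3 \<Rightarrow> real \<Rightarrow> real) \<Rightarrow> bool" where
  "phase_bounded b f \<longleftrightarrow> borel4 f \<and> 0 \<le> b \<and>
     (\<forall>t x v I. 0 < I \<longrightarrow> \<bar>f t x v I\<bar> \<le> b / w v I \<and> 0 \<le> sqrtM v I + f t x v I) \<and>
     (\<forall>t x v I. I \<le> 0 \<longrightarrow> f t x v I = 0) \<and>
     (\<forall>t x v I k. f t (x + axis k (2 * pi)) v I = f t x v I)"

lemma phase_boundedD:
  assumes "phase_bounded b f"
  shows "weight_bounded_by b (f t x)" "borel4 f" "0 \<le> b" "0 < I \<Longrightarrow> 0 \<le> sqrtM v I + f t x v I"
    "0 < I \<Longrightarrow> \<bar>f t x v I\<bar> \<le> b / w v I"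
  using assms borel4_imp_borel2[of f t x] by (auto simp: phase_bounded_def weight_bounded_by_def)

text \<open>\<open>y\<close> solves the linear equation \<open>\<partial>\<^sub>t y + v \<cdot> \<nabla>\<^sub>x y = source f - damp f \<cdot> y\<close> with coefficients frozen at \<open>f\<close>. Keeping
  the full damping on the unknown avoids estimating a term of the size of the collision frequency.\<close>

definition char_solution ::
  "real \<Rightarrow> (real^3 \<Rightarrow> real^3 \<Rightarrow> real \<Rightarrow> real) \<Rightarrow> (real \<Rightarrow> real^3 \<Rightarrow> real^3 \<Rightarrow> real \<Rightarrow> real) \<Rightarrow>
     (real \<Rightarrow> real^3 \<Rightarrow> real^3 \<Rightarrow> real \<Rightarrow> real) \<Rightarrow> bool" where
  "char_solution T f0 f y \<longleftrightarrow> (\<forall>x v I. 0 < I \<longrightarrow> y 0 x v I = f0 x v I \<and>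
     abs_prim_on T (\<lambda>t. y t (x + t *\<^sub>R v) v I)
       (\<lambda>t. source (f t (x + t *\<^sub>R v)) v I - damp (f t (x + t *\<^sub>R v)) v I * y t (x + t *\<^sub>R v) v I))"

lemma char_solutionD:
  assumes "char_solution T f0 f y" "0 < I"
  shows "y 0 x v I = f0 x v I"
    "abs_prim_on T (\<lambda>t. y t (x + t *\<^sub>R v) v I)
       (\<lambda>t. source (f t (x + t *\<^sub>R v)) v I - damp (f t (x + t *\<^sub>R v)) v I * y t (x + t *\<^sub>R v) v I)"
  using assms by (auto simp: char_solution_def)

text \<open>The damping is nonnegative because \<open>M + \<surd>M f\<close> is, so only the source contributes.\<close>

lemma char_solution_bound:
  assumes y: "char_solution T f0 f y" and f: "phase_bounded b f"
    and f0: "\<And>x v I. 0 < I \<Longrightarrow> \<bar>f0 x v I\<bar> \<le> R / w v I" and t: "t \<in> {0..T}" and I: "0 < I"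
  shows "\<bar>y t x v I\<bar> \<le> (R + T * (op_const * (3 * maxw_bound + 1) * (b * (1 + b)))) / w v I"
proof -
  let ?x = "x - t *\<^sub>R v" and ?G = "op_const * (3 * maxw_bound + 1) * (b * (1 + b)) / w v I"
  have b: "0 \<le> b" and w: "1 \<le> w v I" using phase_boundedD(3)[OF f] weight_ge_1 I by auto
  have "\<bar>y t (?x + t *\<^sub>R v) v I\<bar> \<le> R / w v I + ?G * t"
  proof (rule damped_bound[OF char_solutionD(2)[OF y I] _ _ _ t])
    show "0 \<le> damp (f s (?x + s *\<^sub>R v)) v I" for s
      by (rule damp_nonneg[OF phase_boundedD(1)[OF f] I phase_boundedD(4)[OF f]])
    show "\<bar>source (f s (?x + s *\<^sub>R v)) v I\<bar> \<le> ?G" for s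
      by (rule source_bound[OF phase_boundedD(1)[OF f] I])
    show "\<bar>y 0 (?x + 0 *\<^sub>R v) v I\<bar> \<le> R / w v I"
      unfolding char_solutionD(1)[OF y I] by (rule f0[OF I])
  qed
  also have "?G * t \<le> ?G * T"
    using t b w op_const_ge(1) maxw_bound(1) by (intro mult_left_mono) auto
  finally show ?thesis by (simp add: add_divide_distrib mult.commute)
qed

text \<open>\<open>z = \<surd>M + y\<close> satisfies \<open>z' = (source f + \<surd>M damp f) - damp f \<cdot> z\<close> along characteristics, with
  a nonnegative first term.\<close>

lemma char_solution_nonneg:
  assumes y: "char_solution T f0 f y" and f: "phase_bounded b f"
    and f0: "\<And>x v I. 0 < I \<Longrightarrow> 0 \<le> sqrtM v I + f0 x v I" and t: "t \<in> {0..T}" and I: "0 < I"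
  shows "0 \<le> sqrtM v I + y t x v I"
proof -
  let ?x = "x - t *\<^sub>R v" and ?m = "sqrtM v I"
  let ?s = "\<lambda>t. source (f t (?x + t *\<^sub>R v)) v I" and ?a = "\<lambda>t. damp (f t (?x + t *\<^sub>R v)) v I" and ?u = "\<lambda>t. y t (?x + t *\<^sub>R v) v I"
  have z: "abs_prim_on T (\<lambda>t. 1 * (?m + 0 * t) + 1 * ?u t) (\<lambda>t. 1 * 0 + 1 * (?s t - ?a t * ?u t))"
    by (rule abs_prim_on_lincomb[OF abs_prim_on_const_slope char_solutionD(2)[OF y I]])
  have "0 \<le> 1 * (?m + 0 * t) + 1 * ?u t"
  proof (rule abs_prim_on_nonneg[OF z _ _ t])
    fix r assume "1 * (?m + 0 * r) + 1 * ?u r \<le> 0"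
    then have le: "?m + ?u r \<le> 0" by simp
    have "0 \<le> ?a r" by (rule damp_nonneg[OF phase_boundedD(1)[OF f] I phase_boundedD(4)[OF f]])
    then have "?a r * (?m + ?u r) \<le> 0" using le by (rule mult_nonneg_nonpos)
    moreover have "0 \<le> ?s r + ?m * ?a r"
      by (rule source_damp_nonneg[OF phase_boundedD(1)[OF f] I phase_boundedD(4)[OF f]])
    ultimately show "0 \<le> 1 * 0 + 1 * (?s r - ?a r * ?u r)" by (simp add: algebra_simps)
  next
    show "0 \<le> 1 * (?m + 0 * 0) + 1 * ?u 0"
      using f0[OF I, of v ?x] char_solutionD(1)[OF y I, of ?x v] by simp
  qed
  then show ?thesis by simp
qed

text \<open>The difference is damped by \<open>damp f1\<close>. The remaining difference of the frequencies grows like \<open>quad_weight\<close>,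
  but it multiplies \<open>y2\<close>, and \<open>quad_weight \<le> w\<close>. Hence the estimate closes in the norm without
  weight.\<close>

lemma char_solution_diff:
  assumes y1: "char_solution T f0 f1 y1" and y2: "char_solution T f0 f2 y2"
    and f1: "phase_bounded b f1" and f2: "phase_bounded b f2"
    and y2b: "\<And>t x v I. t \<in> {0..T} \<Longrightarrow> 0 < I \<Longrightarrow> \<bar>y2 t x v I\<bar> \<le> b / w v I"
    and d: "0 \<le> d" and fd: "\<And>t x v I. t \<in> {0..T} \<Longrightarrow> 0 < I \<Longrightarrow> \<bar>f1 t x v I - f2 t x v I\<bar> \<le> d"
    and t: "t \<in> {0..T}" and I: "0 < I"
  shows "\<bar>y1 t x v I - y2 t x v I\<bar> \<le> T * (op_const * (3 * maxw_bound + 3 * b)) * d"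
proof -
  let ?x = "x - t *\<^sub>R v"
  let ?s1 = "\<lambda>t. source (f1 t (?x + t *\<^sub>R v)) v I" and ?a1 = "\<lambda>t. damp (f1 t (?x + t *\<^sub>R v)) v I" and ?u1 = "\<lambda>t. y1 t (?x + t *\<^sub>R v) v I"
  let ?s2 = "\<lambda>t. source (f2 t (?x + t *\<^sub>R v)) v I" and ?a2 = "\<lambda>t. damp (f2 t (?x + t *\<^sub>R v)) v I" and ?u2 = "\<lambda>t. y2 t (?x + t *\<^sub>R v) v I"
  have b: "0 \<le> b" and w: "1 \<le> w v I" using phase_boundedD(3)[OF f1] weight_ge_1 I by auto
  let ?G = "op_const * (3 * maxw_bound + 3 * b) * d"
  have "abs_prim_on T (\<lambda>t. 1 * ?u1 t + (-1) * ?u2 t) (\<lambda>t. 1 * (?s1 t - ?a1 t * ?u1 t) + (-1) * (?s2 t - ?a2 t * ?u2 t))"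
    by (rule abs_prim_on_lincomb[OF char_solutionD(2)[OF y1 I] char_solutionD(2)[OF y2 I]])
  also have "(\<lambda>t. 1 * (?s1 t - ?a1 t * ?u1 t) + (-1) * (?s2 t - ?a2 t * ?u2 t))
     = (\<lambda>t. ((?s1 t - ?s2 t) - (?a1 t - ?a2 t) * ?u2 t) - ?a1 t * (1 * ?u1 t + (-1) * ?u2 t))"
    by (simp add: fun_eq_iff algebra_simps)
  finally have "\<bar>1 * ?u1 t + (-1) * ?u2 t\<bar> \<le> 0 + ?G * t"
  proof (rule damped_bound[OF _ _ _ _ t])
    show "0 \<le> ?a1 s" for s
      by (rule damp_nonneg[OF phase_boundedD(1)[OF f1] I phase_boundedD(4)[OF f1]])
    show "\<bar>1 * ?u1 0 + (-1) * ?u2 0\<bar> \<le> 0"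
      using char_solutionD(1)[OF y1 I, of ?x v] char_solutionD(1)[OF y2 I, of ?x v] by simp
    fix s assume s: "s \<in> {0..T}"
    have sd: "\<bar>?s1 s - ?s2 s\<bar> \<le> op_const * (3 * maxw_bound + 2 * b) * d"
      by (rule source_diff[OF phase_boundedD(1)[OF f1] phase_boundedD(1)[OF f2] I d fd[OF s]])
    have "\<bar>(?a1 s - ?a2 s) * ?u2 s\<bar> \<le> (op_const * d * quad_weight v I) * (b / w v I)"
      unfolding abs_mult
      by (rule mult_mono[OF damp_diff[OF phase_boundedD(1)[OF f1] phase_boundedD(1)[OF f2] I d fd[OF s]] y2b[OF s I]])
         (use d op_const_ge(1) in \<open>auto simp: quad_weight_def\<close>)
    also have "\<dots> = (op_const * d * b) * (quad_weight v I / w v I)" by simp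
    also have "\<dots> \<le> (op_const * d * b) * 1"
      using quad_weight_le_weight[of I v] w I d b op_const_ge(1) by (intro mult_left_mono) auto
    finally have "\<bar>(?a1 s - ?a2 s) * ?u2 s\<bar> \<le> op_const * d * b" by simp
    with sd have "\<bar>(?s1 s - ?s2 s) - (?a1 s - ?a2 s) * ?u2 s\<bar> \<le> op_const * (3 * maxw_bound + 2 * b) * d + op_const * d * b"
      by linarith
    also have "\<dots> = ?G" by (simp add: algebra_simps)
    finally show "\<bar>(?s1 s - ?s2 s) - (?a1 s - ?a2 s) * ?u2 s\<bar> \<le> ?G" .
  qed
  also have "0 + ?G * t \<le> ?G * T"
    using t b d op_const_ge(1) maxw_bound(1) by (simp add: mult_left_mono)
  finally show ?thesis by (simp add: mult_ac)
qed

definition damp_integral :: "(real \<Rightarrow> real^3 \<Rightarrow> real^3 \<Rightarrow> real \<Rightarrow> real) \<Rightarrow> real \<Rightarrow> real^3 \<Rightarrow> real^3 \<Rightarrow> real \<Rightarrow> real" where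
  "damp_integral f t x v I = (LBINT s:{0..t}. damp (f s (x + s *\<^sub>R v)) v I)"

text \<open>The explicit solution of the linear equation, written with the foot \<open>y = x - t v\<close> of the characteristic.\<close>

definition char_step :: "real \<Rightarrow> (real^3 \<Rightarrow> real^3 \<Rightarrow> real \<Rightarrow> real) \<Rightarrow> (real \<Rightarrow> real^3 \<Rightarrow> real^3 \<Rightarrow> real \<Rightarrow> real) \<Rightarrow>
    real \<Rightarrow> real^3 \<Rightarrow> real^3 \<Rightarrow> real \<Rightarrow> real" where
  "char_step T f0 f t x v I = (if 0 \<le> t \<and> t \<le> T \<and> 0 < I then
     (let y = x - t *\<^sub>R v in exp (- damp_integral f t y v I) *
        (f0 y v I + (LBINT s:{0..t}. exp (damp_integral f s y v I) * source (f s (y + s *\<^sub>R v)) v I))) else 0)"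

lemma damp_integral_measurable:
  assumes f: "borel4 f" and [measurable]: "\<tau> \<in> borel_measurable N" "X \<in> borel_measurable N"
    "V \<in> borel_measurable N" "J \<in> borel_measurable N"
  shows "(\<lambda>q. damp_integral f (\<tau> q) (X q) (V q) (J q)) \<in> borel_measurable N"
  unfolding damp_integral_def
  by (rule LBINT_param_measurable[where h="\<lambda>q s. damp (f s (X q + s *\<^sub>R V q)) (V q) (J q)"])
     (rule source_along_measurable[OF f], measurable)

lemma char_step_measurable:
  assumes f: "borel4 f" and f0: "(\<lambda>z. f0 (fst z) (fst (snd z)) (snd (snd z))) \<in> borel_measurable borel"
  shows "borel4 (char_step T f0 f)"
proof -
  let ?N = "borel :: (real \<times> (real^3) \<times> (real^3) \<times> real) measure"
  let ?t = "\<lambda>z :: real \<times> (real^3) \<times> (real^3) \<times> real. fst z" and ?v = "\<lambda>z :: real \<times> (real^3) \<times> (real^3) \<times> real. fst (snd (snd z))"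
  let ?I = "\<lambda>z :: real \<times> (real^3) \<times> (real^3) \<times> real. snd (snd (snd z))"
  let ?y = "\<lambda>z :: real \<times> (real^3) \<times> (real^3) \<times> real. fst (snd z) - fst z *\<^sub>R fst (snd (snd z))"
  have "(\<lambda>z. (?y z, ?v z, ?I z)) \<in> borel_measurable ?N" by measurable
  from measurable_compose[OF this f0]
  have [measurable]: "(\<lambda>z. f0 (?y z) (?v z) (?I z)) \<in> borel_measurable ?N" by simp
  have [measurable]: "(\<lambda>z. damp_integral f (?t z) (?y z) (?v z) (?I z)) \<in> borel_measurable ?N"
    by (rule damp_integral_measurable[OF f]) measurable
  have [measurable]: "(\<lambda>z. LBINT s:{0..?t z}. exp (damp_integral f s (?y z) (?v z) (?I z)) * source (f s (?y z + s *\<^sub>R ?v z)) (?v z) (?I z)) \<in> borel_measurable ?N"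
  proof (rule LBINT_param_measurable[where h="\<lambda>z s. exp (damp_integral f s (?y z) (?v z) (?I z)) * source (f s (?y z + s *\<^sub>R ?v z)) (?v z) (?I z)"])
    show "(\<lambda>x. exp (damp_integral f (snd x) (?y (fst x)) (?v (fst x)) (?I (fst x)))
        * source (f (snd x) (?y (fst x) + snd x *\<^sub>R ?v (fst x))) (?v (fst x)) (?I (fst x))) \<in> borel_measurable (?N \<Otimes>\<^sub>M borel)"
    proof -
      have [measurable]: "(\<lambda>x. damp_integral f (snd x) (?y (fst x)) (?v (fst x)) (?I (fst x))) \<in> borel_measurable (?N \<Otimes>\<^sub>M borel)"
        by (rule damp_integral_measurable[OF f]) measurable
      have [measurable]: "(\<lambda>x. source (f (snd x) (?y (fst x) + snd x *\<^sub>R ?v (fst x))) (?v (fst x)) (?I (fst x))) \<in> borel_measurable (?N \<Otimes>\<^sub>M borel)"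
        by (rule source_along_measurable[OF f]) measurable
      show ?thesis by measurable
    qed
  qed measurable
  show ?thesis
    unfolding borel4_def char_step_def Let_def by measurable
qed

lemma char_step_solution:
  assumes f: "phase_bounded b f" and f0: "(\<lambda>z. f0 (fst z) (fst (snd z)) (snd (snd z))) \<in> borel_measurable borel"
    and T: "0 \<le> T"
  shows "char_solution T f0 f (char_step T f0 f)"
  unfolding char_solution_def
proof (intro allI impI conjI)
  fix x v :: "real^3" and I :: real assume I: "0 < I"
  note f4 = phase_boundedD(2)[OF f]
  let ?s = "\<lambda>t. source (f t (x + t *\<^sub>R v)) v I" and ?a = "\<lambda>t. damp (f t (x + t *\<^sub>R v)) v I"
  let ?y = "\<lambda>t. exp (- (LBINT s:{0..t}. ?a s)) * (f0 x v I + (LBINT s:{0..t}. exp (LBINT r:{0..s}. ?a r) * ?s s))"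
  have sm [measurable]: "?s \<in> borel_measurable borel" and am [measurable]: "?a \<in> borel_measurable borel"
    by (rule source_along_measurable[OF f4]; measurable)+
  have eq: "char_step T f0 f t (x + t *\<^sub>R v) v I = ?y t" if "t \<in> {0..T}" for t
    using that I by (simp add: char_step_def damp_integral_def Let_def)
  have y: "abs_prim_on T ?y (\<lambda>t. ?s t - ?a t * ?y t)"
    by (rule damped_solution[OF am damp_bound[OF phase_boundedD(1)[OF f] I] sm source_bound[OF phase_boundedD(1)[OF f] I]])
  have m [measurable]: "(\<lambda>t. char_step T f0 f t (x + t *\<^sub>R v) v I) \<in> borel_measurable borel"
    by (rule borel4_compose[OF char_step_measurable[OF f4 f0]]) measurable
  show "abs_prim_on T (\<lambda>t. char_step T f0 f t (x + t *\<^sub>R v) v I) (\<lambda>t. ?s t - ?a t * char_step T f0 f t (x + t *\<^sub>R v) v I)"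
    by (rule abs_prim_on_cong[OF y m]) (measurable, simp_all add: eq)
  show "char_step T f0 f 0 x v I = f0 x v I"
    using eq[of 0] T by simp
qed

lemma char_step_phase_bounded:
  assumes f: "phase_bounded b f" and f0m: "(\<lambda>z. f0 (fst z) (fst (snd z)) (snd (snd z))) \<in> borel_measurable borel"
    and T: "0 \<le> T" and f0: "\<And>x v I. 0 < I \<Longrightarrow> \<bar>f0 x v I\<bar> \<le> R / w v I" "\<And>x v I. 0 < I \<Longrightarrow> 0 \<le> sqrtM v I + f0 x v I"
    and f0t: "\<And>x v I k. 0 < I \<Longrightarrow> f0 (x + axis k (2 * pi)) v I = f0 x v I"
    and b: "R + T * (op_const * (3 * maxw_bound + 1) * (b * (1 + b))) \<le> b"
  shows "phase_bounded b (char_step T f0 f)"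
  unfolding phase_bounded_def
proof (intro conjI allI impI)
  note S = char_step_solution[OF f f0m T]
  show "borel4 (char_step T f0 f)" by (rule char_step_measurable[OF phase_boundedD(2)[OF f] f0m])
  show b0: "0 \<le> b" by (rule phase_boundedD(3)[OF f])
  fix t :: real and x v :: "real^3" and I :: real
  show "char_step T f0 f t x v I = 0" if "I \<le> 0" using that by (simp add: char_step_def)
  {
    assume I: "0 < I"
    have w: "1 \<le> w v I" using weight_ge_1 I by simp
    show "\<bar>char_step T f0 f t x v I\<bar> \<le> b / w v I"
    proof (cases "t \<in> {0..T}")
      case True
      have "\<bar>char_step T f0 f t x v I\<bar> \<le> (R + T * (op_const * (3 * maxw_bound + 1) * (b * (1 + b)))) / w v I"
        by (rule char_solution_bound[OF S f f0(1) True I])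
      also have "\<dots> \<le> b / w v I" using b w by (intro divide_right_mono) auto
      finally show ?thesis .
    qed (use b0 w in \<open>auto simp: char_step_def\<close>)
    show "0 \<le> sqrtM v I + char_step T f0 f t x v I"
    proof (cases "t \<in> {0..T}")
      case True
      show ?thesis by (rule char_solution_nonneg[OF S f f0(2) True I])
    qed (use maxwellian_pos[OF I, of v] in \<open>auto simp: char_step_def\<close>)
  }
  fix k :: 3
  have "f s (x + axis k (2 * pi) - t *\<^sub>R v + s *\<^sub>R v) = f s (x - t *\<^sub>R v + s *\<^sub>R v)" for s
  proof (intro ext)
    fix v' I'
    have "x + axis k (2 * pi) - t *\<^sub>R v + s *\<^sub>R v = (x - t *\<^sub>R v + s *\<^sub>R v) + axis k (2 * pi)" by simp
    then show "f s (x + axis k (2 * pi) - t *\<^sub>R v + s *\<^sub>R v) v' I' = f s (x - t *\<^sub>R v + s *\<^sub>R v) v' I'"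
      using f unfolding phase_bounded_def by metis
  qed
  moreover have "0 < I \<Longrightarrow> f0 (x + axis k (2 * pi) - t *\<^sub>R v) v I = f0 (x - t *\<^sub>R v) v I"
    using f0t[of I "x - t *\<^sub>R v" k v] by (simp add: algebra_simps)
  ultimately show "char_step T f0 f t (x + axis k (2 * pi)) v I = char_step T f0 f t x v I"
    by (simp add: char_step_def damp_integral_def Let_def)
qed

end

section \<open>Mild solutions as solutions along characteristics\<close>

context polyatomic_kernel
begin

lemma coll_K_cong:
  assumes eq: "\<And>v I. 0 < I \<Longrightarrow> f v I = g v I"
  shows "coll_K \<delta> \<alpha> C f v I = coll_K \<delta> \<alpha> C g v I"
proof -
  have "(\<integral>z. K1_integrand \<delta> f v I z \<partial>Wm v I) = (\<integral>z. K1_integrand \<delta> g v I z \<partial>Wm v I)"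
    by (rule W_integral_cong_region(1)) (auto simp: K1_integrand_def eq)
  moreover have "(\<integral>z. K2_integrand \<delta> f z \<partial>Wm v I) = (\<integral>z. K2_integrand \<delta> g z \<partial>Wm v I)"
    by (rule W_integral_cong_region(1)) (auto simp: K2_integrand_def eq)
  ultimately show ?thesis by (simp add: coll_K_def coll_K1_def coll_K2_def)
qed

lemma coll_Gamma_cong:
  assumes eq: "\<And>v I. 0 < I \<Longrightarrow> f v I = g v I" and I: "0 < I"
  shows "coll_Gamma \<delta> \<alpha> C f f v I = coll_Gamma \<delta> \<alpha> C g g v I"
proof -
  have "(\<integral>z. Q_integrand \<delta> (sqrt_maxw_mult \<delta> f) (sqrt_maxw_mult \<delta> f) v I z \<partial>Wm v I)
      = (\<integral>z. Q_integrand \<delta> (sqrt_maxw_mult \<delta> g) (sqrt_maxw_mult \<delta> g) v I z \<partial>Wm v I)"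
    by (rule W_integral_cong_region(1)) (auto simp: Q_integrand_def sqrt_maxw_mult_def eq I)
  then show ?thesis by (simp add: coll_Gamma_def coll_Q_def)
qed

lemma operators_along_char:
  assumes f: "phase_bounded b f" and I: "0 < I"
  shows "(\<lambda>s. coll_K \<delta> \<alpha> C (f s (x + s *\<^sub>R v)) v I) \<in> borel_measurable borel"
    and "(\<lambda>s. coll_Gamma \<delta> \<alpha> C (f s (x + s *\<^sub>R v)) (f s (x + s *\<^sub>R v)) v I) \<in> borel_measurable borel"
    and "\<exists>B. \<forall>s. \<bar>coll_K \<delta> \<alpha> C (f s (x + s *\<^sub>R v)) v I\<bar> \<le> B \<and>
            \<bar>coll_Gamma \<delta> \<alpha> C (f s (x + s *\<^sub>R v)) (f s (x + s *\<^sub>R v)) v I\<bar> \<le> B"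
proof -
  note fw = phase_boundedD(1)[OF f] and f4 = phase_boundedD(2)[OF f]
  note fb = weight_bounded_imp_bounded[OF fw]
  let ?f = "\<lambda>s. f s (x + s *\<^sub>R v)"
  have K: "coll_K \<delta> \<alpha> C (?f s) v I = gain sqrtM (?f s) v I + gain (?f s) sqrtM v I - sqrtM v I * loss (?f s) v I" for s
    by (simp add: coll_K_def coll_K1_eq(1)[OF I] coll_K2_eq(1)[OF I fw])
  have G: "coll_Gamma \<delta> \<alpha> C (?f s) (?f s) v I = gain (?f s) (?f s) v I - ?f s v I * loss (?f s) v I" for s
    by (rule coll_Gamma_eq(1)[OF I fw])
  have tm: "(\<lambda>s. s) \<in> borel_measurable borel" "(\<lambda>s. x + s *\<^sub>R v) \<in> borel_measurable borel"
    "(\<lambda>s. v) \<in> borel_measurable borel" "(\<lambda>s. I) \<in> borel_measurable borel" by measurable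
  note [measurable] = gain_along_measurable[OF f4 tm] borel4_compose[OF f4 tm]
  show "(\<lambda>s. coll_K \<delta> \<alpha> C (?f s) v I) \<in> borel_measurable borel" unfolding K by measurable
  show "(\<lambda>s. coll_Gamma \<delta> \<alpha> C (?f s) (?f s) v I) \<in> borel_measurable borel" unfolding G by measurable
  let ?L = "op_const * b * quad_weight v I"
  let ?B1 = "op_const * maxw_bound * b + op_const * b * maxw_bound + sqrtM v I * ?L"
  let ?B2 = "op_const * b * b + b / w v I * ?L"
  have l: "\<bar>loss (?f s) v I\<bar> \<le> ?L" for s by (rule loss_bounded(2)[OF fb I])
  have L: "0 \<le> ?L" using l[of 0] by linarith
  have B1: "\<bar>coll_K \<delta> \<alpha> C (?f s) v I\<bar> \<le> ?B1" for s
  proof -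
    have "\<bar>sqrtM v I * loss (?f s) v I\<bar> \<le> sqrtM v I * ?L"
      unfolding abs_mult using l[of s] maxwellian_pos[OF I, of v] by (intro mult_mono) auto
    moreover have "\<bar>gain sqrtM (?f s) v I\<bar> \<le> op_const * maxw_bound * b"
      by (rule gain_weight_bounded_left(2)[OF weight_bounded_sqrt_maxwellian fb I])
    moreover have "\<bar>gain (?f s) sqrtM v I\<bar> \<le> op_const * b * maxw_bound"
      by (rule gain_weight_bounded_right(2)[OF fb weight_bounded_sqrt_maxwellian I])
    ultimately show ?thesis unfolding K by linarith
  qed
  have B2: "\<bar>coll_Gamma \<delta> \<alpha> C (?f s) (?f s) v I\<bar> \<le> ?B2" for s
  proof -
    have "\<bar>?f s v I * loss (?f s) v I\<bar> \<le> b / w v I * ?L"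
      unfolding abs_mult using l[of s] phase_boundedD(5)[OF f I] L by (intro mult_mono) (auto intro: order_trans[OF abs_ge_zero])
    moreover have "\<bar>gain (?f s) (?f s) v I\<bar> \<le> op_const * b * b"
      by (rule gain_weight_bounded_left(2)[OF fw fb I])
    ultimately show ?thesis unfolding G by linarith
  qed
  have "\<bar>coll_K \<delta> \<alpha> C (?f s) v I\<bar> \<le> max ?B1 ?B2 \<and> \<bar>coll_Gamma \<delta> \<alpha> C (?f s) (?f s) v I\<bar> \<le> max ?B1 ?B2" for s
    using B1[of s] B2[of s] by (simp add: le_max_iff_disj)
  then show "\<exists>B. \<forall>s. \<bar>coll_K \<delta> \<alpha> C (?f s) v I\<bar> \<le> B \<and> \<bar>coll_Gamma \<delta> \<alpha> C (?f s) (?f s) v I\<bar> \<le> B" by blast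
qed

lemma duhamel_integrable:
  assumes f: "phase_bounded b f" and I: "0 < I"
  shows "set_integrable lborel {0..t} (\<lambda>s. exp (- c * (t - s)) * coll_K \<delta> \<alpha> C (f s (x + s *\<^sub>R v)) v I)"
    and "set_integrable lborel {0..t} (\<lambda>s. exp (- c * (t - s)) * coll_Gamma \<delta> \<alpha> C (f s (x + s *\<^sub>R v)) (f s (x + s *\<^sub>R v)) v I)"
proof -
  note [measurable] = operators_along_char(1,2)[OF f I, of x v]
  obtain B where B: "\<bar>coll_K \<delta> \<alpha> C (f s (x + s *\<^sub>R v)) v I\<bar> \<le> B"
     "\<bar>coll_Gamma \<delta> \<alpha> C (f s (x + s *\<^sub>R v)) (f s (x + s *\<^sub>R v)) v I\<bar> \<le> B" for s
    using operators_along_char(3)[OF f I, of x v] by blast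
  have e: "exp (- c * (t - s)) \<le> exp (\<bar>c\<bar> * t)" if "s \<in> {0..t}" for s
  proof -
    have "- c * (t - s) \<le> \<bar>c\<bar> * (t - s)" using that by (intro mult_right_mono) auto
    also have "\<dots> \<le> \<bar>c\<bar> * t" using that by (intro mult_left_mono) auto
    finally show ?thesis by simp
  qed
  show "set_integrable lborel {0..t} (\<lambda>s. exp (- c * (t - s)) * coll_K \<delta> \<alpha> C (f s (x + s *\<^sub>R v)) v I)"
  proof (rule set_integrable_bounded_interval)
    show "\<bar>exp (- c * (t - s)) * coll_K \<delta> \<alpha> C (f s (x + s *\<^sub>R v)) v I\<bar> \<le> exp (\<bar>c\<bar> * t) * B" if "s \<in> {0..t}" for s
      unfolding abs_mult using e[OF that] B(1)[of s] by (intro mult_mono) auto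
  qed measurable
  show "set_integrable lborel {0..t} (\<lambda>s. exp (- c * (t - s)) * coll_Gamma \<delta> \<alpha> C (f s (x + s *\<^sub>R v)) (f s (x + s *\<^sub>R v)) v I)"
  proof (rule set_integrable_bounded_interval)
    show "\<bar>exp (- c * (t - s)) * coll_Gamma \<delta> \<alpha> C (f s (x + s *\<^sub>R v)) (f s (x + s *\<^sub>R v)) v I\<bar> \<le> exp (\<bar>c\<bar> * t) * B" if "s \<in> {0..t}" for s
      unfolding abs_mult using e[OF that] B(2)[of s] by (intro mult_mono) auto
  qed measurable
qed

text \<open>Both sides are the Duhamel term of the mild formulation; on the right \<open>K f + \<Gamma>(f, f)\<close> is written as the
  right-hand side of the equation along the characteristic plus \<open>\<nu> f\<close>.\<close>

lemma duhamel_sum: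
  assumes f: "phase_bounded b f" and I: "0 < I"
  shows "(LBINT s:{0..t}. exp (- c * (t - s)) * coll_K \<delta> \<alpha> C (f s (x + s *\<^sub>R v)) v I)
       + (LBINT s:{0..t}. exp (- c * (t - s)) * coll_Gamma \<delta> \<alpha> C (f s (x + s *\<^sub>R v)) (f s (x + s *\<^sub>R v)) v I)
     = exp (- c * t) * (LBINT s:{0..t}. exp (c * s) *
         (source (f s (x + s *\<^sub>R v)) v I - damp (f s (x + s *\<^sub>R v)) v I * f s (x + s *\<^sub>R v) v I
          + coll_nu \<delta> \<alpha> C v I * f s (x + s *\<^sub>R v) v I))"
proof -
  note KG = coll_K_Gamma_eq[OF I phase_boundedD(1)[OF f], symmetric]
  have e: "exp (- c * t) * exp (c * s) = exp (- c * (t - s))" for s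
    unfolding exp_add[symmetric] by (rule arg_cong[where f=exp]) (simp add: algebra_simps)
  show ?thesis
    unfolding KG
    by (subst set_integral_add(2)[OF duhamel_integrable[OF f I], symmetric])
       (simp only: set_integral_mult_right[symmetric] mult.assoc[symmetric] e distrib_left)
qed

text \<open>The product rule for \<open>exp (\<nu> s) f\<close> along the characteristic removes the constant rate \<open>\<nu>\<close>.\<close>

lemma char_solution_imp_mild:
  assumes f: "phase_bounded b f" and sol: "char_solution T f0 f f"
    and f0: "\<And>x v I. 0 < I \<Longrightarrow> f0 x v I = f0' x v I"
  shows "mild_perturbation \<delta> \<alpha> C T f0' f"
  unfolding mild_perturbation_def
proof (intro conjI ballI allI impI)
  note fw = phase_boundedD(1)[OF f] and f4 = phase_boundedD(2)[OF f]
  show "torus_fun (f t)" for t using f by (auto simp: torus_fun_def phase_bounded_def)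
  have "(\<lambda>(t, x, v, I). f t x v I) \<in> borel_measurable borel"
    using f4 by (simp add: borel4_def case_prod_beta)
  then show "(\<lambda>(t, x, v, I). f t x v I) \<in> borel_measurable (restrict_space borel ({0..T} \<times> UNIV \<times> UNIV \<times> {0<..}))"
    by (rule measurable_restrict_space1)
  fix t :: real and x v :: "real^3" and I :: real assume t: "t \<in> {0..T}" and I: "0 < I"
  show "integrable (Wm v I) (nu_integrand \<delta> v I)" by (rule coll_nu_eq(2)[OF I])
  show "integrable (Wm v I) (K1_integrand \<delta> (f t x) v I)"
    by (rule coll_K1_eq(2)[OF I weight_bounded_imp_bounded[OF fw]])
  show "integrable (Wm v I) (K2_integrand \<delta> (f t x))" by (rule coll_K2_eq(2)[OF I fw])
  show "integrable (Wm v I) (Q_integrand \<delta> (sqrt_maxw_mult \<delta> (f t x)) (sqrt_maxw_mult \<delta> (f t x)) v I)"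
    by (rule coll_Gamma_eq(2)[OF I fw])
  define y where "y = x - t *\<^sub>R v"
  define c where "c = coll_nu \<delta> \<alpha> C v I"
  have p: "x - (t - s) *\<^sub>R v = y + s *\<^sub>R v" for s by (simp add: y_def algebra_simps)
  show "set_integrable lborel {0..t} (\<lambda>s. exp (- coll_nu \<delta> \<alpha> C v I * (t - s)) * coll_K \<delta> \<alpha> C (f s (x - (t - s) *\<^sub>R v)) v I)"
    "set_integrable lborel {0..t} (\<lambda>s. exp (- coll_nu \<delta> \<alpha> C v I * (t - s)) * coll_Gamma \<delta> \<alpha> C (f s (x - (t - s) *\<^sub>R v)) (f s (x - (t - s) *\<^sub>R v)) v I)"
    unfolding p by (rule duhamel_integrable[OF f I])+
  let ?u = "\<lambda>s. f s (y + s *\<^sub>R v) v I"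
  let ?U = "\<lambda>s. source (f s (y + s *\<^sub>R v)) v I - damp (f s (y + s *\<^sub>R v)) v I * ?u s"
  have "abs_prim_on T (\<lambda>s. exp (0 + c * s) * ?u s) (\<lambda>s. exp (0 + c * s) * ?U s + exp (0 + c * s) * c * ?u s)"
    by (rule abs_prim_on_mult[OF abs_prim_on_exp[OF abs_prim_on_const_slope] char_solutionD(2)[OF sol I]])
  from abs_prim_on_diff[OF this, of 0 t] t
  have "exp (c * t) * ?u t = ?u 0 + (LBINT s:{0..t}. exp (c * s) * (?U s + c * ?u s))"
    by (simp add: algebra_simps)
  then have "exp (- c * t) * (exp (c * t) * ?u t) = exp (- c * t) * ?u 0 + exp (- c * t) * (LBINT s:{0..t}. exp (c * s) * (?U s + c * ?u s))"
    by (simp only: distrib_left)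
  moreover have "exp (- c * t) * (exp (c * t) * ?u t) = ?u t"
    by (simp add: mult.assoc[symmetric] flip: exp_add)
  moreover have "?u 0 = f0' y v I" using char_solutionD(1)[OF sol I] f0[OF I] by simp
  moreover have "?u t = f t x v I" by (simp add: y_def)
  ultimately show "f t x v I = exp (- coll_nu \<delta> \<alpha> C v I * t) * f0' (x - t *\<^sub>R v) v I
      + (LBINT s:{0..t}. exp (- coll_nu \<delta> \<alpha> C v I * (t - s)) * coll_K \<delta> \<alpha> C (f s (x - (t - s) *\<^sub>R v)) v I)
      + (LBINT s:{0..t}. exp (- coll_nu \<delta> \<alpha> C v I * (t - s)) * coll_Gamma \<delta> \<alpha> C (f s (x - (t - s) *\<^sub>R v)) (f s (x - (t - s) *\<^sub>R v)) v I)"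
    unfolding p add.assoc duhamel_sum[OF f I] by (simp add: c_def y_def)
qed

text \<open>The mild formula says that \<open>exp (\<nu> t) h\<close> is an integral along the characteristic through \<open>x\<close>; multiplying by
  \<open>exp (- \<nu> t)\<close> and applying the product rule gives the equation. \<open>h\<close> is a modification of the given
  solution \<open>g\<close> off the set where \<open>g\<close> is constrained.\<close>

lemma mild_imp_char_solution:
  assumes mild: "mild_perturbation \<delta> \<alpha> C T f0 g" and h: "phase_bounded b h"
    and hg: "\<And>t x v I. t \<in> {0..T} \<Longrightarrow> 0 < I \<Longrightarrow> h t x v I = g t x v I" and T: "0 \<le> T"
  shows "char_solution T f0 h h"
  unfolding char_solution_def
proof (intro allI impI conjI)
  fix x v :: "real^3" and I :: real assume I: "0 < I"
  define c where "c = coll_nu \<delta> \<alpha> C v I"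
  let ?u = "\<lambda>s. h s (x + s *\<^sub>R v) v I"
  let ?U = "\<lambda>s. source (h s (x + s *\<^sub>R v)) v I - damp (h s (x + s *\<^sub>R v)) v I * ?u s"
  have duh: "?u t = exp (- c * t) * (f0 x v I + (LBINT s:{0..t}. exp (c * s) * (?U s + c * ?u s)))" if t: "t \<in> {0..T}" for t
  proof -
    have p: "(x + t *\<^sub>R v) - (t - s) *\<^sub>R v = x + s *\<^sub>R v" for s by (simp add: algebra_simps)
    have gK: "coll_K \<delta> \<alpha> C (g s (x + s *\<^sub>R v)) v I = coll_K \<delta> \<alpha> C (h s (x + s *\<^sub>R v)) v I"
      and gG: "coll_Gamma \<delta> \<alpha> C (g s (x + s *\<^sub>R v)) (g s (x + s *\<^sub>R v)) v I = coll_Gamma \<delta> \<alpha> C (h s (x + s *\<^sub>R v)) (h s (x + s *\<^sub>R v)) v I"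
      if "s \<in> {0..t}" for s
      using that t hg[of s] by (intro coll_K_cong coll_Gamma_cong I; simp)+
    have "g t (x + t *\<^sub>R v) v I = exp (- c * t) * f0 x v I
      + (LBINT s:{0..t}. exp (- c * (t - s)) * coll_K \<delta> \<alpha> C (g s (x + s *\<^sub>R v)) v I)
      + (LBINT s:{0..t}. exp (- c * (t - s)) * coll_Gamma \<delta> \<alpha> C (g s (x + s *\<^sub>R v)) (g s (x + s *\<^sub>R v)) v I)"
      using mild[unfolded mild_perturbation_def] t I unfolding c_def
      by (elim conjE) (drule bspec[OF _ t], drule spec[of _ "x + t *\<^sub>R v"], drule spec[of _ v], drule spec[of _ I], simp add: p)
    also have "(LBINT s:{0..t}. exp (- c * (t - s)) * coll_K \<delta> \<alpha> C (g s (x + s *\<^sub>R v)) v I)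
      = (LBINT s:{0..t}. exp (- c * (t - s)) * coll_K \<delta> \<alpha> C (h s (x + s *\<^sub>R v)) v I)"
      by (rule set_lebesgue_integral_cong) (use gK in auto)
    also have "(LBINT s:{0..t}. exp (- c * (t - s)) * coll_Gamma \<delta> \<alpha> C (g s (x + s *\<^sub>R v)) (g s (x + s *\<^sub>R v)) v I)
      = (LBINT s:{0..t}. exp (- c * (t - s)) * coll_Gamma \<delta> \<alpha> C (h s (x + s *\<^sub>R v)) (h s (x + s *\<^sub>R v)) v I)"
      by (rule set_lebesgue_integral_cong) (use gG in auto)
    finally show ?thesis
      unfolding add.assoc duhamel_sum[OF h I] hg[OF t I] by (simp add: c_def distrib_left)
  qed
  show "h 0 x v I = f0 x v I" using duh[of 0] T by simp
  have tm: "(\<lambda>s. s) \<in> borel_measurable borel" "(\<lambda>s. x + s *\<^sub>R v) \<in> borel_measurable borel"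
    "(\<lambda>s. v) \<in> borel_measurable borel" "(\<lambda>s. I) \<in> borel_measurable borel" by measurable
  note h4 = phase_boundedD(2)[OF h]
  note [measurable] = borel4_compose[OF h4 tm] source_along_measurable[OF h4 tm]
  define P where "P = (\<lambda>s. exp (c * s) * (?U s + c * ?u s))"
  have Pm: "P \<in> borel_measurable borel" unfolding P_def by measurable
  obtain B where B: "\<bar>coll_K \<delta> \<alpha> C (h s (x + s *\<^sub>R v)) v I\<bar> \<le> B"
     "\<bar>coll_Gamma \<delta> \<alpha> C (h s (x + s *\<^sub>R v)) (h s (x + s *\<^sub>R v)) v I\<bar> \<le> B" for s
    using operators_along_char(3)[OF h I, of x v] by blast
  have "\<bar>P s\<bar> \<le> exp (\<bar>c\<bar> * T) * (B + B)" if s: "s \<in> {0..T}" for s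
  proof -
    have "c * s \<le> \<bar>c\<bar> * s" using s by (intro mult_right_mono) auto
    also have "\<dots> \<le> \<bar>c\<bar> * T" using s by (intro mult_left_mono) auto
    finally have e: "exp (c * s) \<le> exp (\<bar>c\<bar> * T)" by simp
    have "\<bar>?U s + c * ?u s\<bar> \<le> B + B"
      unfolding c_def coll_K_Gamma_eq[OF I phase_boundedD(1)[OF h], symmetric]
      by (rule order_trans[OF abs_triangle_ineq add_mono[OF B]])
    with e show ?thesis unfolding P_def abs_mult by (intro mult_mono) auto
  qed
  from abs_prim_on_primitive[OF Pm this]
  have A: "abs_prim_on T (\<lambda>t. f0 x v I + (LBINT s:{0..t}. P s)) P" .
  have D: "abs_prim_on T (\<lambda>t. exp (0 + (- c) * t) * (f0 x v I + (LBINT s:{0..t}. P s)))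
     (\<lambda>t. exp (0 + (- c) * t) * P t + exp (0 + (- c) * t) * (- c) * (f0 x v I + (LBINT s:{0..t}. P s)))"
    by (rule abs_prim_on_mult[OF abs_prim_on_exp[OF abs_prim_on_const_slope] A])
  show "abs_prim_on T ?u ?U"
  proof (rule abs_prim_on_cong[OF D])
    fix t assume t: "t \<in> {0..T}"
    show u: "?u t = exp (0 + (- c) * t) * (f0 x v I + (LBINT s:{0..t}. P s))"
      using duh[OF t] by (simp add: P_def)
    have a: "exp (0 + (- c) * t) * P t = ?U t + c * ?u t"
      unfolding P_def mult.assoc[symmetric] exp_add[symmetric] by simp
    have b: "exp (0 + (- c) * t) * (- c) * (f0 x v I + (LBINT s:{0..t}. P s)) = - c * ?u t"
      unfolding u by simp
    show "?U t = exp (0 + (- c) * t) * P t + exp (0 + (- c) * t) * (- c) * (f0 x v I + (LBINT s:{0..t}. P s))"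
      unfolding a b by simp
  qed measurable
qed

end

section \<open>Fixed point and local well-posedness\<close>

lemma geometric_increments_converge:
  fixes a :: "nat \<Rightarrow> real"
  assumes inc: "\<And>n. \<bar>a (Suc n) - a n\<bar> \<le> c * (1 / 2) ^ n"
  shows "a \<longlonglongrightarrow> lim a" and "\<bar>a n - lim a\<bar> \<le> 2 * c * (1 / 2) ^ n"
proof -
  have "summable (\<lambda>n. a (Suc n) - a n)"
    by (rule summable_comparison_test'[where g="\<lambda>n. c * (1 / 2) ^ n" and N=0])
       (use inc in \<open>auto intro!: summable_mult summable_geometric\<close>)
  then have "convergent (\<lambda>n. a 0 + (\<Sum>i<n. a (Suc i) - a i))"
    by (intro convergent_add convergent_const) (simp add: summable_iff_convergent)
  then have "convergent a" by (simp add: sum_lessThan_telescope)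
  then show lim: "a \<longlonglongrightarrow> lim a" by (simp add: convergent_LIMSEQ_iff)
  have step: "\<bar>a n - a (n + k)\<bar> \<le> 2 * c * (1 / 2) ^ n - 2 * c * (1 / 2) ^ (n + k)" for n k
  proof (induction k)
    case (Suc k)
    have "\<bar>a n - a (n + Suc k)\<bar> \<le> \<bar>a n - a (n + k)\<bar> + \<bar>a (Suc (n + k)) - a (n + k)\<bar>" by simp
    also have "\<dots> \<le> 2 * c * (1 / 2) ^ n - 2 * c * (1 / 2) ^ (n + k) + c * (1 / 2) ^ (n + k)"
      using Suc inc[of "n + k"] by linarith
    also have "\<dots> = 2 * c * (1 / 2) ^ n - 2 * c * (1 / 2) ^ (n + Suc k)" by simp
    finally show ?case .
  qed simp
  have c: "0 \<le> c" using inc[of 0] by simp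
  have "(\<lambda>k. \<bar>a n - a (k + n)\<bar>) \<longlonglongrightarrow> \<bar>a n - lim a\<bar>"
    by (intro tendsto_intros LIMSEQ_ignore_initial_segment lim)
  then show "\<bar>a n - lim a\<bar> \<le> 2 * c * (1 / 2) ^ n"
  proof (rule LIMSEQ_le_const2, intro exI allI impI)
    fix k
    have "0 \<le> 2 * c * (1 / 2) ^ (n + k)" using c by simp
    with step[of n k] show "\<bar>a n - a (k + n)\<bar> \<le> 2 * c * (1 / 2) ^ n" by (simp add: add.commute)
  qed
qed

lemma sup_norm_le_iff:
  assumes "0 \<le> R"
  shows "sup_norm g \<le> ennreal R \<longleftrightarrow> (\<forall>x v I. 0 < I \<longrightarrow> \<bar>g x v I\<bar> \<le> R)"
  unfolding sup_norm_def using assms by (auto simp: SUP_le_iff ennreal_le_iff)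

context polyatomic_kernel
begin

context
  fixes T R b :: real and f0 :: "real^3 \<Rightarrow> real^3 \<Rightarrow> real \<Rightarrow> real"
  assumes T: "0 \<le> T"
    and f0m: "(\<lambda>z. f0 (fst z) (fst (snd z)) (snd (snd z))) \<in> borel_measurable borel"
    and f0: "\<And>x v I. 0 < I \<Longrightarrow> \<bar>f0 x v I\<bar> \<le> R / w v I" "\<And>x v I. 0 < I \<Longrightarrow> 0 \<le> sqrtM v I + f0 x v I"
    and f0t: "\<And>x v I k. 0 < I \<Longrightarrow> f0 (x + axis k (2 * pi)) v I = f0 x v I"
    and b: "0 \<le> b" and invariant: "R + T * (op_const * (3 * maxw_bound + 1) * (b * (1 + b))) \<le> b"
    and contraction: "T * (op_const * (3 * maxw_bound + 3 * b)) \<le> 1 / 2"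
begin

lemma phase_bounded_char_step: "phase_bounded b f \<Longrightarrow> phase_bounded b (char_step T f0 f)"
  by (rule char_step_phase_bounded[OF _ f0m T f0 f0t invariant])

lemma char_solution_contraction:
  assumes y1: "char_solution T f0 f1 y1" and y2: "char_solution T f0 f2 y2"
    and f1: "phase_bounded b f1" and f2: "phase_bounded b f2" and y2b: "phase_bounded b y2"
    and d: "0 \<le> d" and fd: "\<And>t x v I. t \<in> {0..T} \<Longrightarrow> 0 < I \<Longrightarrow> \<bar>f1 t x v I - f2 t x v I\<bar> \<le> d"
    and t: "t \<in> {0..T}" and I: "0 < I"
  shows "\<bar>y1 t x v I - y2 t x v I\<bar> \<le> 1 / 2 * d"
proof -
  have "\<bar>y1 t x v I - y2 t x v I\<bar> \<le> T * (op_const * (3 * maxw_bound + 3 * b)) * d"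
    by (rule char_solution_diff[OF y1 y2 f1 f2 phase_boundedD(5)[OF y2b] d fd t I])
  also have "\<dots> \<le> 1 / 2 * d" by (rule mult_right_mono[OF contraction d])
  finally show ?thesis .
qed

text \<open>The contraction estimate halves any bound on the difference of two solutions.\<close>

lemma char_fixed_point_unique:
  assumes f: "phase_bounded b f" "char_solution T f0 f f" and g: "phase_bounded b g" "char_solution T f0 g g"
    and t: "t \<in> {0..T}" and I: "0 < I"
  shows "f t x v I = g t x v I"
proof -
  have bd: "\<bar>f t x v I - g t x v I\<bar> \<le> (2 * b) * (1 / 2) ^ n" if "t \<in> {0..T}" "0 < I" for n t x v I
    using that
  proof (induction n arbitrary: t x v I)
    case 0
    have "bounded_by b (f t x)" "bounded_by b (g t x)"
      using phase_boundedD(1)[OF f(1)] phase_boundedD(1)[OF g(1)] by (auto intro: weight_bounded_imp_bounded)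
    then have "\<bar>f t x v I\<bar> \<le> b" "\<bar>g t x v I\<bar> \<le> b" using 0 by (auto simp: bounded_by_def)
    then show ?case by simp
  next
    case (Suc n)
    have "\<bar>f t x v I - g t x v I\<bar> \<le> 1 / 2 * ((2 * b) * (1 / 2) ^ n)"
      by (rule char_solution_contraction[OF f(2) g(2) f(1) g(1) g(1) _ Suc.IH Suc.prems]) (use b in auto)
    then show ?case by simp
  qed
  have "(\<lambda>n. (2 * b) * (1 / 2) ^ n) \<longlonglongrightarrow> (2 * b) * 0"
    by (intro tendsto_intros) simp
  then have "\<bar>f t x v I - g t x v I\<bar> \<le> (2 * b) * 0"
    by (rule LIMSEQ_le_const) (use bd[OF t I] in blast)
  then show ?thesis by simp
qed

text \<open>Iterates of the linear problem, starting from the equilibrium \<open>f = 0\<close>, converge geometrically in the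
  norm without weight, and the weighted bound passes to the limit pointwise.\<close>

lemma char_fixed_point_exists: "\<exists>f. phase_bounded b f \<and> char_solution T f0 f f"
proof -
  define F where "F = (\<lambda>n. (char_step T f0 ^^ n) (\<lambda>_ _ _ _. 0))"
  have FS: "F (Suc n) = char_step T f0 (F n)" for n by (simp add: F_def)
  have F: "phase_bounded b (F n)" for n
  proof (induction n)
    case 0
    have "0 \<le> b / w v I" "0 \<le> sqrtM v I" if "0 < I" for v I
      using b weight_ge_1[of I v] maxwellian_pos[OF that, of v] that by auto
    then show ?case using b by (simp add: F_def phase_bounded_def borel4_def)
  next
    case (Suc n)
    then show ?case unfolding FS by (rule phase_bounded_char_step)
  qed
  have sol: "char_solution T f0 (F n) (F (Suc n))" for n
    unfolding FS by (rule char_step_solution[OF F f0m T])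
  have out: "F n t x v I = 0" if "\<not> (t \<in> {0..T} \<and> 0 < I)" for n t x v I
    using that by (cases n) (auto simp: F_def char_step_def)
  have inc: "\<bar>F (Suc n) t x v I - F n t x v I\<bar> \<le> (2 * b) * (1 / 2) ^ n" for n t x v I
  proof (cases "t \<in> {0..T} \<and> 0 < I")
    case True
    then have "t \<in> {0..T}" "0 < I" by auto
    then show ?thesis
    proof (induction n arbitrary: t x v I)
      case 0
      have "bounded_by b (F n t x)" for n
        using phase_boundedD(1)[OF F] by (rule weight_bounded_imp_bounded)
      then have "\<bar>F n t x v I\<bar> \<le> b" for n using 0 by (auto simp: bounded_by_def)
      from this[of 1] this[of 0] show ?case by simp
    next
      case (Suc n)
      have "\<bar>F (Suc (Suc n)) t x v I - F (Suc n) t x v I\<bar> \<le> 1 / 2 * ((2 * b) * (1 / 2) ^ n)"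
        by (rule char_solution_contraction[OF sol sol F F F _ Suc.IH Suc.prems]) (use b in auto)
      then show ?case by simp
    qed
  next
    case False
    then show ?thesis using out[OF False] b by simp
  qed
  define f where "f = (\<lambda>t x v I. lim (\<lambda>n. F n t x v I))"
  have lim: "(\<lambda>n. F n t x v I) \<longlonglongrightarrow> f t x v I" for t x v I
    unfolding f_def by (rule geometric_increments_converge(1)[OF inc])
  have err: "\<bar>F n t x v I - f t x v I\<bar> \<le> 2 * (2 * b) * (1 / 2) ^ n" for n t x v I
    unfolding f_def by (rule geometric_increments_converge(2)[OF inc])
  have fp: "phase_bounded b f"
    unfolding phase_bounded_def
  proof (intro conjI allI impI)
    show "borel4 f"
      unfolding borel4_def
      by (rule borel_measurable_LIMSEQ_real[OF lim]) (use phase_boundedD(2)[OF F] in \<open>simp add: borel4_def\<close>)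
    show "0 \<le> b" by (rule b)
    fix t x v I
    show "\<bar>f t x v I\<bar> \<le> b / w v I" if "0 < I"
      by (rule LIMSEQ_le_const2[OF tendsto_rabs[OF lim]]) (use phase_boundedD(5)[OF F that] in blast)
    show "0 \<le> sqrtM v I + f t x v I" if "0 < I"
      by (rule LIMSEQ_le_const[OF tendsto_add[OF tendsto_const lim]]) (use phase_boundedD(4)[OF F that] in blast)
    show "f t x v I = 0" if "I \<le> 0"
      unfolding f_def using out[of t I] that by (simp add: limI)
    show "f t (x + axis k (2 * pi)) v I = f t x v I" for k
      unfolding f_def using F by (simp add: phase_bounded_def)
  qed
  note solf = char_step_solution[OF fp f0m T]
  have "char_step T f0 f = f"
  proof (intro ext)
    fix t x v I
    show "char_step T f0 f t x v I = f t x v I"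
    proof (cases "t \<in> {0..T} \<and> 0 < I")
      case True
      then have t: "t \<in> {0..T}" and I: "0 < I" by auto
      have le: "norm (F (Suc n) t x v I - char_step T f0 f t x v I) \<le> 1 / 2 * (2 * (2 * b) * (1 / 2) ^ n)" for n
        unfolding real_norm_def
        by (rule char_solution_contraction[OF sol solf F fp phase_bounded_char_step[OF fp] _ err t I]) (use b in auto)
      have "(\<lambda>n. 1 / 2 * (2 * (2 * b) * (1 / 2) ^ n)) \<longlonglongrightarrow> 1 / 2 * (2 * (2 * b) * 0)"
        by (intro tendsto_intros) simp
      then have "(\<lambda>n. 1 / 2 * (2 * (2 * b) * (1 / 2) ^ n)) \<longlonglongrightarrow> 0" by simp
      with always_eventually[OF allI[OF le]]
      have "(\<lambda>n. F (Suc n) t x v I - char_step T f0 f t x v I) \<longlonglongrightarrow> 0"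
        by (rule Lim_null_comparison)
      then have "(\<lambda>n. F (Suc n) t x v I) \<longlonglongrightarrow> char_step T f0 f t x v I"
        by (simp add: LIM_zero_iff)
      moreover have "(\<lambda>n. F (Suc n) t x v I) \<longlonglongrightarrow> f t x v I" by (rule LIMSEQ_Suc[OF lim])
      ultimately show ?thesis by (rule LIMSEQ_unique)
    next
      case False
      then have "f t x v I = 0" unfolding f_def by (simp add: out limI)
      moreover have "char_step T f0 f t x v I = 0" using False by (auto simp: char_step_def)
      ultimately show ?thesis by simp
    qed
  qed
  with solf fp show ?thesis by auto
qed

end

definition local_const :: real where
  "local_const = 4 * op_const * (maxw_bound + 1)"

lemma local_const_pos: "0 < local_const"
  using op_const_ge(1) maxw_bound(1) by (simp add: local_const_def)

text \<open>With \<open>b = 2 R\<close> the two conditions say that the invariant set is preserved and that the step is a contraction.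
  The constant \<open>local_const\<close> is chosen for them.\<close>

lemma local_time_admissible:
  assumes R: "0 \<le> R" and T: "T = 1 / (8 * local_const * (1 + R))"
  shows "R + T * (op_const * (3 * maxw_bound + 1) * (2 * R * (1 + 2 * R))) \<le> 2 * R"
    and "T * (op_const * (3 * maxw_bound + 3 * (2 * R))) \<le> 1 / 2"
proof -
  let ?K = op_const and ?m = maxw_bound
  have K: "1 \<le> ?K" and m: "1 \<le> ?m" using op_const_ge(1) maxw_bound(1) by auto
  define D where "D = 8 * local_const * (1 + R)"
  have D: "0 < D" "D = 32 * ?K * ((?m + 1) * (1 + R))"
    using local_const_pos R by (auto simp: D_def local_const_def)
  have T': "T * x = x / D" for x by (simp add: T D_def)
  have "(3 * ?m + 1) * (1 + 2 * R) \<le> (4 * (?m + 1)) * (2 * (1 + R))"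
    using R m by (intro mult_mono) auto
  then have "?K * ((3 * ?m + 1) * (1 + 2 * R)) \<le> ?K * ((4 * (?m + 1)) * (2 * (1 + R)))"
    using K by (intro mult_left_mono) auto
  also have "\<dots> = D / 4" unfolding D(2) by (simp add: algebra_simps)
  finally have "(2 * R) * (?K * ((3 * ?m + 1) * (1 + 2 * R))) \<le> (2 * R) * (D / 4)"
    using R by (intro mult_left_mono) auto
  then have "?K * (3 * ?m + 1) * (2 * R * (1 + 2 * R)) \<le> R / 2 * D" by (simp add: algebra_simps)
  then have "T * (?K * (3 * ?m + 1) * (2 * R * (1 + 2 * R))) \<le> R / 2"
    unfolding T' using D(1) by (simp add: pos_divide_le_eq)
  then show "R + T * (?K * (3 * ?m + 1) * (2 * R * (1 + 2 * R))) \<le> 2 * R" using R by linarith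
  have "3 * ?m + 3 * (2 * R) \<le> 6 * ((?m + 1) * (1 + R))"
    using R m by (simp add: algebra_simps)
  then have "?K * (3 * ?m + 3 * (2 * R)) \<le> ?K * (6 * ((?m + 1) * (1 + R)))"
    using K by (intro mult_left_mono) auto
  also have "\<dots> \<le> 1 / 2 * D" unfolding D(2) using K m R by simp
  finally show "T * (?K * (3 * ?m + 3 * (2 * R))) \<le> 1 / 2"
    unfolding T' using D(1) by (simp add: pos_divide_le_eq)
qed

lemma abs_weight_mult_le_iff: "0 < I \<Longrightarrow> \<bar>w v I * x\<bar> \<le> R \<longleftrightarrow> \<bar>x\<bar> \<le> R / w v I"
  using weight_ge_1[of I v] by (simp add: abs_mult pos_le_divide_eq mult.commute)

lemma perturbation_nonneg_iff: "0 < I \<Longrightarrow> 0 \<le> M v I + sqrtM v I * x \<longleftrightarrow> 0 \<le> sqrtM v I + x"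
proof -
  assume I: "0 < I"
  then have m: "0 < sqrtM v I" "M v I = sqrtM v I * sqrtM v I" using maxwellian_pos[OF I, of v] by auto
  have "M v I + sqrtM v I * x = sqrtM v I * (sqrtM v I + x)" by (subst m(2)) (simp only: distrib_left)
  then show ?thesis using m(1) by (simp add: zero_le_mult_iff)
qed

lemma local_mild_solution:
  fixes F0 f0 :: "real^3 \<Rightarrow> real^3 \<Rightarrow> real \<Rightarrow> real"
  assumes adm: "admissible_data f0"
    and F0: "\<And>x v I. 0 < I \<Longrightarrow> F0 x v I = M v I + sqrtM v I * f0 x v I \<and> 0 \<le> F0 x v I"
    and R: "0 \<le> R" "sup_norm (\<lambda>x v I. w v I * f0 x v I) = ennreal R"
    and T: "T = 1 / (8 * local_const * (1 + R))"
  defines "sol \<equiv> \<lambda>F f. mild_solution \<delta> \<alpha> C T f0 F f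
                  \<and> (\<forall>t\<in>{0..T}. \<forall>x v. \<forall>I>0. 0 \<le> F t x v I)
                  \<and> (SUP t\<in>{0..T}. sup_norm (\<lambda>x v I. w v I * f t x v I)) \<le> ennreal (2 * R)"
  shows "\<exists>F f. sol F f \<and> (\<forall>G g. sol G g \<longrightarrow> (\<forall>t\<in>{0..T}. \<forall>x v. \<forall>I>0. G t x v I = F t x v I))"
proof -
  have T0: "0 \<le> T" using local_const_pos R by (simp add: T)
  \<comment> \<open>\<open>f0\<close> is Borel only on \<open>I > 0\<close>; extension by zero makes it Borel everywhere\<close>
  define h0 where "h0 = (\<lambda>x v I. if 0 < I then f0 x v I else 0)"
  have h0: "h0 x v I = f0 x v I" if "0 < I" for x v I using that by (simp add: h0_def)
  have h0m: "(\<lambda>z. h0 (fst z) (fst (snd z)) (snd (snd z))) \<in> borel_measurable borel"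
  proof -
    let ?\<Omega> = "UNIV \<times> UNIV \<times> {0<..} :: ((real^3) \<times> (real^3) \<times> real) set"
    have "?\<Omega> = {z. 0 < snd (snd z)}" by auto
    also have "\<dots> \<in> sets borel" by measurable
    finally have "(\<lambda>z. indicator ?\<Omega> z *\<^sub>R (case z of (x, v, I) \<Rightarrow> f0 x v I)) \<in> borel_measurable borel"
      using adm by (simp add: admissible_data_def borel_measurable_restrict_space_iff)
    also have "(\<lambda>z. indicator ?\<Omega> z *\<^sub>R (case z of (x, v, I) \<Rightarrow> f0 x v I)) = (\<lambda>z. h0 (fst z) (fst (snd z)) (snd (snd z)))"
      by (auto simp: h0_def indicator_def fun_eq_iff)
    finally show ?thesis .
  qed
  have h0R: "\<bar>h0 x v I\<bar> \<le> R / w v I" if "0 < I" for x v I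
    using R(2) sup_norm_le_iff[OF R(1), of "\<lambda>x v I. w v I * f0 x v I"] that
    by (simp add: h0 abs_weight_mult_le_iff)
  have h0p: "0 \<le> sqrtM v I + h0 x v I" if "0 < I" for x v I
    using F0[OF that, of x v] perturbation_nonneg_iff[OF that, of v "f0 x v I"] by (simp add: h0[OF that])
  have h0t: "h0 (x + axis k (2 * pi)) v I = h0 x v I" if "0 < I" for x v I k
    using adm that by (simp add: h0 admissible_data_def torus_fun_def)
  have R2: "0 \<le> 2 * R" using R by simp
  note conds = T0 h0m h0R h0p h0t R2 local_time_admissible[OF R(1) T]
  obtain f where f: "phase_bounded (2 * R) f" "char_solution T h0 f f"
    using char_fixed_point_exists[OF conds] by blast
  define F where "F = (\<lambda>t x v I. M v I + sqrtM v I * f t x v I)"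
  have bound: "(SUP t\<in>{0..T}. sup_norm (\<lambda>x v I. w v I * g t x v I)) \<le> ennreal (2 * R) \<longleftrightarrow>
      (\<forall>t\<in>{0..T}. \<forall>x v I. 0 < I \<longrightarrow> \<bar>g t x v I\<bar> \<le> 2 * R / w v I)" for g
    by (simp add: SUP_le_iff sup_norm_le_iff[OF R2] abs_weight_mult_le_iff cong: imp_cong)
  have "mild_perturbation \<delta> \<alpha> C T f0 f"
    by (rule char_solution_imp_mild[OF f h0])
  then have solf: "sol F f"
    using phase_boundedD(4,5)[OF f(1)] perturbation_nonneg_iff
    unfolding sol_def bound mild_solution_def by (auto simp: F_def)
  have "G t x v I = F t x v I" if G: "sol G g" and t: "t \<in> {0..T}" and I: "0 < I" for G g t x v I
  proof -
    have mild: "mild_perturbation \<delta> \<alpha> C T f0 g"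
      and GF: "\<And>t x v I. t \<in> {0..T} \<Longrightarrow> 0 < I \<Longrightarrow> G t x v I = M v I + sqrtM v I * g t x v I"
      and Gp: "\<And>t x v I. t \<in> {0..T} \<Longrightarrow> 0 < I \<Longrightarrow> 0 \<le> G t x v I"
      and gb: "\<And>t x v I. t \<in> {0..T} \<Longrightarrow> 0 < I \<Longrightarrow> \<bar>g t x v I\<bar> \<le> 2 * R / w v I"
      using G unfolding sol_def bound mild_solution_def by auto
    have gt: "\<forall>t\<in>{0..T}. torus_fun (g t)"
      and gm: "(\<lambda>(t, x, v, I). g t x v I) \<in> borel_measurable (restrict_space borel ({0..T} \<times> UNIV \<times> UNIV \<times> {0<..}))"
      using mild unfolding mild_perturbation_def by blast+
    \<comment> \<open>a competing solution is unconstrained off this set and is cut off there to enter the invariant class\<close>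
    define h where "h = (\<lambda>t x v I. if t \<in> {0..T} \<and> 0 < I then g t x v I else 0)"
    have hg: "h t x v I = g t x v I" if "t \<in> {0..T}" "0 < I" for t x v I using that by (simp add: h_def)
    have hp: "phase_bounded (2 * R) h"
      unfolding phase_bounded_def
    proof (intro conjI allI impI)
      let ?\<Omega> = "{0..T} \<times> UNIV \<times> UNIV \<times> {0<..} :: (real \<times> (real^3) \<times> (real^3) \<times> real) set"
      have "?\<Omega> = {z. 0 \<le> fst z \<and> fst z \<le> T \<and> 0 < snd (snd (snd z))}" by auto
      also have "\<dots> \<in> sets borel" by measurable
      finally have "?\<Omega> \<inter> space borel \<in> sets borel" by (simp only: space_borel Int_UNIV_right)
      from iffD1[OF borel_measurable_restrict_space_iff[OF this] gm]
      have "(\<lambda>z. indicator ?\<Omega> z *\<^sub>R (case z of (t, x, v, I) \<Rightarrow> g t x v I)) \<in> borel_measurable borel" .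
      also have "(\<lambda>z. indicator ?\<Omega> z *\<^sub>R (case z of (t, x, v, I) \<Rightarrow> g t x v I))
          = (\<lambda>z. h (fst z) (fst (snd z)) (fst (snd (snd z))) (snd (snd (snd z))))"
        by (auto simp: h_def indicator_def fun_eq_iff)
      finally show "borel4 h" by (simp add: borel4_def)
      show "0 \<le> 2 * R" by (rule R2)
      fix t :: real and x v :: "real^3" and I :: real
      show "\<bar>h t x v I\<bar> \<le> 2 * R / w v I" if "0 < I"
        using that gb[of t I x v] R2 weight_ge_1[of I v] by (auto simp: h_def)
      show "0 \<le> sqrtM v I + h t x v I" if I: "0 < I"
        using Gp[of t I x v] GF[of t I x v] perturbation_nonneg_iff[OF I, of v "g t x v I"] I maxwellian_pos[OF I, of v]
        by (auto simp: h_def)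
      show "h t x v I = 0" if "I \<le> 0" using that by (simp add: h_def)
      show "h t (x + axis k (2 * pi)) v I = h t x v I" for k
        using gt by (auto simp: h_def torus_fun_def)
    qed
    have "char_solution T f0 h h" by (rule mild_imp_char_solution[OF mild hp hg T0])
    then have "char_solution T h0 h h" by (simp add: char_solution_def h0 cong: imp_cong)
    from char_fixed_point_unique[OF conds hp this f t I] show ?thesis
      using GF[OF t I] by (simp add: hg[OF t I] F_def)
  qed
  with solf show ?thesis by blast
qed

end

theorem theorem1p1:
  fixes \<delta> \<alpha> C\<^sub>\<sigma> \<beta> :: real
  assumes "2 \<le> \<delta>" and "0 \<le> \<alpha>" and "\<alpha> \<le> 2" and "0 < C\<^sub>\<sigma>" and "5 < \<beta>"
  shows "\<exists>C1>0. \<forall>F0 f0.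
    admissible_data f0 \<longrightarrow>
    (\<forall>x v. \<forall>I>0. F0 x v I = maxwellian \<delta> v I + sqrt (maxwellian \<delta> v I) * f0 x v I
                  \<and> 0 \<le> F0 x v I) \<longrightarrow>
    sup_norm (\<lambda>x v I. weight \<beta> v I * f0 x v I) < \<infinity> \<longrightarrow>
    (let T1 = 1 / (8 * C1 * (1 + enn2real (sup_norm (\<lambda>x v I. weight \<beta> v I * f0 x v I))));
         sol = (\<lambda>F f. mild_solution \<delta> \<alpha> C\<^sub>\<sigma> T1 f0 F f
                  \<and> (\<forall>t\<in>{0..T1}. \<forall>x v. \<forall>I>0. 0 \<le> F t x v I)
                  \<and> (SUP t\<in>{0..T1}. sup_norm (\<lambda>x v I. weight \<beta> v I * f t x v I))
                      \<le> 2 * sup_norm (\<lambda>x v I. weight \<beta> v I * f0 x v I))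
     in 0 < T1
        \<and> (\<exists>F f. sol F f
             \<and> (\<forall>G g. sol G g \<longrightarrow>
                  (\<forall>t\<in>{0..T1}. \<forall>x v. \<forall>I>0. G t x v I = F t x v I))))"
proof -
  interpret polyatomic_kernel \<delta> \<alpha> C\<^sub>\<sigma> \<beta>
    by unfold_locales (use assms in auto)
  show ?thesis
  proof (intro exI[of _ local_const] conjI allI impI local_const_pos)
    fix F0 f0 :: "real^3 \<Rightarrow> real^3 \<Rightarrow> real \<Rightarrow> real"
    let ?N = "sup_norm (\<lambda>x v I. weight \<beta> v I * f0 x v I)"
    assume adm: "admissible_data f0"
      and F0: "\<forall>x v. \<forall>I>0. F0 x v I = maxwellian \<delta> v I + sqrt (maxwellian \<delta> v I) * f0 x v I \<and> 0 \<le> F0 x v I"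
      and fin: "?N < \<infinity>"
    define R where "R = enn2real ?N"
    have R: "0 \<le> R" "?N = ennreal R" using fin by (simp_all add: R_def)
    have N2: "2 * ?N = ennreal (2 * R)" unfolding R(2) using R(1) by (simp add: ennreal_mult)
    have "0 < 1 / (8 * local_const * (1 + R))" using local_const_pos R(1) by simp
    then show "let T1 = 1 / (8 * local_const * (1 + enn2real ?N));
         sol = (\<lambda>F f. mild_solution \<delta> \<alpha> C\<^sub>\<sigma> T1 f0 F f
                  \<and> (\<forall>t\<in>{0..T1}. \<forall>x v. \<forall>I>0. 0 \<le> F t x v I)
                  \<and> (SUP t\<in>{0..T1}. sup_norm (\<lambda>x v I. weight \<beta> v I * f t x v I)) \<le> 2 * ?N)
     in 0 < T1
        \<and> (\<exists>F f. sol F f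
             \<and> (\<forall>G g. sol G g \<longrightarrow>
                  (\<forall>t\<in>{0..T1}. \<forall>x v. \<forall>I>0. G t x v I = F t x v I)))"
      unfolding Let_def N2 R_def[symmetric]
      using local_mild_solution[OF adm _ R refl, of F0] F0 by blast
  qed
qed

end
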